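(* Let $f\in\operatorname{Sym}\mathscr P\langle\mathbf q,\bar{\mathbf q}\rangle$, $g_1,\dots,g_m\in\operatorname{Sym}\mathbb R\langle\mathbf q,\bar{\mathbf q}\rangle$, and $h_1,\dots,h_\ell\in\mathbb R\langle\mathbf q,\bar{\mathbf q}\rangle$. Assume that $\mathcal Q^{\mathbb H}(\mathbf g,\mathbf h)$ satisfies the Archimedean condition. If $f>0$ on $K_{\mathbf g,\mathbf h}$, then $$f\in\mathcal Q^{\mathbb H}(\mathbf g,\mathbf h)+\left(\mathcal I_n^{\mathbb H}\cap\operatorname{Sym}\mathscr P\langle\mathbf q,\bar{\mathbf q}\rangle\right).$$
   Context: $\mathbb H$ is the skew field of quaternions. Fix $n\ge1$ and letters $q_1,\dots,q_n,\bar q_1,\dots,\bar q_n$. $\mathcal W$ is the set of words (including the empty word $1$) in these letters, where words with the same normal form are identified: any consecutive factor $q_i\bar q_i$ or $\bar q_iq_i$ is written $|q_i|^2$ and moved to the front, so each word is uniquely $\prod_i|q_i|^{2\alpha_i}\tilde w$ with $\tilde w$ containing no such factor. $w^*$ is obtained by reversing $w$ and exchanging $q_i\leftrightarrow\bar q_i$. $\mathbb R\langle\mathbf q,\bar{\mathbf q}\rangle$ is the real $*$-algebra of finite sums $\sum_wp_ww$, $p_w\in\mathbb R$, with $p^*=\sum_wp_ww^*$. $\mathbb H\langle\mathbf q,\bar{\mathbf q}\rangle$ is the real free product of $\mathbb H$ (involution: conjugation) and $\mathbb R\langle\mathbf q,\bar{\mathbf q}\rangle$; quaternionic constants do not commute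 with letters. Inside it, $\mathcal L$ is the space of left-coefficient polynomials $\sum_wp_ww$, $p_w\in\mathbb H$, and $\mathscr P\langle\mathbf q,\bar{\mathbf q}\rangle$ is the space of finite sums $\sum_{a,b\in\mathcal W}a\,p_{a,b}\,b$ with $p_{a,b}\in\mathbb H$ (middle-coefficient polynomials), with $(a\,c\,b)^*=b^*\bar c\,a^*$. $\operatorname{Sym}$ denotes the set of elements with $p=p^*$. Evaluation at $\mathbf a\in\mathbb H^n$ means $q_i\mapsto a_i$, $\bar q_i\mapsto\bar a_i$; symmetric middle-coefficient polynomials take real values. $K_{\mathbf g,\mathbf h}=\{\mathbf a\in\mathbb H^n: g_i(\mathbf a,\bar{\mathbf a})\ge0\ (1\le i\le m),\ h_j(\mathbf a,\bar{\mathbf a})=0\ (1\le j\le\ell)\}$. $\mathcal I_n^{\mathbb H}$ is the two-sided $*$-ideal of all elements of $\mathbb H\langle\mathbf q,\bar{\mathbf q}\rangle$ that vanish under evaluation at every $\mathbf a\in\mathbb H^n$. $\Sigma^{\mathbb H}$ is the set of finite sums $\sum_sp_s^*p_s$ with $p_s\in\mathcal L$. $\mathcal Q^{\mathbb H}(\mathbf g,\mathbf h)$ is the set of all $$\sigma_0+\tfrac12\sum_{i=1}^m(\sigma_ig_i+g_i\sigma_i)+\sum_{j=1}^\ell\sum_\alpha\left(\tau_{j\alpha}h_j\nu_{j\alpha}^*+\nu_{j\alpha}h_j^*\tau_{j\alpha}^*\right)$$ (finite sums) with $\sigma_i\in\Sigma^{\mathbb H}$, $\tau_{j\alpha},\nu_{j\alpha}\in\mathcal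 L$. The Archimedean condition is: there exists $R>0$ with $R-\sum_{i=1}^n|q_i|^2\in\mathcal Q^{\mathbb H}(\mathbf g,\mathbf h)$. *)

theory Defs
  imports "HOL-Analysis.Analysis" "HOL-Library.Poly_Mapping"
begin

section \<open>Quaternions\<close>

codatatype quat = Quat (qRe: real) (qI: real) (qJ: real) (qK: real)

lemma quat_eqI [intro?]:
  "\<lbrakk>qRe x = qRe y; qI x = qI y; qJ x = qJ y; qK x = qK y\<rbrakk> \<Longrightarrow> x = y"
  by (rule quat.expand) simp

lemma quat_eq_iff: "x = y \<longleftrightarrow> qRe x = qRe y \<and> qI x = qI y \<and> qJ x = qJ y \<and> qK x = qK y"
  by (auto intro: quat_eqI)

instantiation quat :: ab_group_add
begin

primcorec zero_quat where
  "qRe 0 = 0" | "qI 0 = 0" | "qJ 0 = 0" | "qK 0 = 0"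

primcorec plus_quat where
  "qRe (x + y) = qRe x + qRe y"
| "qI (x + y) = qI x + qI y"
| "qJ (x + y) = qJ x + qJ y"
| "qK (x + y) = qK x + qK y"

primcorec uminus_quat where
  "qRe (- x) = - qRe x"
| "qI (- x) = - qI x"
| "qJ (- x) = - qJ x"
| "qK (- x) = - qK x"

primcorec minus_quat where
  "qRe (x - y) = qRe x - qRe y"
| "qI (x - y) = qI x - qI y"
| "qJ (x - y) = qJ x - qJ y"
| "qK (x - y) = qK x - qK y"

instance
  by standard (simp_all add: quat_eq_iff)

end

instantiation quat :: real_algebra_1
begin

primcorec one_quat where
  "qRe 1 = 1" | "qI 1 = 0" | "qJ 1 = 0" | "qK 1 = 0"

primcorec times_quat where
  "qRe (x * y) = qRe x * qRe y - qI x * qI y - qJ x * qJ y - qK x * qK y"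
| "qI (x * y) = qRe x * qI y + qI x * qRe y + qJ x * qK y - qK x * qJ y"
| "qJ (x * y) = qRe x * qJ y - qI x * qK y + qJ x * qRe y + qK x * qI y"
| "qK (x * y) = qRe x * qK y + qI x * qJ y - qJ x * qI y + qK x * qRe y"

primcorec scaleR_quat where
  "qRe (scaleR r x) = r * qRe x"
| "qI (scaleR r x) = r * qI x"
| "qJ (scaleR r x) = r * qJ x"
| "qK (scaleR r x) = r * qK x"

instance
  by standard (simp_all add: quat_eq_iff algebra_simps)

end

primcorec qcnj :: "quat \<Rightarrow> quat" where
  "qRe (qcnj x) = qRe x"
| "qI (qcnj x) = - qI x"
| "qJ (qcnj x) = - qJ x"
| "qK (qcnj x) = - qK x"

definition qnorm2 :: "quat \<Rightarrow> real" where
  "qnorm2 x = (qRe x)\<^sup>2 + (qI x)\<^sup>2 + (qJ x)\<^sup>2 + (qK x)\<^sup>2"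

lemma qnorm2_eq_0_iff: "qnorm2 x = 0 \<longleftrightarrow> x = 0"
proof
  assume h: "qnorm2 x = 0"
  have "(qRe x)\<^sup>2 = 0 \<and> (qI x)\<^sup>2 = 0 \<and> (qJ x)\<^sup>2 = 0 \<and> (qK x)\<^sup>2 = 0"
    using h zero_le_power2[of "qRe x"] zero_le_power2[of "qI x"] zero_le_power2[of "qJ x"]
      zero_le_power2[of "qK x"] unfolding qnorm2_def by linarith
  then show "x = 0" by (simp add: quat_eq_iff)
qed (simp add: qnorm2_def)

lemma of_real_quat_sel [simp]:
  "qRe (of_real r) = r" "qI (of_real r) = 0" "qJ (of_real r) = 0" "qK (of_real r) = 0"
  by (simp_all add: of_real_def)

lemma qcnj_mult_self: "qcnj x * x = of_real (qnorm2 x)" "x * qcnj x = of_real (qnorm2 x)"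
  by (simp_all add: quat_eq_iff qnorm2_def power2_eq_square algebra_simps)

lemma qcnj_simps [simp]:
  "qcnj (x + y) = qcnj x + qcnj y" "qcnj (x * y) = qcnj y * qcnj x"
  "qcnj (qcnj x) = x" "qcnj (of_real r) = of_real r" "qcnj 0 = 0" "qcnj 1 = 1"
  "qcnj (- x) = - qcnj x" "qcnj (r *\<^sub>R x) = r *\<^sub>R qcnj x"
  by (simp_all add: quat_eq_iff algebra_simps)

lemma qcnj_sum: "qcnj (sum f A) = (\<Sum>x\<in>A. qcnj (f x))"
  by (induction A rule: infinite_finite_induct) simp_all

instantiation quat :: real_div_algebra
begin

definition inverse_quat :: "quat \<Rightarrow> quat" where
  "inverse_quat x = (1 / qnorm2 x) *\<^sub>R qcnj x"

definition divide_quat :: "quat \<Rightarrow> quat \<Rightarrow> quat" where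
  "divide_quat x y = x * inverse y"

instance
proof
  fix x y :: quat
  show "x \<noteq> 0 \<Longrightarrow> inverse x * x = 1"
    by (simp add: inverse_quat_def qcnj_mult_self qnorm2_eq_0_iff of_real_def)
  show "x \<noteq> 0 \<Longrightarrow> x * inverse x = 1"
    by (simp add: inverse_quat_def qcnj_mult_self qnorm2_eq_0_iff of_real_def)
  show "x div y = x * inverse y" by (simp add: divide_quat_def)
  show "inverse (0::quat) = 0" by (simp add: inverse_quat_def)
qed

end


section \<open>The monoid of words\<close>

datatype 'n letter = LQ 'n | LQbar 'n

fun lidx :: "'n letter \<Rightarrow> 'n" where
  "lidx (LQ i) = i"
| "lidx (LQbar i) = i"

fun lbar :: "'n letter \<Rightarrow> 'n letter" where
  "lbar (LQ i) = LQbar i"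
| "lbar (LQbar i) = LQ i"

lemma lbar_lbar [simp]: "lbar (lbar x) = x" by (cases x) auto
lemma lidx_lbar [simp]: "lidx (lbar x) = lidx x" by (cases x) auto
lemma bar_neq [simp]: "lbar x \<noteq> x" "x \<noteq> lbar x" by (cases x; auto)+
lemma eq_bar_iff: "y = lbar x \<longleftrightarrow> x = lbar y" by (metis lbar_lbar)

text \<open>
  A pair \<open>(\<alpha>, v)\<close> stands for the normal form \<open>(\<Prod>\<^sub>i |q\<^sub>i|\<^bsup>2 \<alpha> i\<^esup>) v\<close>, where no two
  adjacent letters of \<open>v\<close> are conjugate to each other.  \<open>push x\<close> computes the normal form
  after multiplication by the letter \<open>x\<close> on the left; words are letter lists up to
  equality of normal forms.
\<close>

type_synonym 'n nform = "('n \<Rightarrow> nat) \<times> 'n letter list"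

fun push :: "'n letter \<Rightarrow> 'n nform \<Rightarrow> 'n nform" where
  "push x (\<alpha>, []) = (\<alpha>, [x])"
| "push x (\<alpha>, y # v) =
     (if y = lbar x then (\<alpha>(lidx x := Suc (\<alpha> (lidx x))), v) else (\<alpha>, x # y # v))"

definition nf :: "'n letter list \<Rightarrow> 'n nform" where
  "nf u = foldr push u (\<lambda>_. 0, [])"

definition reduced :: "'n letter list \<Rightarrow> bool" where
  "reduced = successively (\<lambda>x y. y \<noteq> lbar x)"

lemma reduced_simps [simp]:
  "reduced []" "reduced [x]" "reduced (x # y # v) \<longleftrightarrow> y \<noteq> lbar x \<and> reduced (y # v)"
  by (simp_all add: reduced_def)

lemma reduced_ConsD: "reduced (x # v) \<Longrightarrow> reduced v"
  by (cases v) auto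

definition nadd :: "('n \<Rightarrow> nat) \<Rightarrow> 'n nform \<Rightarrow> 'n nform" where
  "nadd \<alpha> s = ((\<lambda>i. \<alpha> i + fst s i), snd s)"

lemma push_nadd: "push x (nadd \<alpha> s) = nadd \<alpha> (push x s)"
  by (cases "(x, s)" rule: push.cases) (auto simp: nadd_def)

lemma foldr_push_nadd: "foldr push u (nadd \<alpha> s) = nadd \<alpha> (foldr push u s)"
  by (induction u) (auto simp: push_nadd)

lemma reduced_push: "reduced (snd s) \<Longrightarrow> reduced (snd (push x s))"
  by (cases "(x, s)" rule: push.cases) (auto dest: reduced_ConsD)

lemma reduced_foldr_push: "reduced (snd s) \<Longrightarrow> reduced (snd (foldr push u s))"
  by (induction u) (auto simp: reduced_push)

lemma reduced_nf: "reduced (snd (nf u))"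
  unfolding nf_def by (rule reduced_foldr_push) simp

lemma foldr_push_reduced: "reduced v \<Longrightarrow> foldr push v (\<alpha>, []) = (\<alpha>, v)"
proof (induction v)
  case (Cons x v)
  then show ?case by (cases v) (auto dest: reduced_ConsD)
qed simp

lemma push_push_bar:
  assumes "reduced (snd s)"
  shows "push x (push (lbar x) s) = nadd (\<lambda>i. if i = lidx x then 1 else 0) s"
proof (cases s)
  case (Pair \<alpha> v)
  show ?thesis
  proof (cases v)
    case Nil
    then show ?thesis using Pair by (auto simp: nadd_def)
  next
    case (Cons y v')
    then show ?thesis using Pair assms
      by (cases v') (auto simp: nadd_def)
  qed
qed

lemma foldr_push_nf:
  assumes "reduced (snd s)"
  shows "foldr push u s = nadd (fst (nf u)) (foldr push (snd (nf u)) s)"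
proof (induction u)
  case Nil
  then show ?case by (simp add: nf_def nadd_def)
next
  case (Cons x u)
  obtain \<alpha> v where uv: "nf u = (\<alpha>, v)" by fastforce
  have nfx: "nf (x # u) = push x (\<alpha>, v)" using uv by (simp add: nf_def)
  have IH: "foldr push (x # u) s = nadd \<alpha> (push x (foldr push v s))"
    using Cons uv by (simp add: push_nadd)
  show ?case
  proof (cases "\<exists>v'. v = lbar x # v'")
    case True
    then obtain v' where v': "v = lbar x # v'" by blast
    have "push x (push (lbar x) (foldr push v' s))
        = nadd (\<lambda>i. if i = lidx x then 1 else 0) (foldr push v' s)"
      by (rule push_push_bar) (rule reduced_foldr_push[OF assms])
    then show ?thesis unfolding IH nfx v' by (auto simp: nadd_def)
  next
    case False
    then have "push x (\<alpha>, v) = (\<alpha>, x # v)" by (cases v) auto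
    then show ?thesis unfolding IH nfx by simp
  qed
qed

lemma nf_append: "nf (u @ v) = nadd (fst (nf u)) (foldr push (snd (nf u)) (nf v))"
  using foldr_push_nf[OF reduced_nf[of v], of u] by (simp add: nf_def)

definition lstar :: "'n letter list \<Rightarrow> 'n letter list" where
  "lstar u = rev (map lbar u)"

lemma lstar_simps [simp]:
  "lstar [] = []" "lstar (x # u) = lstar u @ [lbar x]" "lstar (u @ v) = lstar v @ lstar u"
  "lstar (lstar u) = u"
  by (simp_all add: lstar_def rev_map comp_def)

lemma reduced_lstar: "reduced u \<Longrightarrow> reduced (lstar u)"
proof (induction u)
  case (Cons x u)
  then show ?case
    by (cases u) (auto simp: reduced_def successively_append_iff eq_bar_iff)
qed simp

lemma nf_lstar: "nf (lstar u) = (fst (nf u), lstar (snd (nf u)))"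
proof (induction u)
  case Nil
  then show ?case by (simp add: nf_def)
next
  case (Cons x u)
  obtain \<alpha> v where uv: "nf u = (\<alpha>, v)" by fastforce
  have rv: "reduced v" using reduced_nf[of u] uv by simp
  have nfx: "nf (x # u) = push x (\<alpha>, v)" using uv by (simp add: nf_def)
  have e: "nf (lstar (x # u)) = nadd \<alpha> (foldr push (lstar v) ((\<lambda>_. 0), [lbar x]))"
    using Cons uv by (simp add: nf_append) (simp add: nf_def)
  show ?case
  proof (cases "\<exists>v'. v = lbar x # v'")
    case True
    then obtain v' where v': "v = lbar x # v'" by blast
    have "reduced (lstar v')" using rv v' by (auto intro: reduced_lstar dest: reduced_ConsD)
    then show ?thesis unfolding e nfx v'
      by (auto simp: foldr_push_reduced nadd_def)
  next
    case False
    then have p: "push x (\<alpha>, v) = (\<alpha>, x # v)" by (cases v) auto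
    have "reduced (x # v)" using rv False by (cases v) auto
    then have "reduced (lstar v @ [lbar x])" using reduced_lstar by fastforce
    then have "foldr push (lstar v @ [lbar x]) ((\<lambda>_. 0), []) = ((\<lambda>_. 0), lstar v @ [lbar x])"
      by (rule foldr_push_reduced)
    then show ?thesis unfolding e nfx p by (simp add: nadd_def)
  qed
qed

quotient_type 'n qword = "'n letter list" / "\<lambda>u v. nf u = nf v"
  by (rule equivpI) (auto simp: reflp_def symp_def transp_def)

text \<open>
  The library's monoid algebras are indexed by additively written monoids (not necessarily
  commutative), so concatenation of words is written \<open>+\<close> and the empty word is \<open>0\<close>.
\<close>

instantiation qword :: (type) monoid_add
begin

lift_definition zero_qword :: "'a qword" is "[]" .

lift_definition plus_qword :: "'a qword \<Rightarrow> 'a qword \<Rightarrow> 'a qword" is "(@)"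
  by (simp add: nf_append)

instance
  by standard (transfer; simp)+

end

lift_definition wletter :: "'n letter \<Rightarrow> 'n qword" is "\<lambda>x. [x]" .

lift_definition wstar :: "'n qword \<Rightarrow> 'n qword" is lstar
  by (simp add: nf_lstar)

lemma wstar_simps [simp]:
  "wstar 0 = 0" "wstar (u + v) = wstar v + wstar u" "wstar (wstar u) = u"
  "wstar (wletter x) = wletter (lbar x)"
  by (transfer; simp)+

fun letter_eval :: "quat ^ 'n \<Rightarrow> 'n letter \<Rightarrow> quat" where
  "letter_eval a (LQ i) = a $ i"
| "letter_eval a (LQbar i) = qcnj (a $ i)"

definition list_eval :: "quat ^ 'n \<Rightarrow> 'n letter list \<Rightarrow> quat" where
  "list_eval a u = prod_list (map (letter_eval a) u)"

lemma list_eval_simps [simp]: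
  "list_eval a [] = 1" "list_eval a (x # u) = letter_eval a x * list_eval a u"
  "list_eval a (u @ v) = list_eval a u * list_eval a v"
  by (simp_all add: list_eval_def)

lemma letter_eval_bar: "letter_eval a (lbar x) = qcnj (letter_eval a x)"
  by (cases x) auto

lemma letter_eval_mult_bar:
  "letter_eval a x * letter_eval a (lbar x) = of_real (qnorm2 (a $ lidx x))"
  by (cases x) (auto simp: qcnj_mult_self)

lemma list_eval_lstar: "list_eval a (lstar u) = qcnj (list_eval a u)"
  by (induction u) (auto simp: letter_eval_bar)

definition nform_eval :: "quat ^ 'n \<Rightarrow> 'n nform \<Rightarrow> quat" where
  "nform_eval a s = of_real (\<Prod>i\<in>UNIV. qnorm2 (a $ i) ^ fst s i) * list_eval a (snd s)"

lemma nform_eval_push: "nform_eval a (push x s) = letter_eval a x * nform_eval a s"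
proof (cases "(x, s)" rule: push.cases)
  case (1 x' \<alpha>)
  then show ?thesis
    by (simp add: nform_eval_def of_real_def)
next
  case (2 x' \<alpha> y v)
  show ?thesis
  proof (cases "y = lbar x")
    case True
    define P where "P = (\<Prod>i\<in>UNIV. qnorm2 (a $ i) ^ \<alpha> i)"
    let ?\<beta> = "\<alpha>(lidx x := Suc (\<alpha> (lidx x)))"
    have P': "(\<Prod>i\<in>UNIV. qnorm2 (a $ i) ^ ?\<beta> i) = qnorm2 (a $ lidx x) * P"
      unfolding P_def by (subst (1 2) prod.remove[of UNIV "lidx x"]) (auto simp: mult.assoc)
    have ps: "push x s = (?\<beta>, v)" using 2 True by simp
    have "nform_eval a (push x s) = of_real (P * qnorm2 (a $ lidx x)) * list_eval a v"
      unfolding ps nform_eval_def fst_conv snd_conv P' by (simp only: mult.commute)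
    also have "\<dots> = of_real P * ((letter_eval a x * letter_eval a (lbar x)) * list_eval a v)"
      by (simp add: letter_eval_mult_bar mult.assoc)
    also have "\<dots> = letter_eval a x * (of_real P * (letter_eval a (lbar x) * list_eval a v))"
      by (simp add: of_real_def mult.assoc)
    also have "\<dots> = letter_eval a x * nform_eval a s"
      using 2 True by (simp add: nform_eval_def P_def)
    finally show ?thesis .
  next
    case False
    then show ?thesis using 2 by (simp add: nform_eval_def of_real_def)
  qed
qed

lemma list_eval_nf: "list_eval a u = nform_eval a (nf u)"
proof (induction u)
  case Nil
  then show ?case by (simp add: nf_def nform_eval_def)
next
  case (Cons x u)
  have "nf (x # u) = push x (nf u)" by (simp add: nf_def)
  then show ?case using Cons by (simp add: nform_eval_push)
qed

lift_definition weval :: "quat ^ 'n \<Rightarrow> 'n qword \<Rightarrow> quat" is list_eval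
  by (simp add: list_eval_nf)

lemma weval_simps [simp]:
  "weval a 0 = 1" "weval a (u + v) = weval a u * weval a v"
  "weval a (wletter x) = letter_eval a x" "weval a (wstar u) = qcnj (weval a u)"
  by (transfer; simp add: list_eval_lstar)+


section \<open>Polynomials with real coefficients\<close>

type_synonym 'n rpoly = "'n qword \<Rightarrow>\<^sub>0 real"

definition rstar :: "'n rpoly \<Rightarrow> 'n rpoly" where
  "rstar p = (\<Sum>w\<in>Poly_Mapping.keys p. Poly_Mapping.single (wstar w) (Poly_Mapping.lookup p w))"

definition reval :: "quat ^ 'n \<Rightarrow> 'n rpoly \<Rightarrow> quat" where
  "reval a p = (\<Sum>w\<in>Poly_Mapping.keys p. Poly_Mapping.lookup p w *\<^sub>R weval a w)"

lemma rpoly_sum_single: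
  fixes p :: "'a \<Rightarrow>\<^sub>0 real"
  shows "p = (\<Sum>w\<in>Poly_Mapping.keys p. Poly_Mapping.single w (Poly_Mapping.lookup p w))"
proof (rule poly_mapping_eqI)
  fix k
  show "Poly_Mapping.lookup p k = Poly_Mapping.lookup
     (\<Sum>w\<in>Poly_Mapping.keys p. Poly_Mapping.single w (Poly_Mapping.lookup p w)) k"
    by (simp add: lookup_sum lookup_single when_def in_keys_iff)
qed

lemma rpoly_induct [case_names single add]:
  fixes p :: "'a \<Rightarrow>\<^sub>0 real"
  assumes "\<And>w c. P (Poly_Mapping.single w c)" "\<And>p q. P p \<Longrightarrow> P q \<Longrightarrow> P (p + q)"
  shows "P p"
proof -
  have z: "P 0" using assms(1)[of undefined 0] by simp
  have "P (\<Sum>w\<in>S. Poly_Mapping.single w (c w))" for S c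
    by (induction S rule: infinite_finite_induct) (use assms z in auto)
  then show ?thesis by (subst rpoly_sum_single)
qed

lemma rstar_single [simp]: "rstar (Poly_Mapping.single w c) = Poly_Mapping.single (wstar w) c"
  by (cases "c = 0") (auto simp: rstar_def)

lemma reval_single [simp]: "reval a (Poly_Mapping.single w c) = c *\<^sub>R weval a w"
  by (cases "c = 0") (auto simp: reval_def)

lemma rstar_add [simp]: "rstar (p + q) = rstar p + rstar q"
  unfolding rstar_def by (rule setsum_keys_plus_distrib) (auto simp: single_add)

lemma reval_add [simp]: "reval a (p + q) = reval a p + reval a q"
  unfolding reval_def by (rule setsum_keys_plus_distrib) (auto simp: algebra_simps)

lemma rstar_mult [simp]: "rstar (p * q) = rstar q * rstar p"
proof (induction p rule: rpoly_induct)
  case (single w c)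
  show ?case
    by (induction q rule: rpoly_induct) (auto simp: mult_single mult.commute algebra_simps)
qed (auto simp: algebra_simps)

lemma reval_mult [simp]: "reval a (p * q) = reval a p * reval a q"
proof (induction p rule: rpoly_induct)
  case (single w c)
  show ?case
    by (induction q rule: rpoly_induct) (auto simp: mult_single mult.commute algebra_simps)
qed (auto simp: algebra_simps)

lemma rstar_rstar [simp]: "rstar (rstar p) = p"
  by (induction p rule: rpoly_induct) auto

lemma reval_rstar: "reval a (rstar p) = qcnj (reval a p)"
  by (induction p rule: rpoly_induct) auto


section \<open>The free product of the quaternions and the real polynomials\<close>

text \<open>
  The free product of unital real algebras (their coproduct) is presented as formal
  expressions in elements of both factors, modulo the least congruence that makes them a ring,
  makes both inclusions ring homomorphisms, and identifies the two copies of the scalars.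
  Real scalars are then automatically central.
\<close>

datatype 'n hterm =
    HConst quat
  | HPoly "'n rpoly"
  | HAdd "'n hterm" "'n hterm"
  | HMul "'n hterm" "'n hterm"

inductive heq :: "'n hterm \<Rightarrow> 'n hterm \<Rightarrow> bool" (infix \<open>\<doteq>\<close> 50) where
  heq_refl: "s \<doteq> s"
| heq_sym: "s \<doteq> t \<Longrightarrow> t \<doteq> s"
| heq_trans: "s \<doteq> t \<Longrightarrow> t \<doteq> u \<Longrightarrow> s \<doteq> u"
| heq_add: "s \<doteq> s' \<Longrightarrow> t \<doteq> t' \<Longrightarrow> HAdd s t \<doteq> HAdd s' t'"
| heq_mul: "s \<doteq> s' \<Longrightarrow> t \<doteq> t' \<Longrightarrow> HMul s t \<doteq> HMul s' t'"
| heq_add_assoc: "HAdd (HAdd s t) u \<doteq> HAdd s (HAdd t u)"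
| heq_add_comm: "HAdd s t \<doteq> HAdd t s"
| heq_add_zero: "HAdd (HConst 0) s \<doteq> s"
| heq_add_neg: "HAdd (HMul (HConst (- 1)) s) s \<doteq> HConst 0"
| heq_mul_assoc: "HMul (HMul s t) u \<doteq> HMul s (HMul t u)"
| heq_mul_one_left: "HMul (HConst 1) s \<doteq> s"
| heq_mul_one_right: "HMul s (HConst 1) \<doteq> s"
| heq_distrib_right: "HMul (HAdd s t) u \<doteq> HAdd (HMul s u) (HMul t u)"
| heq_distrib_left: "HMul s (HAdd t u) \<doteq> HAdd (HMul s t) (HMul s u)"
| heq_const_add: "HAdd (HConst c) (HConst d) \<doteq> HConst (c + d)"
| heq_const_mul: "HMul (HConst c) (HConst d) \<doteq> HConst (c * d)"
| heq_poly_add: "HAdd (HPoly p) (HPoly q) \<doteq> HPoly (p + q)"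
| heq_poly_mul: "HMul (HPoly p) (HPoly q) \<doteq> HPoly (p * q)"
| heq_scalar: "HConst (of_real r) \<doteq> HPoly (Poly_Mapping.single 0 r)"

lemma heq_real_central: "HMul (HConst (of_real r)) t \<doteq> HMul t (HConst (of_real r))"
proof (induction t)
  case (HConst c)
  have "of_real r * c = c * of_real r" by (simp add: of_real_def)
  then show ?case by (metis heq_const_mul heq_sym heq_trans)
next
  case (HPoly p)
  have c: "Poly_Mapping.single 0 r * p = p * Poly_Mapping.single 0 r"
    by (induction p rule: rpoly_induct) (auto simp: mult_single mult.commute algebra_simps)
  have "HMul (HConst (of_real r)) (HPoly p) \<doteq> HPoly (Poly_Mapping.single 0 r * p)"
    by (meson heq_mul heq_poly_mul heq_refl heq_scalar heq_trans)
  moreover have "HMul (HPoly p) (HConst (of_real r)) \<doteq> HPoly (p * Poly_Mapping.single 0 r)"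
    by (meson heq_mul heq_poly_mul heq_refl heq_scalar heq_trans)
  ultimately show ?case using c by (metis heq_sym heq_trans)
next
  case (HAdd s t)
  then show ?case
    by (meson heq_add heq_distrib_left heq_distrib_right heq_sym heq_trans)
next
  case (HMul s t)
  let ?r = "HConst (of_real r)"
  have "HMul ?r (HMul s t) \<doteq> HMul (HMul ?r s) t" by (rule heq_sym[OF heq_mul_assoc])
  also have "\<dots> \<doteq> HMul (HMul s ?r) t" by (rule heq_mul[OF HMul.IH(1) heq_refl])
  also (heq_trans) have "\<dots> \<doteq> HMul s (HMul ?r t)" by (rule heq_mul_assoc)
  also (heq_trans) have "\<dots> \<doteq> HMul s (HMul t ?r)" by (rule heq_mul[OF heq_refl HMul.IH(2)])
  also (heq_trans) have "\<dots> \<doteq> HMul (HMul s t) ?r" by (rule heq_sym[OF heq_mul_assoc])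
  finally (heq_trans) show ?case .
qed

quotient_type 'n hpoly = "'n hterm" / heq
  by (rule equivpI)
    (auto simp: reflp_def symp_def transp_def intro: heq_refl heq_sym heq_trans)

lift_definition hconst :: "quat \<Rightarrow> 'n hpoly" is HConst .

lift_definition hpoly_of :: "'n rpoly \<Rightarrow> 'n hpoly" is HPoly .

instantiation hpoly :: (type) ring
begin

lift_definition zero_hpoly :: "'a hpoly" is "HConst 0" .

lift_definition plus_hpoly :: "'a hpoly \<Rightarrow> 'a hpoly \<Rightarrow> 'a hpoly" is HAdd
  by (rule heq_add)

lift_definition times_hpoly :: "'a hpoly \<Rightarrow> 'a hpoly \<Rightarrow> 'a hpoly" is HMul
  by (rule heq_mul)

lift_definition uminus_hpoly :: "'a hpoly \<Rightarrow> 'a hpoly" is "HMul (HConst (- 1))"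
  by (rule heq_mul[OF heq_refl])

definition minus_hpoly :: "'a hpoly \<Rightarrow> 'a hpoly \<Rightarrow> 'a hpoly" where
  "minus_hpoly p q = p + - q"

instance
proof
  fix p q r :: "'a hpoly"
  show "p + q + r = p + (q + r)" by transfer (rule heq_add_assoc)
  show "p + q = q + p" by transfer (rule heq_add_comm)
  show "0 + p = p" by transfer (rule heq_add_zero)
  show "- p + p = 0" by transfer (rule heq_add_neg)
  show "p - q = p + - q" by (rule minus_hpoly_def)
  show "p * q * r = p * (q * r)" by transfer (rule heq_mul_assoc)
  show "(p + q) * r = p * r + q * r" by transfer (rule heq_distrib_right)
  show "p * (q + r) = p * q + p * r" by transfer (rule heq_distrib_left)
qed

end

fun hterm_eval :: "quat ^ 'n \<Rightarrow> 'n hterm \<Rightarrow> quat" where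
  "hterm_eval a (HConst c) = c"
| "hterm_eval a (HPoly p) = reval a p"
| "hterm_eval a (HAdd s t) = hterm_eval a s + hterm_eval a t"
| "hterm_eval a (HMul s t) = hterm_eval a s * hterm_eval a t"

lemma hterm_eval_cong: "s \<doteq> t \<Longrightarrow> hterm_eval a s = hterm_eval a t"
  by (induction rule: heq.induct) (auto simp: algebra_simps of_real_def)

lift_definition heval :: "quat ^ 'n \<Rightarrow> 'n hpoly \<Rightarrow> quat" is hterm_eval
  by (rule hterm_eval_cong)

fun hterm_star :: "'n hterm \<Rightarrow> 'n hterm" where
  "hterm_star (HConst c) = HConst (qcnj c)"
| "hterm_star (HPoly p) = HPoly (rstar p)"
| "hterm_star (HAdd s t) = HAdd (hterm_star s) (hterm_star t)"
| "hterm_star (HMul s t) = HMul (hterm_star t) (hterm_star s)"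

lemma hterm_star_cong: "s \<doteq> t \<Longrightarrow> hterm_star s \<doteq> hterm_star t"
proof (induction rule: heq.induct)
  case (heq_add_neg s)
  have "of_real (- 1) = (- 1 :: quat)" by simp
  then have "HMul (hterm_star s) (HConst (- 1)) \<doteq> HMul (HConst (- 1)) (hterm_star s)"
    by (metis heq_real_central heq_sym)
  then show ?case
    by simp (meson heq.heq_add heq.heq_add_neg heq_refl heq_trans)
qed (auto intro: heq.intros)

lift_definition hstar :: "'n hpoly \<Rightarrow> 'n hpoly" is hterm_star
  by (rule hterm_star_cong)

lemma hconst_simps:
  "hconst 0 = 0" "hconst (c + d) = hconst c + hconst d" "hconst (c * d) = hconst c * hconst d"
  by (transfer; metis heq_refl heq_sym heq_const_add heq_const_mul)+

lemma hconst_real_central: "hconst (of_real r) * p = p * hconst (of_real r)"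
  by transfer (rule heq_real_central)

lemma hconst_one_mult: "hconst 1 * p = p" "p * hconst 1 = p"
  by (transfer; rule heq_mul_one_left heq_mul_one_right)+

lemma heval_hconst [simp]: "heval a (hconst c) = c"
  by transfer simp

instantiation hpoly :: (finite) real_algebra_1
begin

definition one_hpoly :: "'a hpoly" where
  "one_hpoly = hconst 1"

definition scaleR_hpoly :: "real \<Rightarrow> 'a hpoly \<Rightarrow> 'a hpoly" where
  "scaleR_hpoly r p = hconst (of_real r) * p"

instance
proof
  fix p q :: "'a hpoly" and r s :: real
  show "1 * p = p" "p * 1 = p" by (simp_all add: one_hpoly_def hconst_one_mult)
  show "(0 :: 'a hpoly) \<noteq> 1"
  proof
    assume "(0 :: 'a hpoly) = 1"
    then have "(hconst 0 :: 'a hpoly) = hconst 1"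
      by (simp only: one_hpoly_def hconst_simps)
    then have "heval a (hconst 0) = heval a (hconst 1)" for a :: "quat ^ 'a"
      by (rule arg_cong)
    then show False by (simp only: heval_hconst) simp
  qed
  show "r *\<^sub>R (p + q) = r *\<^sub>R p + r *\<^sub>R q"
    by (simp add: scaleR_hpoly_def distrib_left)
  show "(r + s) *\<^sub>R p = r *\<^sub>R p + s *\<^sub>R p"
    by (simp add: scaleR_hpoly_def hconst_simps distrib_right)
  show "r *\<^sub>R s *\<^sub>R p = (r * s) *\<^sub>R p"
    by (simp add: scaleR_hpoly_def hconst_simps mult.assoc)
  show "1 *\<^sub>R p = p" by (simp add: scaleR_hpoly_def hconst_one_mult)
  show "r *\<^sub>R p * q = r *\<^sub>R (p * q)" by (simp add: scaleR_hpoly_def mult.assoc)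
  show "p * r *\<^sub>R q = r *\<^sub>R (p * q)"
    by (simp add: scaleR_hpoly_def) (metis hconst_real_central mult.assoc)
qed

end

lemma hpoly_of_add: "hpoly_of (p + q) = hpoly_of p + hpoly_of q"
  by transfer (rule heq_sym[OF heq_poly_add])

lemma hpoly_of_mult: "hpoly_of (p * q) = hpoly_of p * hpoly_of q"
  by transfer (rule heq_sym[OF heq_poly_mul])

lemma hpoly_of_single_hconst: "hpoly_of (Poly_Mapping.single 0 r) = hconst (of_real r)"
  by transfer (rule heq_sym[OF heq_scalar])

lemma hpoly_of_single: "hpoly_of (Poly_Mapping.single 0 r) = (of_real r :: 'n::finite hpoly)"
  by (simp add: hpoly_of_single_hconst of_real_def scaleR_hpoly_def one_hpoly_def hconst_one_mult)

lemma heval_simps [simp]: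
  "heval a (p + q) = heval a p + heval a q" "heval a (p * q) = heval a p * heval a q"
  "heval a 0 = 0" "heval a 1 = 1" "heval a (hpoly_of g) = reval a g"
  by (simp_all add: one_hpoly_def) (transfer; simp)+

lemma hstar_simps [simp]:
  "hstar (p + q) = hstar p + hstar q" "hstar (p * q) = hstar q * hstar p"
  "hstar (hconst c) = hconst (qcnj c)" "hstar (hpoly_of g) = hpoly_of (rstar g)"
  "hstar 0 = 0"
  by (transfer; simp add: heq_refl)+

lemma hterm_star_star: "hterm_star (hterm_star t) = t"
  by (induction t) auto

lemma hstar_hstar [simp]: "hstar (hstar p) = p"
  by transfer (simp add: hterm_star_star heq_refl)

lemma hterm_eval_star: "hterm_eval a (hterm_star t) = qcnj (hterm_eval a t)"
  by (induction t) (auto simp: reval_rstar)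

lemma heval_hstar: "heval a (hstar p) = qcnj (heval a p)"
  by transfer (rule hterm_eval_star)


section \<open>Left- and middle-coefficient polynomials, quadratic modules\<close>

definition hword :: "'n qword \<Rightarrow> 'n hpoly" where
  "hword w = hpoly_of (Poly_Mapping.single w 1)"

definition normsq :: "'n \<Rightarrow> 'n qword" where
  "normsq i = wletter (LQ i) + wletter (LQbar i)"

definition left_polys :: "'n::finite hpoly set" where
  "left_polys = {(\<Sum>w\<in>S. hconst (c w) * hword w) | S c. finite S}"

definition middle_polys :: "'n::finite hpoly set" where
  "middle_polys = {(\<Sum>(u, v)\<in>S. hword u * hconst (c u v) * hword v) | S c. finite S}"

definition hSym :: "'n hpoly set \<Rightarrow> 'n hpoly set" where
  "hSym X = {p \<in> X. hstar p = p}"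

definition rSym :: "'n rpoly set" where
  "rSym = {p. rstar p = p}"

text \<open>
  Symmetric elements take real values, so inequalities between their values and \<open>0\<close> are
  inequalities for the real part.
\<close>

lemma heval_real: "hstar p = p \<Longrightarrow> heval a p = of_real (qRe (heval a p))"
  using heval_hstar[of a p] by (simp add: quat_eq_iff)

lemma reval_real: "g \<in> rSym \<Longrightarrow> reval a g = of_real (qRe (reval a g))"
  using reval_rstar[of a g] by (simp add: quat_eq_iff rSym_def)

definition K_set :: "nat \<Rightarrow> (nat \<Rightarrow> 'n rpoly) \<Rightarrow> nat \<Rightarrow> (nat \<Rightarrow> 'n rpoly) \<Rightarrow> (quat ^ 'n) set" where
  "K_set m g l h =
     {a. (\<forall>i\<in>{1..m}. qRe (reval a (g i)) \<ge> 0) \<and> (\<forall>j\<in>{1..l}. reval a (h j) = 0)}"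

definition vanishing_ideal :: "'n::finite hpoly set" where
  "vanishing_ideal = {p. \<forall>a. heval a p = 0}"

definition sos :: "'n::finite hpoly set" where
  "sos = {(\<Sum>s<N. hstar (p s) * p s) | (N::nat) p. \<forall>s<N. p s \<in> left_polys}"

definition quad_module ::
  "nat \<Rightarrow> (nat \<Rightarrow> 'n::finite rpoly) \<Rightarrow> nat \<Rightarrow> (nat \<Rightarrow> 'n rpoly) \<Rightarrow> 'n hpoly set" where
  "quad_module m g l h =
     {\<sigma> 0 + (1 / 2) *\<^sub>R (\<Sum>i=1..m. \<sigma> i * hpoly_of (g i) + hpoly_of (g i) * \<sigma> i)
        + (\<Sum>j=1..l. \<Sum>\<alpha><N j. \<tau> j \<alpha> * hpoly_of (h j) * hstar (\<nu> j \<alpha>)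
                            + \<nu> j \<alpha> * hstar (hpoly_of (h j)) * hstar (\<tau> j \<alpha>))
      | \<sigma> (N :: nat \<Rightarrow> nat) \<tau> \<nu>. (\<forall>i\<le>m. \<sigma> i \<in> sos) \<and>
          (\<forall>j\<in>{1..l}. \<forall>\<alpha><N j. \<tau> j \<alpha> \<in> left_polys \<and> \<nu> j \<alpha> \<in> left_polys)}"

definition archimedean :: "'n::finite hpoly set \<Rightarrow> bool" where
  "archimedean M \<longleftrightarrow> (\<exists>R>0. of_real R - (\<Sum>i\<in>UNIV. hword (normsq i)) \<in> M)"

end

theory Submission
  imports Defs "HOL-Library.Function_Algebras"
begin

text \<open>
  The vanishing ideal allows us to pass to functions on \<open>\<real>\<^bsup>4n\<^esup>\<close>.  A function \<open>f > 0\<close> outside the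
  cone of values of the quadratic module is separated from it by a functional \<open>\<phi>\<close> with
  \<open>\<phi> f \<le> 0\<close>; taking a maximal cone closed under multiplication by the squares \<open>|w|\<^sup>2\<close> of real
  polynomials makes \<open>\<phi>\<close> multiplicative on these squares, hence on all real-valued elements of
  \<open>\<real>\<langle>q, \<bar>q\<rangle>\<close>.  Dividing \<open>\<real>\<langle>q, \<bar>q\<rangle>\<close> by the null space of the form \<open>\<phi> (Re (x y\<^sup>*))\<close> therefore
  leaves a real division algebra \<open>D\<close>, that is \<open>\<real>\<close>, \<open>\<complex>\<close> or the quaternions.  The positive
  functional \<open>c \<otimes> x \<mapsto> \<phi> (Re (c x))\<close> on the tensor product of the quaternions with \<open>D\<close> is
  bounded below on a given element by some embedding of \<open>D\<close> into the quaternions, and such an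
  embedding is evaluation at a point of \<open>K\<close> where \<open>f \<le> 0\<close>.
\<close>

section \<open>Archimedean modules over a semiring\<close>

text \<open>The obstacle: the functions Re (c x) with real polynomials x form only a vector space,
  not an algebra, so a separating functional \<phi> is no character and need not be evaluation at a
  point. Multiplication by squares of real polynomials does preserve this space and the cone,
  because a left-coefficient polynomial times a real polynomial is again left-coefficient. That f is
  middle-coefficient enters through cyclicity of the real part, Re (u c v) = Re (c v u), which puts
  f into this space. Multiplicativity of \<phi> on squares makes the norm of the form
  multiplicative, whence D has no zero divisors. If D is the quaternions, their tensor product with
  the opposite of D is the algebra of real 4 by 4 matrices, acting by v \<mapsto> c v z. Positive
  functionals there are sums of vector states, and a unit vector v corresponds to the embedding z
  \<mapsto> v z \<open>inverse v\<close>. Thus \<phi> f is an average of values of f, and some value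
  is at most the average. If D is the complex numbers, an embedding is the choice of an imaginary
  unit, and Cauchy-Schwarz shows that the best choice suffices.\<close>

instantiation "fun" :: (type, real_algebra_1) real_algebra_1
begin

definition scaleR_fun :: "real \<Rightarrow> ('a \<Rightarrow> 'b) \<Rightarrow> 'a \<Rightarrow> 'b" where
  "scaleR_fun r f = (\<lambda>x. r *\<^sub>R f x)"

instance
  by standard (simp_all add: scaleR_fun_def fun_eq_iff algebra_simps)

end

text \<open>Scaling by r is multiplication by \<open>single 0 (of_real r)\<close> from either side,
  so compatibility with products reduces to associativity. The instance lets the real word algebra
  serve as the algebra of \<open>quat_state\<close>.\<close>

instantiation poly_mapping :: (monoid_add, real_algebra_1) real_algebra_1
begin

definition scaleR_poly_mapping :: "real \<Rightarrow> ('a \<Rightarrow>\<^sub>0 'b) \<Rightarrow> 'a \<Rightarrow>\<^sub>0 'b" where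
  "scaleR_poly_mapping r p = Poly_Mapping.map (\<lambda>x. r *\<^sub>R x) p"

instance
proof
  have lk: "Poly_Mapping.lookup (r *\<^sub>R p) k = r *\<^sub>R Poly_Mapping.lookup p k"
    for r and p :: "'a \<Rightarrow>\<^sub>0 'b" and k
    by (simp add: scaleR_poly_mapping_def Poly_Mapping.map.rep_eq when_def)
  have inner: "(\<Sum>b. c when b = 0 when k = a + b) = (c when k = a)" for c :: 'b and k a :: 'a
  proof -
    have "(\<lambda>b. c when b = 0 when k = a + b) = (\<lambda>b. (c when k = a) when b = 0)"
      by (auto simp: when_def)
    then show ?thesis by (simp only: Sum_any_when_equal)
  qed
  have sl: "r *\<^sub>R p = Poly_Mapping.single 0 (of_real r) * p" for r and p :: "'a \<Rightarrow>\<^sub>0 'b"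
    by (rule poly_mapping_eqI)
      (simp add: lk times_poly_mapping.rep_eq prod_fun_def lookup_single of_real_def when_mult)
  have sr: "r *\<^sub>R p = p * Poly_Mapping.single 0 (of_real r)" for r and p :: "'a \<Rightarrow>\<^sub>0 'b"
    by (rule poly_mapping_eqI)
      (simp add: lk times_poly_mapping.rep_eq prod_fun_def lookup_single of_real_def inner mult_when)
  fix p q :: "'a \<Rightarrow>\<^sub>0 'b" and r s :: real
  show "r *\<^sub>R (p + q) = r *\<^sub>R p + r *\<^sub>R q" "(r + s) *\<^sub>R p = r *\<^sub>R p + s *\<^sub>R p"
    "r *\<^sub>R s *\<^sub>R p = (r * s) *\<^sub>R p" "1 *\<^sub>R p = p"
    by (rule poly_mapping_eqI; simp add: lk lookup_add algebra_simps)+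
  show "r *\<^sub>R p * q = r *\<^sub>R (p * q)" by (simp add: sl mult.assoc)
  show "p * r *\<^sub>R q = r *\<^sub>R (p * q)" by (simp add: sr mult.assoc)
qed

end

text \<open>V is only a module over T: products of two elements of V may leave V.
  \<open>T_square\<close> supplies the multipliers \<open>(of_real k - p)\<^sup>2\<close> of the
  descent argument.\<close>

locale semiring_cone =
  fixes V T :: "'a :: {real_algebra_1, comm_ring_1} set"
  assumes V_add: "v \<in> V \<Longrightarrow> w \<in> V \<Longrightarrow> v + w \<in> V"
    and V_mult: "t \<in> T \<Longrightarrow> v \<in> V \<Longrightarrow> t * v \<in> V"
    and V_scale: "v \<in> V \<Longrightarrow> of_real r * v \<in> V"
    and T_add: "s \<in> T \<Longrightarrow> t \<in> T \<Longrightarrow> s + t \<in> T"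
    and T_mult: "s \<in> T \<Longrightarrow> t \<in> T \<Longrightarrow> s * t \<in> T"
    and T_real: "r \<ge> 0 \<Longrightarrow> of_real r \<in> T"
    and T_square: "t \<in> T \<Longrightarrow> (of_real r - t)\<^sup>2 \<in> T"
begin

text \<open>The last clause is the Archimedean property for all of V; applied to - v it also bounds
  v from below.\<close>

definition modules :: "'a set set" where
  "modules = {M. T \<subseteq> M \<and> M \<subseteq> V \<and> (\<forall>v\<in>M. \<forall>w\<in>M. v + w \<in> M) \<and>
     (\<forall>t\<in>T. \<forall>v\<in>M. t * v \<in> M) \<and> (\<forall>v\<in>V. \<exists>N. of_real N - v \<in> M)}"

lemma modulesD:
  assumes "M \<in> modules"
  shows "T \<subseteq> M" "M \<subseteq> V" "v \<in> M \<Longrightarrow> w \<in> M \<Longrightarrow> v + w \<in> M" "t \<in> T \<Longrightarrow> v \<in> M \<Longrightarrow> t * v \<in> M"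
    "r \<ge> 0 \<Longrightarrow> of_real r \<in> M"
  using assms T_real by (auto simp: modules_def)

lemma module_bound:
  assumes "M \<in> modules" "v \<in> V"
  shows "\<exists>N\<ge>1. of_real N - v \<in> M"
proof -
  obtain N where N: "of_real N - v \<in> M" using assms unfolding modules_def by blast
  have "(of_real N - v) + of_real (max 1 N - N) \<in> M"
    using assms(1) N by (intro modulesD) auto
  also have "(of_real N - v) + of_real (max 1 N - N) = of_real (max 1 N) - v"
    by (simp only: of_real_diff) simp
  finally show ?thesis by (metis max.cobounded1)
qed

text \<open>The certificate \<open>p * f - 1 \<in> M\<close> with p in T says that f is positive in
  a strong sense. By the Archimedean property f + N lies in M for some constant N, and the
  certificate allows N to be lowered to 0 in finitely many equal steps.\<close>

lemma module_descent:
  assumes M: "M \<in> modules" and f: "f \<in> V" and p: "p \<in> T" "p * f - 1 \<in> M"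
  shows "f \<in> M"
proof -
  note M_add = modulesD(3)[OF M] and M_mult = modulesD(4)[OF M] and constM = modulesD(5)[OF M]
  have "p \<in> V" using p modulesD(1,2)[OF M] by auto
  obtain N1 where N1: "N1 \<ge> 1" "of_real N1 - p \<in> M" using module_bound[OF M \<open>p \<in> V\<close>] by blast
  have "p * (p * f) \<in> V" using p f by (intro V_mult)
  then obtain N2 where N2: "N2 \<ge> 1" "of_real N2 - p * (p * f) \<in> M"
    using module_bound[OF M] by blast
  \<comment> \<open>All that matters is \<open>2 * k \<ge> N1\<close> and
    \<open>2 * k - 1 \<ge> N2\<close>: then 2 k bounds p, and 2 k - 1 bounds p p f.\<close>
  define k where "k = N1 + N2"
  have k: "k \<ge> 1" "2 * k - N1 \<ge> 0" "2 * k - 1 - N2 \<ge> 0" using N1 N2 by (auto simp: k_def)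
  have "of_real N1 - p + of_real (2 * k - N1) \<in> M" using N1(2) k(2) by (intro M_add constM)
  then have e1: "of_real (2 * k) - p \<in> M" by (simp only: of_real_diff) simp
  have "of_real N2 - p * (p * f) + of_real (2 * k - 1 - N2) \<in> M"
    using N2(2) k(3) by (intro M_add constM)
  then have e2: "of_real (2 * k - 1) - p * (p * f) \<in> M" by (simp only: of_real_diff) simp
  have step: "f + of_real (r - 1 / k\<^sup>2) \<in> M" if r: "r \<ge> 0" "f + of_real r \<in> M" for r
  proof -
    let ?k = "of_real k :: 'a" and ?r = "of_real r :: 'a"
    \<comment> \<open>\<open>k\<^sup>2 (f + r - 1 / k\<^sup>2)\<close> is a combination of members of \<open>M\<close>, so that \<open>r\<close> can be lowered by the
      fixed amount \<open>1 / k\<^sup>2\<close>.\<close>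
    have "(?k - p)\<^sup>2 * (f + ?r) + of_real (2 * k) * (p * f - 1)
        + of_real r * (p * (of_real (2 * k) - p)) + (of_real (2 * k - 1) - p * (p * f)) \<in> M"
    proof (intro M_add)
      show "(?k - p)\<^sup>2 * (f + ?r) \<in> M" using r p by (intro M_mult T_square)
      show "of_real (2 * k) * (p * f - 1) \<in> M" using p k(1) by (intro M_mult T_real) auto
      show "of_real r * (p * (of_real (2 * k) - p)) \<in> M" using r p e1 by (intro M_mult T_real)
    qed (rule e2)
    also have "(?k - p)\<^sup>2 * (f + ?r) + of_real (2 * k) * (p * f - 1)
        + of_real r * (p * (of_real (2 * k) - p)) + (of_real (2 * k - 1) - p * (p * f))
       = ?k * ?k * f - 1 + ?r * (?k * ?k)"
      by (simp add: algebra_simps power2_eq_square)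
    finally have "of_real (1 / k\<^sup>2) * (?k * ?k * f - 1 + ?r * (?k * ?k)) \<in> M"
      by (intro M_mult T_real) auto
    also have "of_real (1 / k\<^sup>2) * (?k * ?k * f - 1 + ?r * (?k * ?k))
        = of_real (1 / k\<^sup>2 * k * k) * f - of_real (1 / k\<^sup>2) + of_real (1 / k\<^sup>2 * r * k * k)"
      unfolding of_real_mult by (simp only: algebra_simps mult_1_left mult_1_right)
    also have "1 / k\<^sup>2 * k * k = 1" using k(1) by (simp add: power2_eq_square)
    also have "1 / k\<^sup>2 * r * k * k = r" using k(1) by (simp add: power2_eq_square)
    finally show ?thesis by (simp only: of_real_diff of_real_1) (simp only: algebra_simps mult_1_left mult_1_right)
  qed
  have "of_real (- 1) * f \<in> V" using f by (rule V_scale)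
  then obtain N where N: "N \<ge> 1" "of_real N - of_real (- 1) * f \<in> M"
    using module_bound[OF M] by blast
  \<comment> \<open>The maximum keeps the constant nonnegative, as \<open>step\<close> demands; a
    last step that goes below 0 is repaired by adding a nonnegative constant.\<close>
  have iter: "f + of_real (max 0 (N - real i / k\<^sup>2)) \<in> M" for i
  proof (induction i)
    case 0
    then show ?case using N by (simp add: algebra_simps)
  next
    case (Suc i)
    let ?r = "max 0 (N - real i / k\<^sup>2)"
    have "real (Suc i) / k\<^sup>2 = real i / k\<^sup>2 + 1 / k\<^sup>2" "0 \<le> 1 / k\<^sup>2"
      by (simp_all add: add_divide_distrib)
    then have "?r - 1 / k\<^sup>2 \<le> max 0 (N - real (Suc i) / k\<^sup>2)" by linarith
    then have "0 \<le> max 0 (N - real (Suc i) / k\<^sup>2) - (?r - 1 / k\<^sup>2)" by simp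
    from M_add[OF step[OF _ Suc] constM[OF this]]
    have "f + of_real (?r - 1 / k\<^sup>2)
        + of_real (max 0 (N - real (Suc i) / k\<^sup>2) - (?r - 1 / k\<^sup>2)) \<in> M" by simp
    then show ?case by (simp only: of_real_diff) (simp only: algebra_simps, simp)
  qed
  obtain i where "N * k\<^sup>2 \<le> real i" using real_arch_simple by blast
  then have "N - real i / k\<^sup>2 \<le> 0" using k(1) by (simp add: field_simps)
  then show ?thesis using iter[of i] by (simp add: max_def split: if_splits)
qed

text \<open>A proper module that is maximal by Zorn's lemma cannot be enlarged to
  \<open>P + T * v\<close> without reaching - 1. Doing this for v and for - v gives two
  representations of - 1 that contradict each other, so P contains v or - v.\<close>

lemma maximal_module:
  assumes M: "M \<in> modules" "- 1 \<notin> M"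
  obtains P where "P \<in> modules" "- 1 \<notin> P" "M \<subseteq> P" "\<And>v. v \<in> V \<Longrightarrow> v \<in> P \<or> - v \<in> P"
proof -
  define \<A> where "\<A> = {P \<in> modules. - 1 \<notin> P \<and> M \<subseteq> P}"
  have "\<exists>P\<in>\<A>. \<forall>X\<in>\<A>. P \<subseteq> X \<longrightarrow> X = P"
  proof (rule subset_Zorn_nonempty)
    show "\<A> \<noteq> {}" using M by (auto simp: \<A>_def)
  next
    fix C assume C: "C \<noteq> {}" "subset.chain \<A> C"
    have tot: "X \<subseteq> Y \<or> Y \<subseteq> X" if "X \<in> C" "Y \<in> C" for X Y
      using C(2) that by (auto simp: subset_chain_def)
    have sub: "C \<subseteq> \<A>" using C(2) by (auto simp: subset_chain_def)
    obtain X0 where X0: "X0 \<in> C" using C(1) by blast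
    have "\<Union>C \<in> modules"
      unfolding modules_def
    proof (intro CollectI conjI ballI)
      show "T \<subseteq> \<Union>C" using X0 sub modulesD(1) by (fastforce simp: \<A>_def)
      show "\<Union>C \<subseteq> V" using sub modulesD(2) by (fastforce simp: \<A>_def)
      show "v + w \<in> \<Union>C" if "v \<in> \<Union>C" "w \<in> \<Union>C" for v w
      proof -
        from that obtain X Y where XY: "X \<in> C" "v \<in> X" "Y \<in> C" "w \<in> Y" by blast
        have "X \<in> modules" "Y \<in> modules" using XY sub by (auto simp: \<A>_def)
        then show ?thesis using tot[OF XY(1,3)] XY modulesD(3) by blast
      qed
      show "t * v \<in> \<Union>C" if "t \<in> T" "v \<in> \<Union>C" for t v
        using that sub modulesD(4) by (fastforce simp: \<A>_def)
      show "\<exists>N. of_real N - v \<in> \<Union>C" if "v \<in> V" for v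
      proof -
        have "X0 \<in> modules" using X0 sub by (auto simp: \<A>_def)
        then show ?thesis using module_bound[OF _ that] X0 by blast
      qed
    qed
    then show "\<Union>C \<in> \<A>" using sub X0 by (auto simp: \<A>_def)
  qed
  then obtain P where P: "P \<in> \<A>" and max: "\<And>X. X \<in> \<A> \<Longrightarrow> P \<subseteq> X \<Longrightarrow> X = P" by blast
  have Pm: "P \<in> modules" "- 1 \<notin> P" "M \<subseteq> P" using P by (auto simp: \<A>_def)
  have one: "1 \<in> T" using T_real[of 1] by simp
  have zero: "0 \<in> T" using T_real[of 0] by simp
  have key: "\<exists>s\<in>P. \<exists>t\<in>T. - 1 = s + t * v" if v: "v \<in> V" "v \<notin> P" for v
  proof -
    define X where "X = {s + t * v | s t. s \<in> P \<and> t \<in> T}"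
    have PX: "P \<subseteq> X"
    proof
      fix s assume "s \<in> P"
      then show "s \<in> X" unfolding X_def using zero by (intro CollectI exI[of _ s] exI[of _ 0]) auto
    qed
    have vX: "v \<in> X" unfolding X_def using zero one modulesD(1)[OF Pm(1)]
      by (intro CollectI exI[of _ 0] exI[of _ 1]) auto
    have "X \<in> modules"
      unfolding modules_def
    proof (intro CollectI conjI ballI)
      show "T \<subseteq> X" using PX modulesD(1)[OF Pm(1)] by auto
      show "X \<subseteq> V" unfolding X_def using modulesD(2)[OF Pm(1)] v V_add V_mult by blast
      show "x + y \<in> X" if "x \<in> X" "y \<in> X" for x y
      proof -
        from that obtain s t s' t' where "x = s + t * v" "y = s' + t' * v" "s \<in> P" "s' \<in> P"
          "t \<in> T" "t' \<in> T" by (auto simp: X_def)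
        then show ?thesis unfolding X_def using T_add modulesD(3)[OF Pm(1)]
          by (intro CollectI exI[of _ "s + s'"] exI[of _ "t + t'"]) (auto simp: algebra_simps)
      qed
      show "u * x \<in> X" if "u \<in> T" "x \<in> X" for u x
      proof -
        from that obtain s t where "x = s + t * v" "s \<in> P" "t \<in> T" by (auto simp: X_def)
        moreover have "u * (s + t * v) = u * s + (u * t) * v" by (simp add: algebra_simps)
        moreover have "u * s \<in> P" "u * t \<in> T"
          using T_mult that(1) modulesD(4)[OF Pm(1)] calculation by blast+
        ultimately show ?thesis unfolding X_def by blast
      qed
      show "\<exists>N. of_real N - x \<in> X" if "x \<in> V" for x
        using module_bound[OF Pm(1) that] PX by blast
    qed
    moreover have "X \<noteq> P" using vX v by blast
    ultimately have "- 1 \<in> X" using max[of X] PX Pm(3) by (auto simp: \<A>_def)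
    then show ?thesis by (auto simp: X_def)
  qed
  have total: "v \<in> P \<or> - v \<in> P" if v: "v \<in> V" for v
  proof (rule ccontr)
    assume "\<not> ?thesis"
    then have n: "v \<notin> P" "- v \<notin> P" by auto
    have v': "- v \<in> V" using V_scale[OF v, of "- 1"] by simp
    obtain s1 t1 where 1: "s1 \<in> P" "t1 \<in> T" "- 1 = s1 + t1 * v" using key[OF v n(1)] by blast
    obtain s2 t2 where 2: "s2 \<in> P" "t2 \<in> T" "- 1 = s2 + t2 * - v" using key[OF v' n(2)] by blast
    \<comment> \<open>Computing t1 t2 v from both representations eliminates v and exhibits - t1 as
      a member of P.\<close>
    have "t1 * (t2 * v) = t1 * (1 + s2)" using 2(3) by (simp add: algebra_simps)
    moreover have "t2 * (t1 * v) = t2 * (- 1 - s1)" using 1(3) by (simp add: algebra_simps)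
    ultimately have "t1 * (1 + s2) = t2 * (- 1 - s1)" by (simp add: mult.left_commute)
    then have "t1 * (1 + s2) - t2 * (- 1 - s1) = 0" by simp
    then have "t1 + (t2 + t2 * s1 + t1 * s2) = 0" by (simp add: algebra_simps)
    then have e: "- t1 = t2 + t2 * s1 + t1 * s2" by (rule minus_unique)
    have "t2 + t2 * s1 + t1 * s2 \<in> P"
      using 1 2 modulesD(1,3,4)[OF Pm(1)] by blast
    then have nt: "- t1 \<in> P" using e by simp
    \<comment> \<open>Since v itself is not in P, the product t1 v is reached as t1 (N + v) + N (-
      t1), both summands of which lie in P.\<close>
    obtain N where N: "N \<ge> 1" "of_real N - (- v) \<in> P" using module_bound[OF Pm(1) v'] by blast
    have "s1 + (t1 * (of_real N - (- v)) + of_real N * (- t1)) \<in> P"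
    proof (intro modulesD(3)[OF Pm(1)])
      show "t1 * (of_real N - (- v)) \<in> P" using 1 N by (intro modulesD(4)[OF Pm(1)])
      show "of_real N * (- t1) \<in> P" using nt N by (intro modulesD(4)[OF Pm(1)] T_real) auto
    qed (rule 1)
    also have "s1 + (t1 * (of_real N - (- v)) + of_real N * (- t1)) = - 1"
      unfolding 1(3) by (simp add: algebra_simps)
    finally show False using Pm(2) by blast
  qed
  show ?thesis using that[OF Pm total] .
qed

text \<open>The module \<open>M - T * f\<close> is proper: - 1 in it would be a certificate for
  \<open>module_descent\<close> and put f into M. In a maximal proper module P above it every
  element of V is infinitely close to exactly one real number, its value under \<phi>; stability of
  P under T makes \<phi> multiplicative on T.\<close>

lemma separating_functional:
  assumes M: "M \<in> modules" and f: "f \<in> V" "f \<notin> M"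
  obtains \<phi> :: "'a \<Rightarrow> real" where
    "\<And>v w. v \<in> V \<Longrightarrow> w \<in> V \<Longrightarrow> \<phi> (v + w) = \<phi> v + \<phi> w"
    "\<And>r v. v \<in> V \<Longrightarrow> \<phi> (of_real r * v) = r * \<phi> v"
    "\<And>t v. t \<in> T \<Longrightarrow> v \<in> V \<Longrightarrow> \<phi> (t * v) = \<phi> t * \<phi> v"
    "\<And>v. v \<in> M \<Longrightarrow> \<phi> v \<ge> 0" "\<phi> 1 = 1" "\<phi> f \<le> 0"
proof -
  have one: "1 \<in> T" using T_real[of 1] by simp
  have zero: "0 \<in> T" using T_real[of 0] by simp
  define M' where "M' = {q - t * f | q t. q \<in> M \<and> t \<in> T}"
  have MM': "M \<subseteq> M'"
  proof
    fix s assume "s \<in> M"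
    then show "s \<in> M'" unfolding M'_def using zero
      by (intro CollectI exI[of _ s] exI[of _ 0]) auto
  qed
  have f': "- f \<in> M'" unfolding M'_def using zero one modulesD(1)[OF M]
    by (intro CollectI exI[of _ 0] exI[of _ 1]) auto
  have nV: "- v \<in> V" if "v \<in> V" for v using V_scale[OF that, of "- 1"] by simp
  have "M' \<in> modules"
    unfolding modules_def
  proof (intro CollectI conjI ballI)
    show "T \<subseteq> M'" using MM' modulesD(1)[OF M] by auto
    show "M' \<subseteq> V"
    proof
      fix x assume "x \<in> M'"
      then obtain q t where "x = q + t * - f" "q \<in> M" "t \<in> T" by (auto simp: M'_def)
      then show "x \<in> V" using modulesD(2)[OF M] nV[OF f(1)] V_add V_mult by blast
    qed
    show "x + y \<in> M'" if "x \<in> M'" "y \<in> M'" for x y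
    proof -
      from that obtain s t s' t' where "x = s - t * f" "y = s' - t' * f" "s \<in> M" "s' \<in> M"
        "t \<in> T" "t' \<in> T" by (auto simp: M'_def)
      then show ?thesis unfolding M'_def using T_add modulesD(3)[OF M]
        by (intro CollectI exI[of _ "s + s'"] exI[of _ "t + t'"]) (auto simp: algebra_simps)
    qed
    show "u * x \<in> M'" if "u \<in> T" "x \<in> M'" for u x
    proof -
      from that obtain s t where "x = s - t * f" "s \<in> M" "t \<in> T" by (auto simp: M'_def)
      moreover have "u * (s - t * f) = u * s - (u * t) * f" by (simp add: algebra_simps)
      moreover have "u * s \<in> M" "u * t \<in> T"
        using T_mult that(1) modulesD(4)[OF M] calculation by blast+
      ultimately show ?thesis unfolding M'_def by blast
    qed
    show "\<exists>N. of_real N - x \<in> M'" if "x \<in> V" for x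
      using module_bound[OF M that] MM' by blast
  qed
  moreover have "- 1 \<notin> M'"
  proof
    assume "- 1 \<in> M'"
    then obtain q t where qt: "- 1 = q - t * f" "q \<in> M" "t \<in> T" by (auto simp: M'_def)
    then have "t * f - 1 = q" by (simp add: algebra_simps)
    then show False using module_descent[OF M f(1) qt(3)] qt(2) f(2) by simp
  qed
  ultimately obtain P where P: "P \<in> modules" "- 1 \<notin> P" "M' \<subseteq> P"
    and total: "\<And>v. v \<in> V \<Longrightarrow> v \<in> P \<or> - v \<in> P" using maximal_module by blast
  note P_add = modulesD(3)[OF P(1)] and P_mult = modulesD(4)[OF P(1)]
    and constP = modulesD(5)[OF P(1)]
  have constV: "of_real r \<in> V" for r
    using V_scale[of 1 r] one modulesD(1,2)[OF P(1)] by auto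
  have scaleP: "of_real r * v \<in> P" if "r \<ge> 0" "v \<in> P" for r v
    using that by (intro P_mult T_real)
  have negP: "r \<ge> 0" if "of_real r \<in> P" for r
  proof (rule ccontr)
    assume "\<not> r \<ge> 0"
    then have "of_real (- 1 / r) * of_real r \<in> P" using that by (intro scaleP) auto
    moreover have "of_real (- 1 / r) * of_real r = (- 1 :: 'a)"
      using \<open>\<not> r \<ge> 0\<close> by (simp flip: of_real_mult)
    ultimately show False using P(2) by simp
  qed
  \<comment> \<open>The standard part of v in the preorder defined by P.\<close>
  define std where "std v c \<longleftrightarrow> (\<forall>e>0. v - of_real c + of_real e \<in> P \<and> of_real c - v + of_real e \<in> P)"
    for v c
  have uniq: "c = d" if "std v c" "std v d" for v c d
  proof -
    have le: "c \<le> d" if "std v c" "std v d" for c d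
    proof (rule field_le_epsilon)
      fix e :: real assume "e > 0"
      then have "e / 2 > 0" by simp
      then have "(v - of_real c + of_real (e / 2)) + (of_real d - v + of_real (e / 2)) \<in> P"
        using that unfolding std_def by (meson P_add)
      also have "(v - of_real c + of_real (e / 2)) + (of_real d - v + of_real (e / 2))
          = of_real (d - c + (e / 2 + e / 2))"
        by (simp only: of_real_add of_real_diff) (simp add: algebra_simps)
      finally show "c \<le> d + e" using negP by fastforce
    qed
    show ?thesis using le that by (meson antisym)
  qed
  have ex: "\<exists>c. std v c" if v: "v \<in> V" for v
  proof -
    define S where "S = {r. v - of_real r \<in> P}"
    obtain N1 where N1: "of_real N1 - v \<in> P" using module_bound[OF P(1) v] by blast
    obtain N2 where N2: "of_real N2 - (- v) \<in> P" using module_bound[OF P(1) nV[OF v]] by blast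
    have "- N2 \<in> S" using N2 by (simp add: S_def algebra_simps)
    then have ne: "S \<noteq> {}" by blast
    have bd: "bdd_above S"
    proof (rule bdd_aboveI[of _ N1])
      fix r assume "r \<in> S"
      then have "(of_real N1 - v) + (v - of_real r) \<in> P"
        unfolding S_def by (intro P_add[OF N1]) simp
      also have "(of_real N1 - v) + (v - of_real r) = of_real (N1 - r)" by simp
      finally have "of_real (N1 - r) \<in> P" .
      then show "r \<le> N1" using negP by fastforce
    qed
    have "std v (Sup S)"
      unfolding std_def
    proof (intro allI impI conjI)
      fix e :: real assume e: "e > 0"
      then obtain r where r: "r \<in> S" "Sup S - e < r"
        using less_cSup_iff[OF ne bd, of "Sup S - e"] by auto
      then have "(v - of_real r) + of_real (r - (Sup S - e)) \<in> P"
        by (intro P_add constP) (auto simp: S_def)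
      then show "v - of_real (Sup S) + of_real e \<in> P"
        by (simp only: of_real_diff) (simp add: algebra_simps)
      \<comment> \<open>Beyond the supremum membership in P fails, and totality of P turns the
        failure into the opposite inequality.\<close>
      have "Sup S + e \<notin> S" using cSup_upper[OF _ bd, of "Sup S + e"] e by auto
      then have "v - of_real (Sup S + e) \<notin> P" by (simp add: S_def)
      moreover have "v - of_real (Sup S + e) \<in> V"
        using V_add[OF v nV[OF constV]] by (simp only: diff_conv_add_uminus)
      ultimately have "- (v - of_real (Sup S + e)) \<in> P" using total by blast
      then show "of_real (Sup S) - v + of_real e \<in> P" by (simp add: algebra_simps)
    qed
    then show ?thesis by blast
  qed
  define \<phi> where "\<phi> v = (THE c. std v c)" for v
  have phiI: "\<phi> v = c" if "std v c" for v c
    unfolding \<phi>_def using that uniq by blast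
  have phi: "std v (\<phi> v)" if "v \<in> V" for v
    using ex[OF that] phiI by metis
  have add: "\<phi> (v + w) = \<phi> v + \<phi> w" if "v \<in> V" "w \<in> V" for v w
  proof (rule phiI, unfold std_def, intro allI impI conjI)
    fix e :: real assume "e > 0"
    then have "e / 2 > 0" by simp
    then have "(v - of_real (\<phi> v) + of_real (e / 2)) + (w - of_real (\<phi> w) + of_real (e / 2)) \<in> P"
      "(of_real (\<phi> v) - v + of_real (e / 2)) + (of_real (\<phi> w) - w + of_real (e / 2)) \<in> P"
      using phi that unfolding std_def by (meson P_add)+
    moreover have "of_real (e / 2) + of_real (e / 2) = (of_real e :: 'a)"
      by (simp flip: of_real_add)
    ultimately show "v + w - of_real (\<phi> v + \<phi> w) + of_real e \<in> P"
      "of_real (\<phi> v + \<phi> w) - (v + w) + of_real e \<in> P"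
      by (simp_all add: algebra_simps)
  qed
  have pos: "\<phi> v \<ge> 0" if "v \<in> P" for v
  proof (rule field_le_epsilon)
    fix e :: real assume "e > 0"
    moreover have "v \<in> V" using that modulesD(2)[OF P(1)] by blast
    ultimately have "v + (of_real (\<phi> v) - v + of_real e) \<in> P"
      using phi that unfolding std_def by (meson P_add)
    then have "of_real (\<phi> v + e) \<in> P" by simp
    then show "0 \<le> \<phi> v + e" using negP by blast
  qed
  have const: "\<phi> (of_real r) = r" for r
    by (rule phiI) (auto simp: std_def intro: constP)
  have neg: "\<phi> (- v) = - \<phi> v" if "v \<in> V" for v
    using add[OF that nV[OF that]] const[of 0] by simp
  have scale0: "\<phi> (of_real r * v) = r * \<phi> v" if v: "v \<in> V" and r: "r > 0" for r v
  proof (rule phiI, unfold std_def, intro allI impI conjI)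
    fix e :: real assume "e > 0"
    then have "e / r > 0" using r by simp
    then have "of_real r * (v - of_real (\<phi> v) + of_real (e / r)) \<in> P"
      "of_real r * (of_real (\<phi> v) - v + of_real (e / r)) \<in> P"
      using phi[OF v] r unfolding std_def by (meson scaleP less_imp_le)+
    moreover have "of_real r * of_real (e / r) = (of_real e :: 'a)"
      using r by (simp flip: of_real_mult)
    ultimately show "of_real r * v - of_real (r * \<phi> v) + of_real e \<in> P"
      "of_real (r * \<phi> v) - of_real r * v + of_real e \<in> P"
      by (simp_all add: algebra_simps)
  qed
  have scale: "\<phi> (of_real r * v) = r * \<phi> v" if v: "v \<in> V" for r v
  proof -
    consider "r > 0" | "r = 0" | "r < 0" by linarith
    then show ?thesis
    proof cases
      case 3
      then have "\<phi> (of_real (- r) * v) = - r * \<phi> v" using scale0[OF v, of "- r"] by simp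
      moreover have "\<phi> (of_real r * v) = - \<phi> (of_real (- r) * v)"
        using neg[OF V_scale[OF v, of "- r"]] by simp
      ultimately show ?thesis by simp
    qed (use scale0 v const[of 0] in auto)
  qed
  \<comment> \<open>Here v + e / N lies in P for a bound N of t, so multiplication by t costs an
    error of only e / N times \<phi> t, at most e.\<close>
  have mult0: "\<phi> (t * v) \<ge> 0" if t: "t \<in> T" and v: "v \<in> V" "\<phi> v = 0" for t v
  proof (rule field_le_epsilon)
    fix e :: real assume e: "e > 0"
    have tV: "t \<in> V" using t modulesD(1,2)[OF P(1)] by auto
    obtain N where N: "N \<ge> 1" "of_real N - t \<in> P" using module_bound[OF P(1) tV] by blast
    have "t * (v + of_real (e / N)) \<in> P"
      using phi[OF v(1)] v(2) e N(1) t unfolding std_def by (intro P_mult) auto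
    then have "0 \<le> \<phi> (t * v + of_real (e / N) * t)" using pos by (simp add: algebra_simps)
    also have "\<dots> = \<phi> (t * v) + e / N * \<phi> t" using add scale V_mult V_scale t v tV by metis
    also have "\<phi> t \<le> N"
      using pos[OF N(2)] add[OF constV nV[OF tV], of N] neg[OF tV] const by simp
    then have "e / N * \<phi> t \<le> e / N * N" using e N(1) by (intro mult_left_mono) auto
    also have "\<dots> = e" using N(1) by simp
    finally show "0 \<le> \<phi> (t * v) + e" by simp
  qed
  have mult: "\<phi> (t * v) = \<phi> t * \<phi> v" if t: "t \<in> T" and v: "v \<in> V" for t v
  proof -
    have tV: "t \<in> V" using t modulesD(1,2)[OF P(1)] by auto
    \<comment> \<open>Centering v at value 0 makes \<open>mult0\<close> applicable to w and to - w,
      so the value of t w is 0.\<close>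
    define w where "w = v + of_real (- \<phi> v)"
    have w: "w \<in> V" unfolding w_def by (intro V_add v constV)
    have w0: "\<phi> w = 0" unfolding w_def add[OF v constV] const by simp
    have "\<phi> (t * - w) \<ge> 0" using mult0[OF t nV[OF w]] neg[OF w] w0 by simp
    moreover have "\<phi> (t * - w) = - \<phi> (t * w)" using neg[OF V_mult[OF t w]] by simp
    ultimately have z: "\<phi> (t * w) = 0" using mult0[OF t w w0] by simp
    have "t * v = t * w + of_real (\<phi> v) * t" by (simp add: w_def algebra_simps)
    then show ?thesis
      using z add[OF V_mult[OF t w] V_scale[OF tV]] scale[OF tV] by simp
  qed
  show ?thesis
  proof (rule that[OF add scale mult])
    show "\<phi> v \<ge> 0" if "v \<in> M" for v using that MM' P(3) pos by blast
    show "\<phi> 1 = 1" using const[of 1] by simp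
    show "\<phi> f \<le> 0" using pos[of "- f"] f' P(3) neg[OF f(1)] by auto
  qed
qed

end

section \<open>Positive functionals on pairs of quaternions\<close>

text \<open>Cholesky factorization by induction on the index set: the Schur complement of the new
  index is again positive semidefinite, and the removed row contributes one more vector.\<close>

lemma psd_kernel_factorization:
  fixes S :: "'i \<Rightarrow> 'i \<Rightarrow> real"
  assumes "finite I" and "\<And>i j. S i j = S j i"
    and "\<And>x. 0 \<le> (\<Sum>i\<in>I. \<Sum>j\<in>I. x i * x j * S i j)"
  shows "\<exists>v. \<forall>i\<in>I. \<forall>j\<in>I. S i j = (\<Sum>k\<in>I. v k i * v k j)"
  using assms
proof (induction I arbitrary: S rule: finite_induct)
  case empty
  then show ?case by simp
next
  case (insert a I)
  have expand: "(\<Sum>i\<in>insert a I. \<Sum>j\<in>insert a I. x i * x j * S i j)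
      = x a * x a * S a a + 2 * x a * (\<Sum>i\<in>I. x i * S i a) + (\<Sum>i\<in>I. \<Sum>j\<in>I. x i * x j * S i j)"
    for x
  proof -
    have "(\<Sum>i\<in>insert a I. \<Sum>j\<in>insert a I. x i * x j * S i j)
      = x a * x a * S a a + (\<Sum>j\<in>I. x a * x j * S a j)
        + ((\<Sum>i\<in>I. x i * x a * S i a) + (\<Sum>i\<in>I. \<Sum>j\<in>I. x i * x j * S i j))"
      using insert.hyps by (simp add: sum.distrib)
    moreover have "(\<Sum>j\<in>I. x a * x j * S a j) = x a * (\<Sum>i\<in>I. x i * S i a)"
      unfolding sum_distrib_left insert.prems(1)[of a] by (simp add: mult_ac)
    moreover have "(\<Sum>i\<in>I. x i * x a * S i a) = x a * (\<Sum>i\<in>I. x i * S i a)"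
      unfolding sum_distrib_left by (simp add: mult_ac)
    ultimately show ?thesis by simp
  qed
  have quad: "0 \<le> t * t * S a a + 2 * t * (\<Sum>i\<in>I. x i * S i a) + (\<Sum>i\<in>I. \<Sum>j\<in>I. x i * x j * S i j)"
    for t x
  proof -
    let ?y = "x(a := t)"
    have e: "?y i = x i" if "i \<in> I" for i using that insert.hyps by auto
    have "(\<Sum>i\<in>I. ?y i * S i a) = (\<Sum>i\<in>I. x i * S i a)"
      by (intro sum.cong refl) (simp only: e)
    moreover have "(\<Sum>i\<in>I. \<Sum>j\<in>I. ?y i * ?y j * S i j) = (\<Sum>i\<in>I. \<Sum>j\<in>I. x i * x j * S i j)"
      by (intro sum.cong refl) (simp only: e)
    ultimately show ?thesis using insert.prems(2)[of ?y] unfolding expand by simp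
  qed
  have diag: "0 \<le> S a a" using quad[of 1 "\<lambda>_. 0"] by simp
  \<comment> \<open>With a zero diagonal entry the form is affine in the coordinate t; at t = - (Q +
    1) / (2 B) it would take the value - 1.\<close>
  have lin: "(\<Sum>i\<in>I. x i * S i a) = 0" if "S a a = 0" for x
  proof (rule ccontr)
    define B where "B = (\<Sum>i\<in>I. x i * S i a)"
    define Q where "Q = (\<Sum>i\<in>I. \<Sum>j\<in>I. x i * x j * S i j)"
    assume "(\<Sum>i\<in>I. x i * S i a) \<noteq> 0"
    then have "B \<noteq> 0" by (simp add: B_def)
    then show False
      using quad[of "- (Q + 1) / (2 * B)" x] that unfolding B_def[symmetric] Q_def[symmetric]
      by (simp add: field_simps)
  qed
  have off: "S i a = 0" if "S a a = 0" "i \<in> I" for i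
    using lin[OF that(1), of "\<lambda>j. if j = i then 1 else 0"] that(2) insert.hyps(1)
    by (simp add: if_distrib[of "\<lambda>c. c * _"] cong: if_cong)
  define S' where "S' i j = S i j - S i a * S j a / S a a" for i j
  have "\<exists>v. \<forall>i\<in>I. \<forall>j\<in>I. S' i j = (\<Sum>k\<in>I. v k i * v k j)"
  proof (rule insert.IH)
    show "S' i j = S' j i" for i j
      using insert.prems(1)[of i j] by (simp add: S'_def)
    show "0 \<le> (\<Sum>i\<in>I. \<Sum>j\<in>I. x i * x j * S' i j)" for x
    proof -
      define B where "B = (\<Sum>i\<in>I. x i * S i a)"
      have "(\<Sum>i\<in>I. \<Sum>j\<in>I. x i * x j * S' i j)
          = (\<Sum>i\<in>I. \<Sum>j\<in>I. x i * x j * S i j) - B * B / S a a"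
        unfolding B_def S'_def sum_product sum_divide_distrib sum_subtractf[symmetric]
        by (simp add: algebra_simps)
      also have "\<dots> \<ge> 0"
        \<comment> \<open>This t minimizes the form in the removed coordinate, and the minimum is
          the Schur complement.\<close>
        using quad[of "- B / S a a" x] lin[of x] unfolding B_def[symmetric]
        by (cases "S a a = 0") (auto simp: field_simps)
      finally show ?thesis .
    qed
  qed
  then obtain v where v: "\<And>i j. i \<in> I \<Longrightarrow> j \<in> I \<Longrightarrow> S' i j = (\<Sum>k\<in>I. v k i * v k j)" by blast
  \<comment> \<open>If \<open>S a a = 0\<close>, division by zero makes the vector at a vanish, in
    agreement with \<open>off\<close>.\<close>
  define w where "w k i = (if k = a then S i a / sqrt (S a a) else if i = a then 0 else v k i)" for k i
  have "S i j = (\<Sum>k\<in>insert a I. w k i * w k j)" if ij: "i \<in> insert a I" "j \<in> insert a I" for i j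
  proof -
    have "(\<Sum>k\<in>insert a I. w k i * w k j) = w a i * w a j + (\<Sum>k\<in>I. w k i * w k j)"
      using insert.hyps by simp
    also have "(\<Sum>k\<in>I. w k i * w k j) = (if i = a \<or> j = a then 0 else \<Sum>k\<in>I. v k i * v k j)"
      using insert.hyps(2) by (auto intro!: sum.cong sum.neutral simp: w_def)
    also have "w a i * w a j = S i a * S j a / S a a"
      using diag by (simp add: w_def)
    also have "S i a * S j a / S a a + (if i = a \<or> j = a then 0 else \<Sum>k\<in>I. v k i * v k j) = S i j"
    proof (cases "i = a \<or> j = a")
      case True
      then show ?thesis
        using ij off[of i] off[of j] insert.prems(1)[of a j] by (cases "S a a = 0") auto
    next
      case False
      then show ?thesis using ij v[of i j] by (simp add: S'_def)
    qed
    finally show ?thesis by simp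
  qed
  then show ?case by blast
qed

lemma lessThan_4: "{..<4::nat} = {0, 1, 2, 3}"
  by auto

definition quat_unit :: "nat \<Rightarrow> quat" where
  "quat_unit m = Quat (of_bool (m = 0)) (of_bool (m = 1)) (of_bool (m = 2)) (of_bool (m = 3))"

lemma quat_unit_sel [simp]:
  "qRe (quat_unit m) = of_bool (m = 0)" "qI (quat_unit m) = of_bool (m = 1)"
  "qJ (quat_unit m) = of_bool (m = 2)" "qK (quat_unit m) = of_bool (m = 3)"
  by (simp_all add: quat_unit_def)

lemma quat_eq_sum_units:
  "c = qRe c *\<^sub>R quat_unit 0 + qI c *\<^sub>R quat_unit 1 + qJ c *\<^sub>R quat_unit 2 + qK c *\<^sub>R quat_unit 3"
  by (simp add: quat_eq_iff)

lemma bilinear_quat_expand: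
  fixes F :: "quat \<Rightarrow> quat \<Rightarrow> real"
  assumes add: "\<And>c d z. F (c + d) z = F c z + F d z" "\<And>c z w. F c (z + w) = F c z + F c w"
    and scale: "\<And>r c z. F (r *\<^sub>R c) z = r * F c z" "\<And>r c z. F c (r *\<^sub>R z) = r * F c z"
  defines "f m n \<equiv> F (quat_unit m) (quat_unit n)"
  shows "F c z = qRe c * (qRe z * f 0 0 + qI z * f 0 1 + qJ z * f 0 2 + qK z * f 0 3)
    + qI c * (qRe z * f 1 0 + qI z * f 1 1 + qJ z * f 1 2 + qK z * f 1 3)
    + qJ c * (qRe z * f 2 0 + qI z * f 2 1 + qJ z * f 2 2 + qK z * f 2 3)
    + qK c * (qRe z * f 3 0 + qI z * f 3 1 + qJ z * f 3 2 + qK z * f 3 3)"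
  by (subst quat_eq_sum_units[of c], subst quat_eq_sum_units[of z])
    (simp only: add scale f_def distrib_left add_ac mult.left_commute)

text \<open>For imaginary c and z the coefficients are minus the matrix entries of c \<mapsto>
  \<open>qcnj v * c * v\<close>, a rotation scaled by the squared norm of v. Being quadratic in the
  coordinates of v, they are linear in the products of two coordinates.\<close>

lemma conj_form_expand:
  "qRe (qcnj (Quat p q r s) * c * Quat p q r s * z) =
    qRe c * qRe z * (p * p + q * q + r * r + s * s)
    + qI c * (qI z * (- (p * p) - q * q + r * r + s * s) + qJ z * (- 2 * (q * r) + 2 * (p * s))
        + qK z * (- 2 * (q * s) - 2 * (p * r)))
    + qJ c * (qI z * (- 2 * (q * r) - 2 * (p * s)) + qJ z * (- (p * p) + q * q - r * r + s * s)
        + qK z * (- 2 * (r * s) + 2 * (p * q)))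
    + qK c * (qI z * (- 2 * (q * s) + 2 * (p * r)) + qJ z * (- 2 * (r * s) - 2 * (p * q))
        + qK z * (- (p * p) + q * q + r * r - s * s))"
  by (simp add: algebra_simps)

text \<open>The maps v \<mapsto> c v z span all real 4 by 4 matrices, and conjugating both c and z
  is transposition. So F is a transposition-invariant positive functional on matrices, that is, the
  trace against a positive semidefinite matrix G; each rank-one summand of G is a vector
  state.\<close>

lemma quat_state_decomposition:
  fixes F :: "quat \<Rightarrow> quat \<Rightarrow> real"
  assumes add: "\<And>c d z. F (c + d) z = F c z + F d z" "\<And>c z w. F c (z + w) = F c z + F c w"
    and scale: "\<And>r c z. F (r *\<^sub>R c) z = r * F c z" "\<And>r c z. F c (r *\<^sub>R z) = r * F c z"
    and cnj: "\<And>c z. F (qcnj c) (qcnj z) = F c z"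
    and pos: "\<And>c z. 0 \<le> (\<Sum>k<4::nat. \<Sum>l<4::nat. F (qcnj (c k) * c l) (z l * qcnj (z k)))"
  shows "\<exists>v :: nat \<Rightarrow> quat. \<forall>c z. F c z = (\<Sum>j<4. qRe (qcnj (v j) * c * v j * z))"
proof -
  define f where "f m n = F (quat_unit m) (quat_unit n)" for m n
  note F16 = bilinear_quat_expand[of F, OF add scale, folded f_def]
  \<comment> \<open>Conjugation flips the sign of exactly one argument. Ten values remain, as many
    as a symmetric 4 by 4 matrix has free entries.\<close>
  have z: "f 0 1 = 0" "f 0 2 = 0" "f 0 3 = 0" "f 1 0 = 0" "f 2 0 = 0" "f 3 0 = 0"
    using cnj[of "quat_unit 0" "quat_unit 1"] cnj[of "quat_unit 0" "quat_unit 2"]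
      cnj[of "quat_unit 0" "quat_unit 3"] cnj[of "quat_unit 1" "quat_unit 0"]
      cnj[of "quat_unit 2" "quat_unit 0"] cnj[of "quat_unit 3" "quat_unit 0"]
    unfolding F16 by simp_all
  have F10: "F c z = qRe c * qRe z * f 0 0
    + qI c * (qI z * f 1 1 + qJ z * f 1 2 + qK z * f 1 3)
    + qJ c * (qI z * f 2 1 + qJ z * f 2 2 + qK z * f 2 3)
    + qK c * (qI z * f 3 1 + qJ z * f 3 2 + qK z * f 3 3)" for c z
    unfolding F16 z by simp
  \<comment> \<open>For \<open>F c z = Re (v\<^sup>* c v z)\<close> the identity \<open>\<Sum>\<^sub>m u\<^sub>m y u\<^sub>m\<^sup>* = 4 Re y\<close> gives \<open>G i j = v\<^sub>i v\<^sub>j\<close>.\<close>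
  define G where "G i j = (\<Sum>m<4. F (quat_unit i * quat_unit m * qcnj (quat_unit j)) (qcnj (quat_unit m))) / 4"
    for i j
  have "\<exists>v. \<forall>i\<in>{..<4}. \<forall>j\<in>{..<4}. G i j = (\<Sum>k\<in>{..<4::nat}. v k i * v k j)"
  proof (rule psd_kernel_factorization)
    have "F (quat_unit j * quat_unit m * qcnj (quat_unit i)) (qcnj (quat_unit m))
        = F (quat_unit i * quat_unit m * qcnj (quat_unit j)) (qcnj (quat_unit m))" for i j m
    proof -
      have "\<exists>e. qcnj (quat_unit m) = e *\<^sub>R quat_unit m \<and> e * e = 1"
        by (intro exI[of _ "if m = 0 then 1 else - 1"]) (auto simp: quat_eq_iff)
      then obtain e where e: "qcnj (quat_unit m) = e *\<^sub>R quat_unit m" "e * e = 1" by blast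
      show ?thesis
        using cnj[of "quat_unit j * quat_unit m * qcnj (quat_unit i)" "qcnj (quat_unit m)"] e(2)
        by (auto simp: mult.assoc e(1) scale)
    qed
    then show "G i j = G j i" for i j unfolding G_def by simp
    show "0 \<le> (\<Sum>i\<in>{..<4}. \<Sum>j\<in>{..<4}. x i * x j * G i j)" for x
    proof -
      define y where "y = (\<Sum>i<4. x i *\<^sub>R quat_unit i)"
      define H where "H c d = F (y * c * qcnj y) d" for c d
      define h where "h m n = H (quat_unit m) (quat_unit n)" for m n
      have H_lin: "H (c + c') d = H c d + H c' d" "H c (d + d') = H c d + H c d'"
        "H (r *\<^sub>R c) d = r * H c d" "H c (r *\<^sub>R d) = r * H c d" for c c' d d' r
        by (simp_all add: H_def add scale distrib_left distrib_right)
      \<comment> \<open>The choice of pairs turns the squared operator into a positive multiple of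
        the rank-one operator v \<mapsto> Re (\<open>qcnj y\<close> v) y. Products of units are
        units up to sign; the signs cancel by bilinearity and each unit occurs four times.\<close>
      have "0 \<le> (\<Sum>k<4. \<Sum>l<4. F (qcnj (quat_unit k * qcnj y) * (quat_unit l * qcnj y))
          (qcnj (quat_unit l) * qcnj (qcnj (quat_unit k))))"
        by (rule pos)
      also have "\<dots> = (\<Sum>k<4. \<Sum>l<4. H (qcnj (quat_unit k) * quat_unit l)
          (qcnj (quat_unit l) * quat_unit k))"
        by (simp add: H_def mult.assoc del: times_quat.sel)
      also have "\<dots> = 4 * (\<Sum>m<4. H (quat_unit m) (qcnj (quat_unit m)))"
        unfolding bilinear_quat_expand[of H, OF H_lin, folded h_def] by (simp add: lessThan_4)
      also have "(\<Sum>m<4. H (quat_unit m) (qcnj (quat_unit m)))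
          = (\<Sum>m<4. \<Sum>i<4. \<Sum>j<4. x i * x j
              * F (quat_unit i * quat_unit m * qcnj (quat_unit j)) (qcnj (quat_unit m)))"
      proof -
        have F0: "F 0 d = 0" for d using scale(1)[of 0 0 d] by simp
        have "F (sum h A) d = (\<Sum>i\<in>A. F (h i) d)" for h d and A :: "nat set"
          by (induction A rule: infinite_finite_induct) (simp_all add: F0 add)
        then show ?thesis
          by (simp add: H_def y_def qcnj_sum sum_distrib_left sum_distrib_right scale mult_ac
              del: times_quat.sel)
            (rule sum.cong[OF refl], subst sum.swap, simp add: mult_ac del: times_quat.sel)
      qed
      also have "\<dots> = 4 * (\<Sum>i\<in>{..<4}. \<Sum>j\<in>{..<4}. x i * x j * G i j)"
        unfolding G_def sum_distrib_left sum_divide_distrib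
        by (subst sum.swap, rule sum.cong[OF refl], subst sum.swap) simp
      finally show ?thesis by simp
    qed
  qed simp
  then obtain v where v: "\<And>i j. i < 4 \<Longrightarrow> j < 4 \<Longrightarrow> G i j = (\<Sum>k<4::nat. v k i * v k j)" by auto
  define w where "w k = Quat (v k 0) (v k 1) (v k 2) (v k 3)" for k
  have G: "G 0 0 = (f 0 0 - f 1 1 - f 2 2 - f 3 3) / 4" "G 1 1 = (f 0 0 - f 1 1 + f 2 2 + f 3 3) / 4"
    "G 2 2 = (f 0 0 + f 1 1 - f 2 2 + f 3 3) / 4" "G 3 3 = (f 0 0 + f 1 1 + f 2 2 - f 3 3) / 4"
    "G 0 1 = (f 2 3 - f 3 2) / 4" "G 0 2 = (f 3 1 - f 1 3) / 4" "G 0 3 = (f 1 2 - f 2 1) / 4"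
    "G 1 2 = - (f 1 2 + f 2 1) / 4" "G 1 3 = - (f 1 3 + f 3 1) / 4" "G 2 3 = - (f 2 3 + f 3 2) / 4"
    by (simp_all add: lessThan_4 G_def F10)
  \<comment> \<open>The coefficients of \<open>conj_form_expand\<close>, with products of
    coordinates replaced by entries of G.\<close>
  have fG: "f 0 0 = G 0 0 + G 1 1 + G 2 2 + G 3 3" "f 1 1 = - G 0 0 - G 1 1 + G 2 2 + G 3 3"
    "f 2 2 = - G 0 0 + G 1 1 - G 2 2 + G 3 3" "f 3 3 = - G 0 0 + G 1 1 + G 2 2 - G 3 3"
    "f 1 2 = - 2 * G 1 2 + 2 * G 0 3" "f 2 1 = - 2 * G 1 2 - 2 * G 0 3"
    "f 1 3 = - 2 * G 1 3 - 2 * G 0 2" "f 3 1 = - 2 * G 1 3 + 2 * G 0 2"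
    "f 2 3 = - 2 * G 2 3 + 2 * G 0 1" "f 3 2 = - 2 * G 2 3 - 2 * G 0 1"
    unfolding G by argo+
  have "F c z = (\<Sum>j<4. qRe (qcnj (w j) * c * w j * z))" for c z
    unfolding F10 fG w_def conj_form_expand by (simp add: v lessThan_4) (simp add: algebra_simps)
  then show ?thesis by blast
qed

section \<open>Quaternionic states and their evaluations\<close>

text \<open>The model is \<beta> c x = \<phi> (Re (c x)). The reversed order of the second arguments
  in \<open>\<beta>_pos\<close> and the trace property \<open>\<beta>_cyc\<close> come from
  cyclicity of the real part; \<open>\<beta>_sym\<close> says that symmetric elements behave like
  scalars.\<close>

locale quat_state =
  fixes st :: "'a :: real_algebra_1 \<Rightarrow> 'a" and \<beta> :: "quat \<Rightarrow> 'a \<Rightarrow> real"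
  assumes st_add: "st (x + y) = st x + st y"
    and st_mult: "st (x * y) = st y * st x"
    and st_st [simp]: "st (st x) = x"
    and st_scale: "st (r *\<^sub>R x) = r *\<^sub>R st x"
    and \<beta>_add_left: "\<beta> (c + c') x = \<beta> c x + \<beta> c' x"
    and \<beta>_scale_left: "\<beta> (r *\<^sub>R c) x = r * \<beta> c x"
    and \<beta>_add: "\<beta> c (x + y) = \<beta> c x + \<beta> c y"
    and \<beta>_scale: "\<beta> c (r *\<^sub>R x) = r * \<beta> c x"
    and \<beta>_one: "\<beta> c 1 = qRe c"
    and \<beta>_st: "\<beta> (qcnj c) (st x) = \<beta> c x"
    and \<beta>_pos: "0 \<le> (\<Sum>k<n::nat. \<Sum>l<n. \<beta> (qcnj (cs k) * cs l) (xs l * st (xs k)))"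
    and \<beta>_sym: "st s = s \<Longrightarrow> \<beta> c (x * s) = \<beta> 1 s * \<beta> c x"
    and \<beta>_cyc: "\<beta> 1 (x * y) = \<beta> 1 (y * x)"
begin

lemma st_one [simp]: "st 1 = 1"
  using st_mult[of 1 "st 1"] by simp

lemma st_minus: "st (- x) = - st x"
  using st_scale[of "- 1" x] by simp

lemma st_diff: "st (x - y) = st x - st y"
  using st_add[of x "- y"] by (simp add: st_minus)

lemmas st_simps = st_add st_mult st_scale st_minus st_diff

lemma \<beta>_minus: "\<beta> c (- x) = - \<beta> c x"
  using \<beta>_scale[of c "- 1" x] by simp

lemma \<beta>_diff: "\<beta> c (x - y) = \<beta> c x - \<beta> c y"
  using \<beta>_add[of c x "- y"] by (simp add: \<beta>_minus)

lemma \<beta>_zero: "\<beta> c 0 = 0"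
  using \<beta>_scale[of c 0 0] by simp

lemma \<beta>_sum_left: "\<beta> (sum d A) x = (\<Sum>k\<in>A. \<beta> (d k) x)"
proof -
  have "\<beta> 0 x = 0" using \<beta>_scale_left[of 0 0 x] by simp
  then show ?thesis by (induction A rule: infinite_finite_induct) (simp_all add: \<beta>_add_left)
qed

lemmas \<beta>_simps = \<beta>_add \<beta>_scale \<beta>_minus \<beta>_diff

lemma \<beta>_one_st: "\<beta> 1 (st x) = \<beta> 1 x"
  using \<beta>_st[of 1 x] by simp

section \<open>The null ideal of a quaternionic state\<close>

definition null :: "'a set" where
  "null = {x. \<beta> 1 (x * st x) = 0}"

lemma norm_nonneg: "\<beta> 1 (x * st x) \<ge> 0"
  using \<beta>_pos[where n = 1 and cs = "\<lambda>_. 1" and xs = "\<lambda>_. x"] by simp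

text \<open>Cyclicity brings the argument to (\<open>st x\<close> x) (y \<open>st y\<close>), whose
  second factor is symmetric and hence acts as a scalar. This makes \<open>null\<close> a two-sided
  ideal whose quotient has no zero divisors.\<close>

lemma norm_mult: "\<beta> 1 (x * y * st (x * y)) = \<beta> 1 (x * st x) * \<beta> 1 (y * st y)"
proof -
  have "\<beta> 1 (x * y * st (x * y)) = \<beta> 1 (x * (y * st y) * st x)"
    by (simp add: st_mult mult.assoc)
  also have "\<dots> = \<beta> 1 ((st x * x) * (y * st y))"
    by (subst \<beta>_cyc) (simp add: mult.assoc)
  also have "\<dots> = \<beta> 1 (y * st y) * \<beta> 1 (st x * x)"
    by (rule \<beta>_sym) (simp add: st_mult)
  finally show ?thesis by (simp add: \<beta>_cyc[of "st x"])
qed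

lemma null_mult: "x \<in> null \<Longrightarrow> x * y \<in> null" "x \<in> null \<Longrightarrow> y * x \<in> null"
  using norm_mult[of x y] norm_mult[of y x] by (simp_all add: null_def)

lemma null_scale: "x \<in> null \<Longrightarrow> r *\<^sub>R x \<in> null"
  by (simp add: null_def st_scale \<beta>_scale)

lemma null_minus: "x \<in> null \<Longrightarrow> - x \<in> null"
  by (simp add: null_def st_minus)

text \<open>By the parallelogram law two nonnegative norms add up to 0.\<close>

lemma null_add:
  assumes "x \<in> null" "y \<in> null"
  shows "x + y \<in> null"
proof -
  have "\<beta> 1 ((x + y) * st (x + y)) + \<beta> 1 ((x - y) * st (x - y))
      = 2 * \<beta> 1 (x * st x) + 2 * \<beta> 1 (y * st y)"
    by (simp add: st_simps algebra_simps \<beta>_simps)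
  then show ?thesis
    using assms norm_nonneg[of "x + y"] norm_nonneg[of "x - y"] by (simp add: null_def)
qed

lemma null_diff: "x \<in> null \<Longrightarrow> y \<in> null \<Longrightarrow> x - y \<in> null"
  using null_add[OF _ null_minus, of x y] by simp

lemmas null_intros = null_mult null_scale null_minus null_add null_diff

text \<open>Positivity for the two pairs (t \<open>qcnj c\<close>, 1) and (1, x) is a quadratic
  polynomial in t; it is evaluated at its minimum.\<close>

lemma Cauchy_Schwarz: "(\<beta> c x)\<^sup>2 \<le> qnorm2 c * \<beta> 1 (x * st x)"
proof -
  have quad: "0 \<le> t\<^sup>2 * qnorm2 c + 2 * t * \<beta> c x + \<beta> 1 (x * st x)" for t
  proof -
    define d where "d k = (if k = 0 then t *\<^sub>R qcnj c else 1)" for k :: nat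
    define y where "y k = (if k = 0 then 1 else x)" for k :: nat
    have "0 \<le> (\<Sum>k<2. \<Sum>l<2. \<beta> (qcnj (d k) * d l) (y l * st (y k)))" by (rule \<beta>_pos)
    also have "\<dots> = \<beta> (t *\<^sub>R c * t *\<^sub>R qcnj c) 1 + \<beta> (t *\<^sub>R c) x
        + (\<beta> (t *\<^sub>R qcnj c) (st x) + \<beta> 1 (x * st x))"
      by (simp add: numeral_2_eq_2 d_def y_def)
    also have "\<dots> = t\<^sup>2 * qnorm2 c + 2 * t * \<beta> c x + \<beta> 1 (x * st x)"
      by (simp add: \<beta>_scale_left \<beta>_st \<beta>_one qcnj_mult_self power2_eq_square)
    finally show ?thesis .
  qed
  show ?thesis
  proof (cases "c = 0")
    case True
    then show ?thesis using \<beta>_scale_left[of 0 0 x] by (simp add: qnorm2_def)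
  next
    case False
    have "qnorm2 c \<ge> 0" by (simp add: qnorm2_def)
    then have p: "qnorm2 c > 0" using False qnorm2_eq_0_iff[of c] by linarith
    have "0 \<le> qnorm2 c * ((- \<beta> c x / qnorm2 c)\<^sup>2 * qnorm2 c + 2 * (- \<beta> c x / qnorm2 c) * \<beta> c x
        + \<beta> 1 (x * st x))"
      using p by (intro mult_nonneg_nonneg quad) simp
    also have "\<dots> = qnorm2 c * \<beta> 1 (x * st x) - (\<beta> c x)\<^sup>2"
      using p by (simp add: field_simps power2_eq_square)
    finally show ?thesis by simp
  qed
qed

lemma \<beta>_null: "x \<in> null \<Longrightarrow> \<beta> c x = 0"
  using Cauchy_Schwarz[of c x] by (simp add: null_def)

lemma \<beta>_cong: "x - y \<in> null \<Longrightarrow> \<beta> c x = \<beta> c y"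
  using \<beta>_null[of "x - y" c] by (simp add: \<beta>_diff)

text \<open>The variance of s vanishes, because \<open>\<beta>_sym\<close> gives s s the value of s
  squared.\<close>

lemma sym_null:
  assumes "st s = s"
  shows "s - \<beta> 1 s *\<^sub>R 1 \<in> null"
  using \<beta>_sym[OF assms, of 1 s]
  by (simp add: null_def st_simps assms algebra_simps \<beta>_simps \<beta>_one)

text \<open>The last clause ties the homomorphism to the state, so that inequalities known for
  \<beta> 1 hold for real parts of values.\<close>

definition evaluations :: "('a \<Rightarrow> quat) set" where
  "evaluations = {\<psi>. (\<forall>x y. \<psi> (x + y) = \<psi> x + \<psi> y) \<and> (\<forall>r x. \<psi> (r *\<^sub>R x) = r *\<^sub>R \<psi> x) \<and>
     (\<forall>x y. \<psi> (x * y) = \<psi> x * \<psi> y) \<and> \<psi> 1 = 1 \<and> (\<forall>x. \<psi> (st x) = qcnj (\<psi> x)) \<and>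
     (\<forall>x. qRe (\<psi> x) = \<beta> 1 x)}"

text \<open>If \<iota> maps Z onto the quotient by \<open>null\<close>, its inverse is an
  evaluation. Injectivity comes for free: \<iota> z times \<iota> (\<open>qcnj z\<close>) is the
  scalar \<open>qnorm2 z\<close> modulo \<open>null\<close>. Linearity of \<iota> is asked on all
  quaternions, products and conjugation only on Z.\<close>

lemma evaluation_from_section:
  fixes Z :: "quat set" and \<iota> :: "quat \<Rightarrow> 'a"
  assumes Z: "\<And>z w. z \<in> Z \<Longrightarrow> w \<in> Z \<Longrightarrow> z + w \<in> Z" "\<And>r z. z \<in> Z \<Longrightarrow> r *\<^sub>R z \<in> Z"
      "\<And>z w. z \<in> Z \<Longrightarrow> w \<in> Z \<Longrightarrow> z * w \<in> Z" "1 \<in> Z" "\<And>z. z \<in> Z \<Longrightarrow> qcnj z \<in> Z"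
    and \<iota>_add: "\<And>z w. \<iota> (z + w) = \<iota> z + \<iota> w" and \<iota>_scale: "\<And>r z. \<iota> (r *\<^sub>R z) = r *\<^sub>R \<iota> z"
    and \<iota>_one: "\<iota> 1 = 1"
    and \<iota>_mult: "\<And>z w. z \<in> Z \<Longrightarrow> w \<in> Z \<Longrightarrow> \<iota> z * \<iota> w - \<iota> (z * w) \<in> null"
    and \<iota>_st: "\<And>z. z \<in> Z \<Longrightarrow> st (\<iota> z) - \<iota> (qcnj z) \<in> null"
    and surj: "\<And>x. \<exists>z\<in>Z. x - \<iota> z \<in> null"
  shows "\<exists>\<psi>\<in>evaluations. \<forall>x. \<psi> x \<in> Z \<and> x - \<iota> (\<psi> x) \<in> null"
proof -
  have \<iota>_re: "\<iota> (of_real r) = r *\<^sub>R 1" for r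
    using \<iota>_scale[of r 1] by (simp add: \<iota>_one of_real_def)
  have \<iota>_minus: "\<iota> (- z) = - \<iota> z" for z using \<iota>_scale[of "- 1" z] by simp
  have \<iota>_diff: "\<iota> (z - w) = \<iota> z - \<iota> w" for z w using \<iota>_add[of z "- w"] by (simp add: \<iota>_minus)
  have inj: "z = 0" if z: "z \<in> Z" "\<iota> z \<in> null" for z
  proof -
    have "\<iota> z * \<iota> (qcnj z) - \<iota> (z * qcnj z) \<in> null" using z Z(5) by (intro \<iota>_mult)
    then have "\<iota> z * \<iota> (qcnj z) - qnorm2 z *\<^sub>R 1 \<in> null" by (simp add: qcnj_mult_self \<iota>_re)
    moreover have "\<iota> z * \<iota> (qcnj z) \<in> null" using z(2) by (rule null_mult)
    ultimately have "\<iota> z * \<iota> (qcnj z) - (\<iota> z * \<iota> (qcnj z) - qnorm2 z *\<^sub>R 1) \<in> null"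
      using null_diff by blast
    then have "qnorm2 z *\<^sub>R 1 \<in> null" by (simp only: diff_diff_eq2 add_diff_cancel_left')
    then have "qnorm2 z = 0" by (simp add: null_def st_scale \<beta>_scale \<beta>_one)
    then show ?thesis by (simp add: qnorm2_eq_0_iff)
  qed
  define \<psi> where "\<psi> x = (SOME z. z \<in> Z \<and> x - \<iota> z \<in> null)" for x
  have \<psi>: "\<psi> x \<in> Z" "x - \<iota> (\<psi> x) \<in> null" for x
    using someI_ex[of "\<lambda>z. z \<in> Z \<and> x - \<iota> z \<in> null"] surj[of x] unfolding \<psi>_def by blast+
  have uniq: "\<psi> x = z" if "z \<in> Z" "x - \<iota> z \<in> null" for x z
  proof -
    have "(x - \<iota> z) - (x - \<iota> (\<psi> x)) \<in> null" by (rule null_diff[OF that(2) \<psi>(2)])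
    then have "\<iota> (\<psi> x + (- 1) *\<^sub>R z) \<in> null" by (simp add: \<iota>_diff)
    moreover have "\<psi> x + (- 1) *\<^sub>R z \<in> Z" using that \<psi> by (intro Z)
    ultimately show ?thesis using inj by fastforce
  qed
  have "\<psi> \<in> evaluations"
    unfolding evaluations_def
  proof (intro CollectI conjI allI)
    show "\<psi> (x + y) = \<psi> x + \<psi> y" for x y
    proof (rule uniq)
      have "(x - \<iota> (\<psi> x)) + (y - \<iota> (\<psi> y)) \<in> null" by (intro null_add \<psi>)
      then show "x + y - \<iota> (\<psi> x + \<psi> y) \<in> null" by (simp add: \<iota>_add algebra_simps)
    qed (intro Z \<psi>)
    show "\<psi> (r *\<^sub>R x) = r *\<^sub>R \<psi> x" for r x
    proof (rule uniq)
      have "r *\<^sub>R (x - \<iota> (\<psi> x)) \<in> null" by (intro null_scale \<psi>)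
      then show "r *\<^sub>R x - \<iota> (r *\<^sub>R \<psi> x) \<in> null" by (simp add: \<iota>_scale algebra_simps)
    qed (intro Z \<psi>)
    show "\<psi> (x * y) = \<psi> x * \<psi> y" for x y
    proof (rule uniq)
      have "(x - \<iota> (\<psi> x)) * y + \<iota> (\<psi> x) * (y - \<iota> (\<psi> y))
          + (\<iota> (\<psi> x) * \<iota> (\<psi> y) - \<iota> (\<psi> x * \<psi> y)) \<in> null"
        by (intro null_add null_mult(1)[OF \<psi>(2)] null_mult(2)[OF \<psi>(2)] \<iota>_mult \<psi>(1))
      then show "x * y - \<iota> (\<psi> x * \<psi> y) \<in> null" by (simp add: algebra_simps)
    qed (intro Z \<psi>)
    show "\<psi> 1 = 1"
      using Z(4) by (rule uniq) (simp add: \<iota>_one null_def \<beta>_zero)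
    show cnj: "\<psi> (st x) = qcnj (\<psi> x)" for x
    proof (rule uniq)
      have "st (x - \<iota> (\<psi> x)) \<in> null"
        using \<psi>(2)[of x] by (simp add: null_def \<beta>_cyc[of "st (x - \<iota> (\<psi> x))"])
      then have "st (x - \<iota> (\<psi> x)) + (st (\<iota> (\<psi> x)) - \<iota> (qcnj (\<psi> x))) \<in> null"
        by (intro null_add \<iota>_st \<psi>)
      then show "st x - \<iota> (qcnj (\<psi> x)) \<in> null" by (simp add: st_diff)
    qed (intro Z \<psi>)
    show "qRe (\<psi> x) = \<beta> 1 x" for x
    proof -
      let ?z = "\<psi> x"
      have "?z + qcnj ?z = of_real (2 * qRe ?z)" by (simp add: quat_eq_iff del: of_real_mult)
      then have "\<iota> ?z + \<iota> (qcnj ?z) = (2 * qRe ?z) *\<^sub>R 1" by (metis \<iota>_add \<iota>_re)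
      then have "\<beta> 1 (\<iota> ?z) + \<beta> 1 (\<iota> (qcnj ?z)) = 2 * qRe ?z"
        by (metis \<beta>_add \<beta>_scale \<beta>_one one_quat.sel(1) mult_1_right)
      moreover have "\<beta> 1 (\<iota> (qcnj ?z)) = \<beta> 1 (\<iota> ?z)"
        using \<beta>_cong[OF \<iota>_st[OF \<psi>(1)], of 1 x] by (simp add: \<beta>_one_st)
      ultimately show ?thesis using \<beta>_cong[OF \<psi>(2), of 1 x] by simp
    qed
  qed
  then show ?thesis using \<psi> by blast
qed

end

text \<open>For imaginary s, Re (d s) is minus the inner product of s with the imaginary part of d,
  so the normalized imaginary part of d is the minimizer.\<close>

lemma minimizing_imaginary_unit:
  "\<exists>s. qRe s = 0 \<and> qnorm2 s = 1 \<and> qRe (d * s) = - sqrt (qnorm2 (d - of_real (qRe d)))"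
proof -
  define \<nu> where "\<nu> = sqrt (qnorm2 (d - of_real (qRe d)))"
  have \<nu>2: "(qI d)\<^sup>2 + (qJ d)\<^sup>2 + (qK d)\<^sup>2 = \<nu>\<^sup>2" "\<nu> \<ge> 0"
    by (simp_all add: \<nu>_def qnorm2_def)
  show ?thesis
  proof (cases "\<nu> = 0")
    case True
    have "qnorm2 (d - of_real (qRe d)) = 0" using True by (simp add: \<nu>_def)
    then have "d - of_real (qRe d) = 0" by (simp only: qnorm2_eq_0_iff)
    then have "qI d = 0" by (simp add: quat_eq_iff)
    then show ?thesis using True unfolding \<nu>_def[symmetric]
      by (intro exI[of _ "Quat 0 1 0 0"]) (simp add: qnorm2_def)
  next
    case False
    have "(qI d / \<nu>)\<^sup>2 + (qJ d / \<nu>)\<^sup>2 + (qK d / \<nu>)\<^sup>2 = 1"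
      using False \<nu>2(1) by (simp add: power_divide flip: add_divide_distrib)
    moreover have "qI d * (qI d / \<nu>) + qJ d * (qJ d / \<nu>) + qK d * (qK d / \<nu>) = \<nu>"
      using False \<nu>2(1) by (simp add: power2_eq_square flip: add_divide_distrib)
    ultimately show ?thesis unfolding \<nu>_def[symmetric]
      by (intro exI[of _ "Quat 0 (qI d / \<nu>) (qJ d / \<nu>) (qK d / \<nu>)"]) (simp add: qnorm2_def)
  qed
qed

section \<open>Real, complex and quaternionic quotients\<close>

context quat_state
begin

lemma skew_\<beta>: "st y = - y \<Longrightarrow> \<beta> 1 y = 0"
  using \<beta>_one_st[of y] by (simp add: \<beta>_minus)

text \<open>The symmetric part of x is a scalar modulo \<open>null\<close>; only the skew part can
  carry more information.\<close>

lemma null_skew_part: "x - (\<beta> 1 x *\<^sub>R 1 + (1 / 2) *\<^sub>R (x - st x)) \<in> null"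
proof -
  have "(1 / 2) *\<^sub>R (x + st x) - \<beta> 1 ((1 / 2) *\<^sub>R (x + st x)) *\<^sub>R 1 \<in> null"
    by (rule sym_null) (simp add: st_simps add.commute)
  moreover have "\<beta> 1 ((1 / 2) *\<^sub>R (x + st x)) = \<beta> 1 x" by (simp add: \<beta>_simps \<beta>_one_st)
  moreover have "x - (\<beta> 1 x *\<^sub>R 1 + (1 / 2) *\<^sub>R (x - st x)) = (1 / 2) *\<^sub>R (x + st x) - \<beta> 1 x *\<^sub>R 1"
    by (simp add: algebra_simps flip: scaleR_add_left)
  ultimately show ?thesis by (simp only:)
qed

lemma skew_square: "st u = - u \<Longrightarrow> u * u + \<beta> 1 (u * st u) *\<^sub>R 1 \<in> null"
  using sym_null[of "u * u"] by (simp add: st_mult \<beta>_minus)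

text \<open>The quotient is the real line, every x is congruent to its scalar value, and the
  inequality holds with equality.\<close>

lemma evaluation_below_real:
  assumes "\<And>y. st y = - y \<Longrightarrow> y \<in> null"
  shows "\<exists>\<psi>\<in>evaluations. (\<Sum>k<n. qRe (c k * \<psi> (x k))) \<le> (\<Sum>k<n::nat. \<beta> (c k) (x k))"
proof -
  have "\<exists>\<psi>\<in>evaluations. \<forall>x. \<psi> x \<in> range of_real \<and> x - qRe (\<psi> x) *\<^sub>R 1 \<in> null"
  proof (rule evaluation_from_section[where \<iota> = "\<lambda>z. qRe z *\<^sub>R 1"])
    fix z w :: quat and r :: real
    assume z: "z \<in> range of_real"
    then show "r *\<^sub>R z \<in> range of_real" "qcnj z \<in> range of_real"
      by (auto simp: quat_eq_iff image_iff)
    show "st (qRe z *\<^sub>R 1) - qRe (qcnj z) *\<^sub>R 1 \<in> null"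
      by (simp add: st_simps null_def \<beta>_zero)
    assume w: "w \<in> range of_real"
    show "z + w \<in> range of_real" "z * w \<in> range of_real"
      using z w by (auto simp: quat_eq_iff image_iff)
    show "qRe z *\<^sub>R 1 * qRe w *\<^sub>R 1 - qRe (z * w) *\<^sub>R 1 \<in> null"
      using z w by (auto simp: null_def \<beta>_zero mult.commute)
  next
    fix x
    have "(x - (\<beta> 1 x *\<^sub>R 1 + (1 / 2) *\<^sub>R (x - st x))) + (1 / 2) *\<^sub>R (x - st x) \<in> null"
      by (intro null_add null_skew_part null_scale assms) (simp add: st_simps)
    then show "\<exists>z\<in>range of_real. x - qRe z *\<^sub>R 1 \<in> null" by (auto simp: algebra_simps)
  qed (auto simp: algebra_simps image_iff intro: exI[of _ 1])
  then obtain \<psi> where \<psi>: "\<psi> \<in> evaluations" "\<And>x. \<psi> x \<in> range of_real"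
    "\<And>x. x - qRe (\<psi> x) *\<^sub>R 1 \<in> null" by blast
  have "qRe (d * \<psi> y) = \<beta> d y" for d y
    using \<psi>(2)[of y] \<beta>_cong[OF \<psi>(3), of d y] by (auto simp: \<beta>_scale \<beta>_one)
  then show ?thesis using \<psi>(1) by (intro bexI[of _ \<psi>]) auto
qed

text \<open>The quotient is spanned by 1 and u, and u may be sent to any imaginary unit s. State and
  evaluation differ only in \<beta> d u against Re (d s), where d collects the constants; s is
  chosen so that Re (d s) equals the lower Cauchy-Schwarz bound for \<beta> d u.\<close>

lemma evaluation_below_complex:
  assumes u: "st u = - u" "\<beta> 1 (u * st u) = 1"
    and skew: "\<And>y. st y = - y \<Longrightarrow> y + \<beta> 1 (y * u) *\<^sub>R u \<in> null"
  shows "\<exists>\<psi>\<in>evaluations. (\<Sum>k<n. qRe (c k * \<psi> (x k))) \<le> (\<Sum>k<n::nat. \<beta> (c k) (x k))"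
proof -
  \<comment> \<open>As u is skew, this is \<beta> 1 (y \<open>st u\<close>), the coordinate of y
    along the unit vector u.\<close>
  define t where "t y = - \<beta> 1 (y * u)" for y
  define d where "d = (\<Sum>k<n. t (x k) *\<^sub>R c k)"
  obtain s where s: "qRe s = 0" "qnorm2 s = 1" "qRe (d * s) = - sqrt (qnorm2 (d - of_real (qRe d)))"
    using minimizing_imaginary_unit by blast
  \<comment> \<open>On Z this reads off the coefficient of s; being defined everywhere, it makes the
    section linear on all quaternions.\<close>
  define dot where "dot z = qI z * qI s + qJ z * qJ s + qK z * qK s" for z
  have s2: "s * s = - 1" using s(1,2)
    by (simp add: quat_eq_iff qnorm2_def power2_eq_square algebra_simps)
  define Z where "Z = {of_real a + b *\<^sub>R s | a b. True}"
  have ZI: "of_real a + b *\<^sub>R s \<in> Z" for a b by (auto simp: Z_def)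
  have dotZ: "dot (of_real a + b *\<^sub>R s) = b" "qRe (of_real a + b *\<^sub>R s) = a" for a b
  proof -
    have "dot (of_real a + b *\<^sub>R s) = b * qnorm2 s"
      by (simp add: dot_def qnorm2_def s(1) power2_eq_square algebra_simps)
    then show "dot (of_real a + b *\<^sub>R s) = b" using s(2) by simp
  qed (simp add: s(1))
  have Z_mult: "(of_real a + b *\<^sub>R s) * (of_real a' + b' *\<^sub>R s)
      = of_real (a * a' - b * b') + (a * b' + b * a') *\<^sub>R s" for a b a' b'
    using s2 by (simp add: algebra_simps of_real_def)
  have Z_cnj: "qcnj (of_real a + b *\<^sub>R s) = of_real a + (- b) *\<^sub>R s" for a b
    using s(1) by (simp add: quat_eq_iff)
  have u2: "u * u + 1 \<in> null" using skew_square[OF u(1)] u(2) by simp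
  have uu: "\<beta> 1 (u * u) = - 1" using u by (simp add: \<beta>_minus)
  have "\<exists>\<psi>\<in>evaluations. \<forall>x. \<psi> x \<in> Z \<and> x - (qRe (\<psi> x) *\<^sub>R 1 + dot (\<psi> x) *\<^sub>R u) \<in> null"
  proof (rule evaluation_from_section[where \<iota> = "\<lambda>z. qRe z *\<^sub>R 1 + dot z *\<^sub>R u"])
    fix z w :: quat and r :: real
    assume "z \<in> Z"
    then obtain a b where z: "z = of_real a + b *\<^sub>R s" by (auto simp: Z_def)
    have "r *\<^sub>R z = of_real (r * a) + (r * b) *\<^sub>R s" by (simp add: z of_real_def scaleR_add_right)
    then show "r *\<^sub>R z \<in> Z" using ZI by metis
    show "qcnj z \<in> Z" unfolding z Z_cnj by (rule ZI)
    show "st (qRe z *\<^sub>R 1 + dot z *\<^sub>R u) - (qRe (qcnj z) *\<^sub>R 1 + dot (qcnj z) *\<^sub>R u) \<in> null"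
      unfolding z Z_cnj dotZ by (simp add: st_simps u(1) null_def \<beta>_zero)
    assume "w \<in> Z"
    then obtain a' b' where w: "w = of_real a' + b' *\<^sub>R s" by (auto simp: Z_def)
    have "z + w = of_real (a + a') + (b + b') *\<^sub>R s" by (simp add: z w algebra_simps)
    then show "z + w \<in> Z" using ZI by metis
    show "z * w \<in> Z" unfolding z w Z_mult by (rule ZI)
    have "(b * b') *\<^sub>R (u * u + 1) \<in> null" by (intro null_scale u2)
    then show "(qRe z *\<^sub>R 1 + dot z *\<^sub>R u) * (qRe w *\<^sub>R 1 + dot w *\<^sub>R u)
        - (qRe (z * w) *\<^sub>R 1 + dot (z * w) *\<^sub>R u) \<in> null"
      unfolding z w Z_mult dotZ by (simp add: algebra_simps)
  next
    show "1 \<in> Z" using ZI[of 1 0] by simp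
    show "qRe 1 *\<^sub>R 1 + dot 1 *\<^sub>R u = 1" by (simp add: dot_def)
  next
    fix y
    let ?y = "(1 / 2) *\<^sub>R (y - st y)"
    define b where "b = - \<beta> 1 (?y * u)"
    have "(y - (\<beta> 1 y *\<^sub>R 1 + ?y)) + (?y + \<beta> 1 (?y * u) *\<^sub>R u) \<in> null"
      by (intro null_add[OF null_skew_part skew]) (simp add: st_simps scaleR_diff_right)
    also have "(y - (\<beta> 1 y *\<^sub>R 1 + ?y)) + (?y + \<beta> 1 (?y * u) *\<^sub>R u) = y - (\<beta> 1 y *\<^sub>R 1 + b *\<^sub>R u)"
      by (simp add: b_def)
    finally show "\<exists>z\<in>Z. y - (qRe z *\<^sub>R 1 + dot z *\<^sub>R u) \<in> null"
      by (intro bexI[of _ "of_real (\<beta> 1 y) + b *\<^sub>R s"] ZI) (simp only: dotZ)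
  qed (simp_all add: dot_def algebra_simps)
  then obtain \<psi> where \<psi>: "\<psi> \<in> evaluations" "\<And>x. \<psi> x \<in> Z"
    "\<And>x. x - (qRe (\<psi> x) *\<^sub>R 1 + dot (\<psi> x) *\<^sub>R u) \<in> null" by blast
  have dot\<psi>: "dot (\<psi> y) = t y" for y
  proof -
    have "y * u - (qRe (\<psi> y) *\<^sub>R 1 + dot (\<psi> y) *\<^sub>R u) * u \<in> null"
      using null_mult(1)[OF \<psi>(3)[of y], of u] by (simp add: algebra_simps)
    then show ?thesis
      using \<beta>_cong[of _ _ 1] skew_\<beta>[OF u(1)] uu by (fastforce simp: t_def \<beta>_simps distrib_right)
  qed
  have eq: "\<psi> y = of_real (qRe (\<psi> y)) + t y *\<^sub>R s" for y
  proof -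
    obtain a b where "\<psi> y = of_real a + b *\<^sub>R s" using \<psi>(2)[of y] by (auto simp: Z_def)
    then show ?thesis using dotZ[of a b] dot\<psi>[of y] by simp
  qed
  have val: "qRe (e * \<psi> y) = qRe (\<psi> y) * qRe e + qRe ((t y *\<^sub>R e) * s)" for e y
    by (subst eq) (simp add: algebra_simps)
  have \<beta>val: "\<beta> e y = qRe (\<psi> y) * qRe e + \<beta> (t y *\<^sub>R e) u" for e y
    using \<beta>_cong[OF \<psi>(3), of e y] by (simp add: \<beta>_simps \<beta>_one \<beta>_scale_left dot\<psi>)
  have "(\<Sum>k<n. qRe (c k * \<psi> (x k))) = (\<Sum>k<n. qRe (\<psi> (x k)) * qRe (c k)) + qRe (d * s)"
  proof -
    have "qRe (sum h A) = (\<Sum>k\<in>A. qRe (h k))" for h and A :: "nat set"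
      by (induction A rule: infinite_finite_induct) auto
    then show ?thesis unfolding val sum.distrib d_def sum_distrib_right by simp
  qed
  moreover have "(\<Sum>k<n. \<beta> (c k) (x k)) = (\<Sum>k<n. qRe (\<psi> (x k)) * qRe (c k)) + \<beta> d u"
    unfolding d_def \<beta>_sum_left sum.distrib[symmetric] by (intro sum.cong refl \<beta>val)
  moreover have "qRe (d * s) \<le> \<beta> d u"
  proof -
    let ?e = "d - of_real (qRe d)"
    \<comment> \<open>Real constants see nothing of the skew u, so Cauchy-Schwarz can be applied to
      the imaginary part of d alone.\<close>
    have "\<beta> (of_real (qRe d)) u = 0"
      using \<beta>_scale_left[of "qRe d" 1 u] skew_\<beta>[OF u(1)] by (simp add: of_real_def)
    then have "\<beta> d u = \<beta> ?e u" using \<beta>_add_left[of ?e "of_real (qRe d)" u] by simp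
    moreover have "(\<beta> ?e u)\<^sup>2 \<le> qnorm2 ?e" using Cauchy_Schwarz[of ?e u] u(2) by simp
    then have "\<bar>\<beta> ?e u\<bar> \<le> sqrt (qnorm2 ?e)" using real_sqrt_le_mono by fastforce
    ultimately show ?thesis using s(3) by simp
  qed
  ultimately show ?thesis using \<psi>(1) by (intro bexI[of _ \<psi>]) auto
qed

lemma evaluation_conj:
  assumes \<psi>: "\<psi> \<in> evaluations" and v: "v \<noteq> 0"
  shows "(\<lambda>x. (1 / qnorm2 v) *\<^sub>R (v * \<psi> x * qcnj v)) \<in> evaluations"
proof -
  have nz: "qnorm2 v \<noteq> 0" using v by (simp add: qnorm2_eq_0_iff)
  have "qRe (v * z * qcnj v) = qnorm2 v * qRe z" for z
    by (simp add: qnorm2_def power2_eq_square algebra_simps)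
  moreover have "v * z * qcnj v * (v * w * qcnj v) = qnorm2 v *\<^sub>R (v * (z * w) * qcnj v)" for z w
  proof -
    have "v * z * qcnj v * (v * w * qcnj v) = v * z * (qcnj v * v) * (w * qcnj v)"
      by (simp only: mult.assoc)
    then show ?thesis by (simp add: qcnj_mult_self of_real_def mult.assoc)
  qed
  ultimately show ?thesis
    using \<psi> nz unfolding evaluations_def
    by (auto simp: algebra_simps qcnj_mult_self of_real_def simp del: times_quat.sel)
qed

text \<open>Orthonormal skew u and v generate the quaternions modulo \<open>null\<close>, and as in
  Frobenius' theorem nothing else is left. The state becomes a sum of vector states, hence a convex
  combination of evaluations conjugated by the vectors, one of which is at most the average.\<close>

lemma evaluation_below_quaternion:
  assumes u: "st u = - u" "\<beta> 1 (u * st u) = 1" and v: "st v = - v" "\<beta> 1 (v * st v) = 1"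
    and uv: "\<beta> 1 (u * v) = 0"
  shows "\<exists>\<psi>\<in>evaluations. (\<Sum>k<n. qRe (c k * \<psi> (x k))) \<le> (\<Sum>k<n::nat. \<beta> (c k) (x k))"
proof -
  define U W A where "U = u * u + 1" and "W = v * v + 1" and "A = u * v + v * u"
  have U: "U \<in> null" using skew_square[OF u(1)] u(2) by (simp add: U_def)
  have W: "W \<in> null" using skew_square[OF v(1)] v(2) by (simp add: W_def)
  \<comment> \<open>The anticommutator is symmetric and its value is twice \<beta> 1 (u v), that is
    0.\<close>
  have A: "A \<in> null"
    using sym_null[of A] uv \<beta>_cyc[of v u] u v by (simp add: A_def st_simps \<beta>_simps add.commute)
  define \<iota> where "\<iota> z = qRe z *\<^sub>R 1 + qI z *\<^sub>R u + qJ z *\<^sub>R v + qK z *\<^sub>R (u * v)" for z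
  have \<iota>_mult: "\<iota> z * \<iota> w - \<iota> (z * w) \<in> null" for z w
  proof -
    \<comment> \<open>Each summand is one entry of the multiplication table of 1, u, v, u v, its
      deviation from the quaternion product being expressed through U, W and A.\<close>
    have "(qI z * qI w) *\<^sub>R U + (qJ z * qJ w) *\<^sub>R W
        + (qK z * qK w) *\<^sub>R (u * A * v - U * (W - 1) + W) + (qI z * qK w) *\<^sub>R (U * v)
        + (qK z * qI w) *\<^sub>R (u * A - U * v) + (qJ z * qI w) *\<^sub>R A
        + (qJ z * qK w) *\<^sub>R (A * v - u * W) + (qK z * qJ w) *\<^sub>R (u * W) \<in> null"
      by (blast intro: null_intros U W A)
    also have "(qI z * qI w) *\<^sub>R U + (qJ z * qJ w) *\<^sub>R W
        + (qK z * qK w) *\<^sub>R (u * A * v - U * (W - 1) + W) + (qI z * qK w) *\<^sub>R (U * v)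
        + (qK z * qI w) *\<^sub>R (u * A - U * v) + (qJ z * qI w) *\<^sub>R A
        + (qJ z * qK w) *\<^sub>R (A * v - u * W) + (qK z * qJ w) *\<^sub>R (u * W) = \<iota> z * \<iota> w - \<iota> (z * w)"
      unfolding \<iota>_def U_def W_def A_def by (simp add: algebra_simps)
    finally show ?thesis .
  qed
  have \<iota>_st: "st (\<iota> z) - \<iota> (qcnj z) \<in> null" for z
    using null_scale[OF A, of "qK z"] by (simp add: \<iota>_def A_def st_simps u v algebra_simps)
  \<comment> \<open>The product u v is skew only modulo \<open>null\<close>; w is an exactly skew
    element of the same class.\<close>
  define w where "w = (1 / 2) *\<^sub>R (u * v - v * u)"
  have w_skew: "st w = - w" by (simp add: w_def st_simps u v flip: scaleR_minus_right)
  have w_uv: "w - u * v \<in> null"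
  proof -
    have "(- 1 / 2) *\<^sub>R A \<in> null" by (intro null_scale A)
    also have "(- 1 / 2) *\<^sub>R A = w - u * v"
      by (simp add: A_def w_def algebra_simps flip: scaleR_add_left)
    finally show ?thesis .
  qed
  have uu: "\<beta> 1 (u * u) = - 1" and vv: "\<beta> 1 (v * v) = - 1"
    using u v by (simp_all add: \<beta>_minus)
  have wu: "\<beta> 1 (w * u) = 0" "\<beta> 1 (w * v) = 0"
    using \<beta>_cyc[of "u * v" u] \<beta>_cyc[of "v * u" v] \<beta>_cyc[of u "v * v"]
      \<beta>_cyc[of v "u * u"]
    by (simp_all add: w_def \<beta>_simps algebra_simps)
  have ww: "\<beta> 1 (w * w) = - 1"
  proof -
    have "(w - u * v) * w + u * v * (w - u * v) \<in> null" by (blast intro: null_intros w_uv)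
    then have "w * w - u * v * (u * v) \<in> null" by (simp add: algebra_simps)
    then have "\<beta> 1 (w * w) = \<beta> 1 (u * v * (u * v))" by (rule \<beta>_cong)
    also have "u * v * (u * v) = u * A * v - (u * u) * (v * v)" by (simp add: A_def algebra_simps)
    also have "\<beta> 1 \<dots> = - \<beta> 1 ((u * u) * (v * v))"
      using \<beta>_null[OF null_mult(1)[OF null_mult(2)[OF A]]] by (simp add: \<beta>_simps)
    also have "\<beta> 1 ((u * u) * (v * v)) = 1"
      using \<beta>_sym[of "v * v" 1 "u * u"] uu vv by (simp add: st_mult v)
    finally show ?thesis .
  qed
  have ortho: "y \<in> null"
    if y: "st y = - y" "\<beta> 1 (y * u) = 0" "\<beta> 1 (y * v) = 0" "\<beta> 1 (y * w) = 0" for y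
  proof -
    have anti: "y * e + e * y \<in> null" if "st e = - e" "\<beta> 1 (y * e) = 0" for e
      using sym_null[of "y * e + e * y"] that y(1) \<beta>_cyc[of e y]
      by (simp add: st_simps \<beta>_simps add.commute)
    \<comment> \<open>A skew y orthogonal to u, v and w anticommutes with all three. Passing u and v
      in turn, it also commutes with u v, hence with w. So 2 y w is null, and since w has norm 1, y
      is null.\<close>
    have "(y * w + w * y) + (y * (w - u * v) - (w - u * v) * y)
        + ((y * u + u * y) * v - u * (y * v + v * y)) \<in> null"
      by (intro null_add null_diff null_mult(1)[OF anti] null_mult(2)[OF anti] anti null_mult(1)[OF w_uv]
          null_mult(2)[OF w_uv] w_skew u v y)
    also have "(y * w + w * y) + (y * (w - u * v) - (w - u * v) * y)
        + ((y * u + u * y) * v - u * (y * v + v * y)) = 2 *\<^sub>R (y * w)"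
      by (simp add: algebra_simps scaleR_2)
    finally have "(1 / 2) *\<^sub>R (2 *\<^sub>R (y * w)) \<in> null" by (rule null_scale)
    then show ?thesis
      using norm_mult[of y w] ww by (simp add: null_def w_skew \<beta>_minus)
  qed
  have "\<exists>\<psi>\<in>evaluations. \<forall>x. \<psi> x \<in> UNIV \<and> x - \<iota> (\<psi> x) \<in> null"
  proof (rule evaluation_from_section)
    fix x
    define y where "y = (1 / 2) *\<^sub>R (x - st x)"
    have ys: "st y = - y" by (simp add: y_def st_simps flip: scaleR_minus_right)
    \<comment> \<open>The orthogonal projections are subtracted; the plus signs come from \<beta> 1
      (u u) = - 1 and its analogues.\<close>
    define y' where "y' = y + \<beta> 1 (y * u) *\<^sub>R u + \<beta> 1 (y * v) *\<^sub>R v + \<beta> 1 (y * w) *\<^sub>R w"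
    have "y' \<in> null"
    proof (rule ortho)
      show "st y' = - y'" by (simp add: y'_def st_simps ys u v w_skew)
      show "\<beta> 1 (y' * u) = 0" "\<beta> 1 (y' * v) = 0" "\<beta> 1 (y' * w) = 0"
        using uu vv ww wu uv \<beta>_cyc[of v u] \<beta>_cyc[of u w] \<beta>_cyc[of v w]
        by (simp_all add: y'_def distrib_right \<beta>_simps)
    qed
    then have "(x - (\<beta> 1 x *\<^sub>R 1 + y)) + y' - \<beta> 1 (y * w) *\<^sub>R (w - u * v) \<in> null"
      unfolding y_def by (intro null_diff null_add null_scale null_skew_part w_uv)
    also have "(x - (\<beta> 1 x *\<^sub>R 1 + y)) + y' - \<beta> 1 (y * w) *\<^sub>R (w - u * v)
      = x - \<iota> (Quat (\<beta> 1 x) (- \<beta> 1 (y * u)) (- \<beta> 1 (y * v)) (- \<beta> 1 (y * w)))"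
      by (simp add: \<iota>_def y'_def algebra_simps)
    finally show "\<exists>z\<in>UNIV. x - \<iota> z \<in> null" by blast
  qed (auto simp: \<iota>_mult \<iota>_st, simp_all add: \<iota>_def algebra_simps)
  then obtain \<psi> where \<psi>: "\<psi> \<in> evaluations" "\<And>x. x - \<iota> (\<psi> x) \<in> null" by blast
  define F where "F d z = \<beta> d (\<iota> z)" for d z
  have "\<exists>r :: nat \<Rightarrow> quat. \<forall>d z. F d z = (\<Sum>j<4. qRe (qcnj (r j) * d * r j * z))"
  proof (rule quat_state_decomposition)
    show "F (qcnj d) (qcnj z) = F d z" for d z
      using \<beta>_cong[OF \<iota>_st, of "qcnj d" z] by (simp add: F_def \<beta>_st)
    show "0 \<le> (\<Sum>k<4::nat. \<Sum>l<4::nat. F (qcnj (d k) * d l) (z l * qcnj (z k)))" for d z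
    proof -
      have "F e (z l * qcnj (z k)) = \<beta> e (\<iota> (z l) * st (\<iota> (z k)))" for e k l
      proof -
        have "\<iota> (z l) * (st (\<iota> (z k)) - \<iota> (qcnj (z k)))
            + (\<iota> (z l) * \<iota> (qcnj (z k)) - \<iota> (z l * qcnj (z k))) \<in> null"
          by (intro null_add null_mult(2)[OF \<iota>_st] \<iota>_mult)
        then have "\<iota> (z l) * st (\<iota> (z k)) - \<iota> (z l * qcnj (z k)) \<in> null"
          by (simp add: algebra_simps)
        then show ?thesis unfolding F_def by (metis \<beta>_cong)
      qed
      then show ?thesis using \<beta>_pos by simp
    qed
  qed (simp_all add: F_def \<iota>_def algebra_simps \<beta>_simps \<beta>_add_left \<beta>_scale_left)
  then obtain r where r: "\<And>d z. F d z = (\<Sum>j<4::nat. qRe (qcnj (r j) * d * r j * z))" by blast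
  define B where "B = (\<Sum>k<n. \<beta> (c k) (x k))"
  \<comment> \<open>The value at \<psi> conjugated by \<open>r j\<close>. For \<open>r j = 0\<close>
    division by zero gives 0, and the weight \<open>qnorm2 (r j)\<close> vanishes as well.\<close>
  define E where "E j = (\<Sum>k<n. qRe (c k * ((1 / qnorm2 (r j)) *\<^sub>R (r j * \<psi> (x k) * qcnj (r j)))))" for j
  have qRe_sum: "qRe (sum h S) = (\<Sum>k\<in>S. qRe (h k))" for h and S :: "nat set"
    by (induction S rule: infinite_finite_induct) auto
  have E: "(\<Sum>k<n. qRe (qcnj (r j) * c k * r j * \<psi> (x k))) = qnorm2 (r j) * E j" for j
  proof (cases "r j = 0")
    case False
    have cyc: "qRe (a * b) = qRe (b * a)" for a b by simp
    have "qRe (qcnj (r j) * c k * r j * \<psi> (x k))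
        = qnorm2 (r j) * qRe (c k * ((1 / qnorm2 (r j)) *\<^sub>R (r j * \<psi> (x k) * qcnj (r j))))" for k
      using False qnorm2_eq_0_iff[of "r j"] cyc[of "qcnj (r j)" "c k * r j * \<psi> (x k)"]
      by (simp del: times_quat.sel add: mult.assoc)
    then show ?thesis by (simp add: E_def sum_distrib_left del: times_quat.sel)
  qed (simp add: qnorm2_def)
  have B: "B = (\<Sum>j<4. qnorm2 (r j) * E j)"
  proof -
    have "\<beta> (c k) (x k) = F (c k) (\<psi> (x k))" for k
      unfolding F_def by (rule \<beta>_cong[OF \<psi>(2)])
    then have "B = (\<Sum>k<n. \<Sum>j<4. qRe (qcnj (r j) * c k * r j * \<psi> (x k)))"
      by (simp add: B_def r del: times_quat.sel)
    also have "\<dots> = (\<Sum>j<4. qnorm2 (r j) * E j)"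
      unfolding E[symmetric] by (rule sum.swap)
    finally show ?thesis .
  qed
  \<comment> \<open>The decomposition at (1, 1) normalizes the weights, so B is a convex combination
    of the E j.\<close>
  have one: "(\<Sum>j<4. qnorm2 (r j)) = 1"
    using r[of 1 1] by (simp add: qcnj_mult_self F_def \<iota>_def \<beta>_one del: times_quat.sel)
  have "\<exists>j<4. r j \<noteq> 0 \<and> E j \<le> B"
  proof (rule ccontr)
    assume "\<not> ?thesis"
    then have gt: "B < E j" if "r j \<noteq> 0" "j < 4" for j using that by force
    have nn: "qnorm2 z \<ge> 0" for z by (simp add: qnorm2_def)
    have "\<exists>j<4. qnorm2 (r j) \<noteq> 0"
      using one by (metis (no_types, lifting) lessThan_iff sum.neutral zero_neq_one)
    then obtain i where i: "i < 4" "qnorm2 (r i) > 0" using nn by (metis order_le_less)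
    have "(\<Sum>j<4. qnorm2 (r j) * B) < (\<Sum>j<4. qnorm2 (r j) * E j)"
    proof (rule sum_strict_mono_ex1)
      show "\<forall>j\<in>{..<4}. qnorm2 (r j) * B \<le> qnorm2 (r j) * E j"
      proof
        fix j :: nat assume "j \<in> {..<4}"
        then show "qnorm2 (r j) * B \<le> qnorm2 (r j) * E j"
          using gt[of j] nn[of "r j"] by (cases "r j = 0") (auto simp: qnorm2_def intro: mult_left_mono)
      qed
      have "r i \<noteq> 0" using i(2) by (auto simp: qnorm2_def)
      then show "\<exists>j\<in>{..<4}. qnorm2 (r j) * B < qnorm2 (r j) * E j"
        using gt[of i] i by (intro bexI[of _ i]) auto
    qed simp
    then show False using B one by (simp flip: sum_distrib_right)
  qed
  then obtain j where "r j \<noteq> 0" "E j \<le> B" by blast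
  then show ?thesis
    using evaluation_conj[OF \<psi>(1)] unfolding E_def B_def by fast
qed

lemma evaluation_below:
  "\<exists>\<psi>\<in>evaluations. (\<Sum>k<n. qRe (c k * \<psi> (x k))) \<le> (\<Sum>k<n::nat. \<beta> (c k) (x k))"
proof -
  have normalize: "\<exists>u. st u = - u \<and> \<beta> 1 (u * st u) = 1 \<and> (\<exists>r. u = r *\<^sub>R y)"
    if y: "st y = - y" "y \<notin> null" for y
  proof -
    have p: "\<beta> 1 (y * st y) > 0" using y(2) norm_nonneg[of y] by (simp add: null_def)
    define r where "r = 1 / sqrt (\<beta> 1 (y * st y))"
    have "r * r * \<beta> 1 (y * st y) = 1" using p by (simp add: r_def)
    then show ?thesis using y(1)
      by (intro exI[of _ "r *\<^sub>R y"]) (auto simp: st_simps \<beta>_simps)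
  qed
  show ?thesis
  proof (cases "\<forall>y. st y = - y \<longrightarrow> y \<in> null")
    case True
    then show ?thesis using evaluation_below_real by blast
  next
    case False
    then obtain u where u: "st u = - u" "\<beta> 1 (u * st u) = 1" using normalize by blast
    show ?thesis
    proof (cases "\<forall>y. st y = - y \<longrightarrow> y + \<beta> 1 (y * u) *\<^sub>R u \<in> null")
      case True
      then show ?thesis using evaluation_below_complex[OF u] by blast
    next
      case False
      \<comment> \<open>Gram-Schmidt: the displayed sum is y without its component along u, and
        normalizing it yields the second unit v.\<close>
      then obtain y where y: "st y = - y" "y + \<beta> 1 (y * u) *\<^sub>R u \<notin> null" by blast
      obtain v r where v: "st v = - v" "\<beta> 1 (v * st v) = 1" "v = r *\<^sub>R (y + \<beta> 1 (y * u) *\<^sub>R u)"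
        using normalize[OF _ y(2)] y(1) u(1) by (auto simp: st_simps)
      have "\<beta> 1 (u * u) = - 1" using u by (simp add: \<beta>_minus)
      then have "\<beta> 1 (u * v) = 0"
        unfolding v(3) by (simp add: \<beta>_simps distrib_left \<beta>_cyc[of u y])
      then show ?thesis using evaluation_below_quaternion[OF u v(1,2)] by blast
    qed
  qed
qed

end

section \<open>Left- and middle-coefficient polynomials\<close>

lemma qnorm2_mult: "qnorm2 (z * w) = qnorm2 z * qnorm2 w"
  by (simp add: qnorm2_def power2_eq_square algebra_simps)

lemma qnorm2_conv: "qnorm2 z = qRe (qcnj z * z)"
  by (simp add: qcnj_mult_self)

lemma qRe_cyc: "qRe (z * w) = qRe (w * z)"
  by (simp add: algebra_simps)

lemma qRe_sum: "qRe (sum f A) = (\<Sum>k\<in>A. qRe (f k))"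
  by (induction A rule: infinite_finite_induct) auto

lemma qRe_mult_of_real: "qRe (z * of_real r) = qRe z * r"
  by simp

lemma heval_sum: "heval a (sum p A) = (\<Sum>k\<in>A. heval a (p k))"
  by (induction A rule: infinite_finite_induct) auto

lemma heval_scaleR: "heval a (r *\<^sub>R p) = r *\<^sub>R heval a p"
  by (simp add: scaleR_hpoly_def of_real_def)

lemma hstar_scaleR: "hstar (r *\<^sub>R p) = r *\<^sub>R hstar p"
  using hconst_real_central[of r "hstar p"] by (simp add: scaleR_hpoly_def)

lemma hstar_minus: "hstar (- p) = - hstar (p :: 'n::finite hpoly)"
  using hstar_scaleR[of "- 1" p] by simp

lemma heval_minus: "heval a (- p) = - heval a p"
  using heval_scaleR[of a "- 1" p] by simp

lemma scaleR_rpoly: "r *\<^sub>R p = Poly_Mapping.single 0 r * (p :: 'n rpoly)"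
proof -
  have "r *\<^sub>R (1 :: 'n rpoly) = Poly_Mapping.single 0 r"
    by (rule poly_mapping_eqI)
      (simp add: scaleR_poly_mapping_def Poly_Mapping.map.rep_eq when_def lookup_one lookup_single)
  then show ?thesis by (metis scaleR_left.minus mult_scaleR_left mult_1_left)
qed

lemma scaleR_single: "r *\<^sub>R Poly_Mapping.single w c = Poly_Mapping.single (w :: 'n qword) (r * c)"
  by (simp add: scaleR_rpoly mult_single)

lemma rstar_scaleR: "rstar (r *\<^sub>R p) = r *\<^sub>R rstar p"
  using mult_scaleR_right[of "rstar p" r 1] by (simp add: scaleR_rpoly mult_single)

lemma reval_scaleR: "reval a (r *\<^sub>R p) = r *\<^sub>R reval a p"
  by (simp add: scaleR_rpoly)

lemma rstar_one [simp]: "rstar 1 = 1"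
  using rstar_single[of 0 1] by (simp add: single_one del: rstar_single)

lemma reval_one [simp]: "reval a 1 = 1"
  using reval_single[of a 0 1] by (simp add: single_one del: reval_single)

lemma reval_minus: "reval a (- p) = - reval a p"
  using reval_scaleR[of a "- 1" p] by simp

lemma reval_diff: "reval a (p - q) = reval a p - reval a q"
  using reval_add[of a p "- q"] by (simp add: reval_minus del: reval_add)

lemma qword_induct [case_names empty letter]:
  assumes "P 0" and "\<And>x w. P w \<Longrightarrow> P (wletter x + w)"
  shows "P w"
proof -
  have "P (abs_qword u)" for u
  proof (induction u)
    case Nil
    then show ?case using assms(1) by (simp add: zero_qword_def)
  next
    case (Cons x u)
    have "abs_qword (x # u) = wletter x + abs_qword u"
      by (simp add: wletter.abs_eq plus_qword.abs_eq)
    then show ?case using assms(2)[OF Cons] by simp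
  qed
  then show ?thesis by (induction w rule: qword.abs_induct)
qed

lemma hpoly_of_hconst_single:
  "hpoly_of (Poly_Mapping.single w r) = hconst (of_real r) * (hword w :: 'n hpoly)"
  unfolding hword_def by (simp add: mult_single flip: hpoly_of_single_hconst hpoly_of_mult)

lemma hword_add: "hword (u + v) = hword u * hword v"
  by (simp add: hword_def mult_single flip: hpoly_of_mult)

lemma hword_zero: "hword 0 = (1 :: 'n::finite hpoly)"
  by (simp only: hword_def hpoly_of_single of_real_1)

lemma hstar_hword: "hstar (hword w) = hword (wstar w)"
  by (simp add: hword_def)

lemma heval_hword: "heval a (hword w) = weval a w"
  by (simp add: hword_def)

lemma left_polys_gen: "hconst c * hword w \<in> left_polys"
  unfolding left_polys_def by (intro CollectI exI[of _ "{w}"] exI[of _ "\<lambda>_. c"]) simp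

lemma left_polys_add:
  assumes "p \<in> left_polys" "q \<in> left_polys"
  shows "p + q \<in> left_polys"
proof -
  obtain S c S' c' where p: "p = (\<Sum>w\<in>S. hconst (c w) * hword w)" "finite S"
    and q: "q = (\<Sum>w\<in>S'. hconst (c' w) * hword w)" "finite S'"
    using assms by (auto simp: left_polys_def)
  let ?d = "\<lambda>w. (if w \<in> S then c w else 0) + (if w \<in> S' then c' w else 0)"
  have "p = (\<Sum>w\<in>S \<union> S'. hconst (if w \<in> S then c w else 0) * hword w)"
    "q = (\<Sum>w\<in>S \<union> S'. hconst (if w \<in> S' then c' w else 0) * hword w)"
    unfolding p(1) q(1) using p(2) q(2)
    by (intro sum.mono_neutral_cong_left; auto simp: hconst_simps)+
  then have "p + q = (\<Sum>w\<in>S \<union> S'. hconst (?d w) * hword w)"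
    by (simp only: hconst_simps distrib_right sum.distrib)
  then show ?thesis unfolding left_polys_def using p(2) q(2)
    by (intro CollectI exI[of _ "S \<union> S'"] exI[of _ ?d]) simp
qed

lemma left_polys_induct [consumes 1, case_names gen add]:
  assumes "p \<in> left_polys" and "\<And>c w. P (hconst c * hword w)" and "\<And>p q. P p \<Longrightarrow> P q \<Longrightarrow> P (p + q)"
  shows "P p"
proof -
  obtain S c where p: "p = (\<Sum>w\<in>S. hconst (c w) * hword w)" "finite S"
    using assms(1) by (auto simp: left_polys_def)
  have z: "P 0" using assms(2)[of 0 undefined] by (simp add: hconst_simps)
  have "P (\<Sum>w\<in>S. hconst (c w) * hword w)" using p(2)
    by (induction S rule: finite_induct) (use z assms(2,3) in auto)
  then show ?thesis by (simp add: p(1))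
qed

lemma left_polys_hpoly_of: "hconst c * hpoly_of x \<in> left_polys"
proof (induction x rule: rpoly_induct)
  case (single w r)
  have "hconst c * hpoly_of (Poly_Mapping.single w r) = hconst (c * of_real r) * hword w"
    by (simp add: hpoly_of_hconst_single hconst_simps mult.assoc)
  then show ?case using left_polys_gen by metis
qed (simp add: hpoly_of_add distrib_left left_polys_add)

text \<open>Since x has real coefficients, appending it leaves every quaternionic constant in front.
  The stability of \<open>value_cone\<close> under squares of real polynomials rests on
  this.\<close>

lemma left_polys_mult: "p \<in> left_polys \<Longrightarrow> p * hpoly_of x \<in> left_polys"
proof (induction p rule: left_polys_induct)
  case (gen c w)
  have "hconst c * hword w * hpoly_of x = hconst c * hpoly_of (Poly_Mapping.single w 1 * x)"
    by (simp add: hword_def hpoly_of_mult mult.assoc)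
  then show ?case by (simp add: left_polys_hpoly_of)
qed (simp add: distrib_right left_polys_add)

lemma middle_polys_gen: "hword u * hconst c * hword v \<in> middle_polys"
  unfolding middle_polys_def
  by (intro CollectI exI[of _ "{(u, v)}"] exI[of _ "\<lambda>_ _. c"]) simp

lemma middle_polys_add:
  assumes "p \<in> middle_polys" "q \<in> middle_polys"
  shows "p + q \<in> middle_polys"
proof -
  obtain S c S' c' where p: "p = (\<Sum>(u, v)\<in>S. hword u * hconst (c u v) * hword v)" "finite S"
    and q: "q = (\<Sum>(u, v)\<in>S'. hword u * hconst (c' u v) * hword v)" "finite S'"
    using assms by (auto simp: middle_polys_def)
  let ?d = "\<lambda>u v. (if (u, v) \<in> S then c u v else 0) + (if (u, v) \<in> S' then c' u v else 0)"
  have "p = (\<Sum>(u, v)\<in>S \<union> S'. hword u * hconst (if (u, v) \<in> S then c u v else 0) * hword v)"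
    "q = (\<Sum>(u, v)\<in>S \<union> S'. hword u * hconst (if (u, v) \<in> S' then c' u v else 0) * hword v)"
    unfolding p(1) q(1) using p(2) q(2)
    by (intro sum.mono_neutral_cong_left; auto simp: hconst_simps)+
  then have "p + q = (\<Sum>(u, v)\<in>S \<union> S'. hword u * hconst (?d u v) * hword v)"
    by (simp only: hconst_simps distrib_right distrib_left sum.distrib[symmetric])
      (auto intro!: sum.cong)
  then show ?thesis unfolding middle_polys_def using p(2) q(2)
    by (intro CollectI exI[of _ "S \<union> S'"] exI[of _ ?d]) simp
qed

lemma middle_polys_induct [consumes 1, case_names gen add]:
  assumes "p \<in> middle_polys" and "\<And>u c v. P (hword u * hconst c * hword v)"
    and "\<And>p q. P p \<Longrightarrow> P q \<Longrightarrow> P (p + q)"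
  shows "P p"
proof -
  obtain S c where p: "p = (\<Sum>(u, v)\<in>S. hword u * hconst (c u v) * hword v)" "finite S"
    using assms(1) by (auto simp: middle_polys_def)
  have z: "P 0" using assms(2)[of undefined 0 undefined] by (simp add: hconst_simps)
  have "P (\<Sum>(u, v)\<in>S. hword u * hconst (c u v) * hword v)" using p(2)
    by (induction S rule: finite_induct) (use z assms(2,3) in auto)
  then show ?thesis by (simp add: p(1))
qed

lemma middle_polys_word:
  "p \<in> middle_polys \<Longrightarrow> hword w * p \<in> middle_polys" "p \<in> middle_polys \<Longrightarrow> p * hword w \<in> middle_polys"
proof -
  show "p \<in> middle_polys \<Longrightarrow> hword w * p \<in> middle_polys"
  proof (induction p rule: middle_polys_induct)
    case (gen u c v)
    then show ?case using middle_polys_gen[of "w + u" c v] by (simp add: hword_add mult.assoc)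
  qed (simp add: distrib_left middle_polys_add)
  show "p \<in> middle_polys \<Longrightarrow> p * hword w \<in> middle_polys"
  proof (induction p rule: middle_polys_induct)
    case (gen u c v)
    then show ?case using middle_polys_gen[of u c "v + w"] by (simp add: hword_add mult.assoc)
  qed (simp add: distrib_right middle_polys_add)
qed

lemma middle_polys_scaleR: "p \<in> middle_polys \<Longrightarrow> r *\<^sub>R p \<in> middle_polys"
proof (induction p rule: middle_polys_induct)
  case (gen u c v)
  have "r *\<^sub>R (hword u * hconst c * hword v) = hword u * hconst (of_real r * c) * hword v"
    by (simp add: scaleR_hpoly_def hconst_simps) (metis hconst_real_central mult.assoc)
  then show ?case by (simp add: middle_polys_gen)
qed (simp add: scaleR_add_right middle_polys_add)

lemma middle_polys_hpoly_of:
  assumes "p \<in> middle_polys"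
  shows "hpoly_of x * p \<in> middle_polys" "p * hpoly_of x \<in> middle_polys"
proof -
  show "hpoly_of x * p \<in> middle_polys"
  proof (induction x rule: rpoly_induct)
    case (single w r)
    have "hpoly_of (Poly_Mapping.single w r) * p = r *\<^sub>R (hword w * p)"
      by (simp add: hpoly_of_hconst_single scaleR_hpoly_def mult.assoc)
    then show ?case by (simp add: assms middle_polys_scaleR middle_polys_word)
  qed (simp add: hpoly_of_add distrib_right middle_polys_add)
  show "p * hpoly_of x \<in> middle_polys"
  proof (induction x rule: rpoly_induct)
    case (single w r)
    have "p * hpoly_of (Poly_Mapping.single w r) = r *\<^sub>R (p * hword w)"
      by (simp add: hpoly_of_hconst_single scaleR_hpoly_def)
        (metis hconst_real_central mult.assoc)
    then show ?case by (simp add: assms middle_polys_scaleR middle_polys_word)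
  qed (simp add: hpoly_of_add distrib_left middle_polys_add)
qed

lemma middle_polys_hconst: "hconst c \<in> (middle_polys :: 'n::finite hpoly set)"
  using middle_polys_gen[of 0 c 0] by (simp add: hword_zero)

lemma hstar_middle_polys: "p \<in> middle_polys \<Longrightarrow> hstar p \<in> middle_polys"
proof (induction p rule: middle_polys_induct)
  case (gen u c v)
  then show ?case using middle_polys_gen[of "wstar v" "qcnj c" "wstar u"]
    by (simp add: hstar_hword mult.assoc)
qed (simp add: middle_polys_add)

lemma hstar_left_mult_left:
  assumes "p \<in> left_polys" "q \<in> left_polys"
  shows "hstar p * q \<in> middle_polys"
  using assms(1)
proof (induction p rule: left_polys_induct)
  case (gen c w)
  show ?case using assms(2)
  proof (induction q rule: left_polys_induct)
    case (gen d v)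
    then show ?case using middle_polys_gen[of "wstar w" "qcnj c * d" v]
      by (simp add: hstar_hword hconst_simps mult.assoc)
  qed (simp add: distrib_left middle_polys_add)
qed (simp add: distrib_right middle_polys_add)

section \<open>Sums of squares and generators of the quadratic module\<close>

lemma sosE:
  assumes "p \<in> sos"
  obtains n u where "p = (\<Sum>s<n::nat. hstar (u s) * u s)" "\<forall>s<n. u s \<in> left_polys"
  using assms unfolding sos_def by (elim CollectE exE conjE) (rule that)

lemma sos_zero: "0 \<in> sos"
  unfolding sos_def by (intro CollectI exI[of _ 0]) auto

lemma sos_square: "p \<in> left_polys \<Longrightarrow> hstar p * p \<in> sos"
  unfolding sos_def by (intro CollectI exI[of _ 1] exI[of _ "\<lambda>_. p"]) auto

lemma sum_concat:
  fixes f f' :: "nat \<Rightarrow> 'a::comm_monoid_add"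
  shows "(\<Sum>k<n + n'. if k < n then f k else f' (k - n)) = sum f {..<n} + sum f' {..<n'}"
  by (induction n') (simp_all add: add.assoc)

lemma sos_add:
  assumes "p \<in> sos" "q \<in> sos"
  shows "p + q \<in> sos"
proof -
  obtain n u where p: "p = (\<Sum>s<n::nat. hstar (u s) * u s)" "\<forall>s<n. u s \<in> left_polys"
    by (rule sosE[OF assms(1)])
  obtain n' u' where q: "q = (\<Sum>s<n'::nat. hstar (u' s) * u' s)" "\<forall>s<n'. u' s \<in> left_polys"
    by (rule sosE[OF assms(2)])
  let ?v = "\<lambda>s::nat. if s < n then u s else u' (s - n)"
  have "p + q = (\<Sum>s<n + n'. hstar (?v s) * ?v s)"
    unfolding p(1) q(1) sum_concat[symmetric] by (intro sum.cong) auto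
  then show ?thesis unfolding sos_def using p(2) q(2)
    by (intro CollectI exI[of _ "n + n'"] exI[of _ ?v]) auto
qed

lemma quad_module_add:
  assumes "p \<in> quad_module m g l h" "q \<in> quad_module m g l h"
  shows "p + q \<in> quad_module m g l h"
proof -
  let ?t = "\<lambda>j x y. x * hpoly_of (h j) * hstar y + y * hstar (hpoly_of (h j)) * hstar x"
  obtain \<sigma> N \<tau> \<nu> where p: "p = \<sigma> 0 + (1 / 2) *\<^sub>R (\<Sum>i=1..m. \<sigma> i * hpoly_of (g i) + hpoly_of (g i) * \<sigma> i)
        + (\<Sum>j=1..l. \<Sum>\<alpha><N j. ?t j (\<tau> j \<alpha>) (\<nu> j \<alpha>))" "\<forall>i\<le>m. \<sigma> i \<in> sos"
      "\<forall>j\<in>{1..l}. \<forall>\<alpha><(N j :: nat). \<tau> j \<alpha> \<in> left_polys \<and> \<nu> j \<alpha> \<in> left_polys"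
    using assms(1) unfolding quad_module_def by blast
  obtain \<sigma>' N' \<tau>' \<nu>' where q: "q = \<sigma>' 0 + (1 / 2) *\<^sub>R (\<Sum>i=1..m. \<sigma>' i * hpoly_of (g i) + hpoly_of (g i) * \<sigma>' i)
        + (\<Sum>j=1..l. \<Sum>\<alpha><N' j. ?t j (\<tau>' j \<alpha>) (\<nu>' j \<alpha>))" "\<forall>i\<le>m. \<sigma>' i \<in> sos"
      "\<forall>j\<in>{1..l}. \<forall>\<alpha><(N' j :: nat). \<tau>' j \<alpha> \<in> left_polys \<and> \<nu>' j \<alpha> \<in> left_polys"
    using assms(2) unfolding quad_module_def by blast
  define \<tau>2 where "\<tau>2 j \<alpha> = (if \<alpha> < N j then \<tau> j \<alpha> else \<tau>' j (\<alpha> - N j))" for j \<alpha>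
  define \<nu>2 where "\<nu>2 j \<alpha> = (if \<alpha> < N j then \<nu> j \<alpha> else \<nu>' j (\<alpha> - N j))" for j \<alpha>
  have 1: "(\<Sum>\<alpha><N j + N' j. ?t j (\<tau>2 j \<alpha>) (\<nu>2 j \<alpha>))
      = (\<Sum>\<alpha><N j. ?t j (\<tau> j \<alpha>) (\<nu> j \<alpha>)) + (\<Sum>\<alpha><N' j. ?t j (\<tau>' j \<alpha>) (\<nu>' j \<alpha>))" for j
    unfolding sum_concat[symmetric] by (intro sum.cong) (auto simp: \<tau>2_def \<nu>2_def)
  have 2: "(\<Sum>i=1..m. (\<sigma> i + \<sigma>' i) * hpoly_of (g i) + hpoly_of (g i) * (\<sigma> i + \<sigma>' i))
      = (\<Sum>i=1..m. \<sigma> i * hpoly_of (g i) + hpoly_of (g i) * \<sigma> i)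
        + (\<Sum>i=1..m. \<sigma>' i * hpoly_of (g i) + hpoly_of (g i) * \<sigma>' i)"
    by (simp add: algebra_simps sum.distrib)
  have "p + q = (\<sigma> 0 + \<sigma>' 0)
        + (1 / 2) *\<^sub>R (\<Sum>i=1..m. (\<sigma> i + \<sigma>' i) * hpoly_of (g i) + hpoly_of (g i) * (\<sigma> i + \<sigma>' i))
        + (\<Sum>j=1..l. \<Sum>\<alpha><N j + N' j. ?t j (\<tau>2 j \<alpha>) (\<nu>2 j \<alpha>))"
    unfolding 1 2 unfolding p(1) q(1) sum.distrib scaleR_add_right by (simp add: add_ac)
  moreover have "\<forall>i\<le>m. \<sigma> i + \<sigma>' i \<in> sos" using p(2) q(2) sos_add by blast
  moreover have "\<forall>j\<in>{1..l}. \<forall>\<alpha><N j + N' j. \<tau>2 j \<alpha> \<in> left_polys \<and> \<nu>2 j \<alpha> \<in> left_polys"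
    using p(3) q(3) by (auto simp: \<tau>2_def \<nu>2_def)
  ultimately show ?thesis
    unfolding quad_module_def
    by (intro CollectI exI[of _ "\<lambda>i. \<sigma> i + \<sigma>' i"] exI[of _ "\<lambda>j. N j + N' j"] exI[of _ \<tau>2] exI[of _ \<nu>2]) blast
qed

lemma quad_module_square:
  assumes "p \<in> left_polys"
  shows "hstar p * p \<in> quad_module m g l h"
  unfolding quad_module_def
  by (intro CollectI exI[of _ "\<lambda>i. if i = 0 then hstar p * p else 0"] exI[of _ "\<lambda>_. 0"] exI)
    (auto simp: sos_zero sos_square assms)

lemma quad_module_weight:
  assumes "p \<in> left_polys" "i \<in> {1..m}"
  shows "(1 / 2) *\<^sub>R (hstar p * p * hpoly_of (g i) + hpoly_of (g i) * (hstar p * p)) \<in> quad_module m g l h"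
proof -
  let ?s = "\<lambda>k. if k = i then hstar p * p else 0"
  have "(\<Sum>k=1..m. ?s k * hpoly_of (g k) + hpoly_of (g k) * ?s k)
      = (\<Sum>k=1..m. if k = i then hstar p * p * hpoly_of (g i) + hpoly_of (g i) * (hstar p * p) else 0)"
    by (intro sum.cong) auto
  then have "(1 / 2) *\<^sub>R (hstar p * p * hpoly_of (g i) + hpoly_of (g i) * (hstar p * p))
      = ?s 0 + (1 / 2) *\<^sub>R (\<Sum>k=1..m. ?s k * hpoly_of (g k) + hpoly_of (g k) * ?s k)
        + (\<Sum>j=1..l. \<Sum>\<alpha><0::nat. 0 * hpoly_of (h j) * hstar 0 + 0 * hstar (hpoly_of (h j)) * hstar 0)"
    using assms(2) by simp
  then show ?thesis
    unfolding quad_module_def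
    by (intro CollectI exI[of _ ?s] exI[of _ "\<lambda>_. 0"] exI[of _ "\<lambda>_ _. 0"] exI[of _ "\<lambda>_ _. 0"])
      (auto simp: sos_zero sos_square assms(1))
qed

lemma quad_module_ideal:
  assumes "p \<in> left_polys" "q \<in> left_polys" "j \<in> {1..l}"
  shows "p * hpoly_of (h j) * hstar q + q * hstar (hpoly_of (h j)) * hstar p \<in> quad_module m g l h"
proof -
  let ?t = "\<lambda>j. p * hpoly_of (h j) * hstar q + q * hstar (hpoly_of (h j)) * hstar p"
  let ?N = "\<lambda>k. if k = j then 1 else 0 :: nat"
  have "(\<Sum>k=1..l. \<Sum>\<alpha><?N k. ?t k) = (\<Sum>k=1..l. if k = j then ?t j else 0)"
    by (intro sum.cong) auto
  then have "?t j = 0 + (1 / 2) *\<^sub>R (\<Sum>i=1..m. 0 * hpoly_of (g i) + hpoly_of (g i) * 0)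
        + (\<Sum>k=1..l. \<Sum>\<alpha><?N k. ?t k)"
    using assms(3) by simp
  then show ?thesis
    unfolding quad_module_def
    by (intro CollectI exI[of _ "\<lambda>_. 0"] exI[of _ ?N] exI[of _ "\<lambda>_ _. p"] exI[of _ "\<lambda>_ _. q"])
      (auto simp: sos_zero assms)
qed

section \<open>The cone of values of a quadratic module\<close>

lemma quat_add_cnj: "z + qcnj z = of_real (2 * qRe z)"
  by (simp add: quat_eq_iff del: of_real_mult)

lemma heval_diff: "heval a (p - q) = heval a p - heval a q"
  using heval_simps(1)[of a p "- q"] by (simp add: heval_minus del: heval_simps)

lemma of_real_fun: "of_real r = (\<lambda>_. of_real r)"
  by (simp add: of_real_def scaleR_fun_def fun_eq_iff)

inductive_set square_cone :: "(quat ^ 'n \<Rightarrow> real) set" where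
  square: "(\<lambda>a. qnorm2 (reval a x)) \<in> square_cone"
| add: "s \<in> square_cone \<Longrightarrow> t \<in> square_cone \<Longrightarrow> s + t \<in> square_cone"

text \<open>The space V of the abstract part; it contains the real part of every middle-coefficient
  polynomial.\<close>

inductive_set coeff_space :: "(quat ^ 'n \<Rightarrow> real) set" where
  gen: "(\<lambda>a. qRe (c * reval a x)) \<in> coeff_space"
| add: "v \<in> coeff_space \<Longrightarrow> w \<in> coeff_space \<Longrightarrow> v + w \<in> coeff_space"

text \<open>Generators chosen so that stability under squares can be read off. The terms in
  \<open>ideal\<close> form a set closed under negation, since c ranges over all
  quaternions.\<close>

inductive_set value_cone :: "nat \<Rightarrow> (nat \<Rightarrow> 'n::finite rpoly) \<Rightarrow> nat \<Rightarrow> (nat \<Rightarrow> 'n rpoly) \<Rightarrow>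
    (quat ^ 'n \<Rightarrow> real) set"
  for m g l h where
  square: "p \<in> left_polys \<Longrightarrow> (\<lambda>a. qnorm2 (heval a p)) \<in> value_cone m g l h"
| weight: "p \<in> left_polys \<Longrightarrow> i \<in> {1..m} \<Longrightarrow>
    (\<lambda>a. qnorm2 (heval a p) * qRe (reval a (g i))) \<in> value_cone m g l h"
| ideal: "j \<in> {1..l} \<Longrightarrow> (\<lambda>a. qRe (c * reval a (x * h j * y))) \<in> value_cone m g l h"
| add: "v \<in> value_cone m g l h \<Longrightarrow> w \<in> value_cone m g l h \<Longrightarrow> v + w \<in> value_cone m g l h"

lemma square_cone_real:
  assumes "r \<ge> 0"
  shows "(of_real r :: quat ^ 'n::finite \<Rightarrow> real) \<in> square_cone"
proof -
  have "of_real r = (\<lambda>a :: quat ^ 'n. qnorm2 (reval a (sqrt r *\<^sub>R 1)))"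
    using assms by (simp add: fun_eq_iff of_real_fun reval_scaleR qnorm2_def)
  then show ?thesis by (simp only: square_cone.square)
qed

text \<open>A real polynomial with the values t turns t Re (c x) into Re (c x z), which keeps
  \<open>coeff_space\<close> stable under multiplication by t.\<close>

lemma square_cone_poly:
  assumes "t \<in> square_cone"
  shows "\<exists>z. \<forall>a. reval a z = of_real (t a)"
  using assms
proof induction
  case (square x)
  then show ?case by (intro exI[of _ "x * rstar x"]) (simp add: reval_rstar qcnj_mult_self)
next
  case (add s t)
  then obtain z w where "\<forall>a. reval a z = of_real (s a)" "\<forall>a. reval a w = of_real (t a)" by blast
  then show ?case by (intro exI[of _ "z + w"]) (simp add: plus_fun_def)
qed

lemma square_cone_mult:
  assumes "s \<in> square_cone" "t \<in> square_cone"
  shows "s * t \<in> square_cone"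
  using assms(1)
proof induction
  case (square x)
  show ?case using assms(2)
  proof induction
    case (square y)
    have "(\<lambda>a. qnorm2 (reval a x)) * (\<lambda>a. qnorm2 (reval a y)) = (\<lambda>a. qnorm2 (reval a (x * y)))"
      by (simp add: fun_eq_iff qnorm2_mult)
    then show ?case by (simp only: square_cone.square)
  qed (simp only: distrib_left square_cone.add)
qed (simp only: distrib_right square_cone.add)

lemma coeff_space_mult_real:
  assumes z: "\<And>a. reval a z = of_real (t a)" and v: "v \<in> coeff_space"
  shows "t * v \<in> coeff_space"
  using v
proof induction
  case (gen c x)
  have "t * (\<lambda>a. qRe (c * reval a x)) = (\<lambda>a. qRe (c * reval a (x * z)))"
    by (simp add: fun_eq_iff z algebra_simps)
  then show ?case by (simp only: coeff_space.gen)
qed (simp only: distrib_left coeff_space.add)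

text \<open>Norms of quaternions multiply, so a square factor is absorbed into p; in an ideal term
  the central value of \<open>x * rstar x\<close> is absorbed into the right cofactor.\<close>

lemma value_cone_mult:
  assumes t: "t \<in> square_cone" and v: "v \<in> value_cone m g l h"
  shows "t * v \<in> value_cone m g l h"
  using t
proof induction
  case (square x)
  show ?case using v
  proof induction
    case (square p)
    have "(\<lambda>a. qnorm2 (reval a x)) * (\<lambda>a. qnorm2 (heval a p))
        = (\<lambda>a. qnorm2 (heval a (p * hpoly_of x)))"
      by (simp add: fun_eq_iff qnorm2_mult)
    then show ?case by (simp only: value_cone.square[OF left_polys_mult[OF square]])
  next
    case (weight p i)
    have "(\<lambda>a. qnorm2 (reval a x)) * (\<lambda>a. qnorm2 (heval a p) * qRe (reval a (g i)))
        = (\<lambda>a. qnorm2 (heval a (p * hpoly_of x)) * qRe (reval a (g i)))"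
      by (simp add: fun_eq_iff qnorm2_mult)
    then show ?case by (simp only: value_cone.weight[OF left_polys_mult[OF weight(1)] weight(2)])
  next
    case (ideal j c u y)
    have "(\<lambda>a. qnorm2 (reval a x)) * (\<lambda>a. qRe (c * reval a (u * h j * y)))
        = (\<lambda>a. qRe (c * reval a (u * h j * (y * (x * rstar x)))))"
    proof
      fix a
      have "c * reval a (u * h j * (y * (x * rstar x)))
          = c * reval a (u * h j * y) * of_real (qnorm2 (reval a x))"
        by (simp add: reval_rstar qcnj_mult_self mult.assoc)
      then show "((\<lambda>a. qnorm2 (reval a x)) * (\<lambda>a. qRe (c * reval a (u * h j * y)))) a
          = qRe (c * reval a (u * h j * (y * (x * rstar x))))"
        by (simp only: qRe_mult_of_real times_fun_def mult.commute)
    qed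
    then show ?case by (simp only: value_cone.ideal[where h = h, OF ideal])
  qed (simp only: distrib_left value_cone.add)
qed (simp only: distrib_right value_cone.add)

lemma coeff_space_square:
  assumes "p \<in> left_polys" "q \<in> left_polys"
  shows "(\<lambda>a. qRe (qcnj (heval a p) * heval a q)) \<in> coeff_space"
  using assms(1)
proof (induction p rule: left_polys_induct)
  case (gen c w)
  show ?case using assms(2)
  proof (induction q rule: left_polys_induct)
    case (gen d v)
    have "(\<lambda>a. qRe (qcnj (heval a (hconst c * hword w)) * heval a (hconst d * hword v)))
        = (\<lambda>a. qRe ((qcnj c * d) * reval a (Poly_Mapping.single (v + wstar w) 1)))"
    proof
      fix a
      show "qRe (qcnj (heval a (hconst c * hword w)) * heval a (hconst d * hword v))
          = qRe ((qcnj c * d) * reval a (Poly_Mapping.single (v + wstar w) 1))"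
        using qRe_cyc[of "qcnj (weval a w)" "qcnj c * d * weval a v"]
        by (simp add: heval_hword mult.assoc del: times_quat.sel)
    qed
    then show ?case by (simp only: coeff_space.gen)
  next
    case (add q q')
    then show ?case using coeff_space.add[OF add] by (simp add: plus_fun_def distrib_left del: times_quat.sel)
  qed
next
  case (add p p')
  then show ?case using coeff_space.add[OF add] by (simp add: plus_fun_def distrib_right del: times_quat.sel)
qed

lemma value_cone_subset:
  assumes g: "\<And>i. i \<in> {1..m} \<Longrightarrow> g i \<in> rSym"
  shows "value_cone m g l h \<subseteq> coeff_space"
proof
  fix v assume "v \<in> value_cone m g l h"
  then show "v \<in> coeff_space"
  proof induction
    case (square p)
    then show ?case using coeff_space_square[of p p] by (simp only: qnorm2_conv)
  next
    case (weight p i)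
    have "reval a (g i) = of_real (qRe (reval a (g i)))" for a
      using reval_real[OF g[OF weight(2)]] .
    from coeff_space_mult_real[OF this coeff_space_square[OF weight(1) weight(1)]]
    show ?case by (simp only: qnorm2_conv times_fun_def mult.commute)
  next
    case (ideal j c x y)
    show ?case by (rule coeff_space.gen)
  qed (rule coeff_space.add)
qed

lemma value_cone_sum:
  assumes "\<And>k. k \<in> A \<Longrightarrow> (\<lambda>a. v k a) \<in> value_cone m g l h"
  shows "(\<lambda>a. \<Sum>k\<in>A. v k a) \<in> value_cone m g l h"
proof -
  have "(\<lambda>a. qnorm2 (heval a (hconst 0 * hword 0))) \<in> value_cone m g l h"
    by (intro value_cone.square left_polys_gen)
  then have z: "(\<lambda>a. 0) \<in> value_cone m g l h" by (simp add: qnorm2_def)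
  show ?thesis using assms
  proof (induction A rule: infinite_finite_induct)
    case (insert k A)
    have "(\<lambda>a. v k a) + (\<lambda>a. \<Sum>k\<in>A. v k a) \<in> value_cone m g l h"
      by (intro value_cone.add insert.IH insert.prems) simp_all
    then show ?case using insert.hyps by (simp add: plus_fun_def)
  qed (simp_all add: z)
qed

lemma value_cone_real:
  assumes "r \<ge> 0" "v \<in> value_cone m g l h"
  shows "(\<lambda>a. r * v a) \<in> value_cone m g l h"
  using value_cone_mult[OF square_cone_real[OF assms(1)] assms(2)]
  by (simp add: of_real_fun times_fun_def)

lemma value_cone_ideal_left:
  assumes "p \<in> left_polys" "q \<in> left_polys" "j \<in> {1..l}"
  shows "(\<lambda>a. qRe (heval a p * reval a (h j) * qcnj (heval a q))) \<in> value_cone m g l h"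
  using assms(1)
proof (induction p rule: left_polys_induct)
  case (gen c w)
  show ?case using assms(2)
  proof (induction q rule: left_polys_induct)
    case (gen d v)
    have "(\<lambda>a. qRe (heval a (hconst c * hword w) * reval a (h j) * qcnj (heval a (hconst d * hword v))))
        = (\<lambda>a. qRe ((qcnj d * c) * reval a (Poly_Mapping.single w 1 * h j * Poly_Mapping.single (wstar v) 1)))"
    proof
      fix a
      show "qRe (heval a (hconst c * hword w) * reval a (h j) * qcnj (heval a (hconst d * hword v)))
        = qRe ((qcnj d * c) * reval a (Poly_Mapping.single w 1 * h j * Poly_Mapping.single (wstar v) 1))"
        using qRe_cyc[of "c * weval a w * reval a (h j) * qcnj (weval a v)" "qcnj d"]
        by (simp add: heval_hword mult.assoc del: times_quat.sel)
    qed
    then show ?case by (simp only: value_cone.ideal[where h = h, OF assms(3)])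
  next
    case (add q q')
    then show ?case using value_cone.add[OF add] by (simp add: plus_fun_def distrib_left del: times_quat.sel)
  qed
next
  case (add p p')
  then show ?case using value_cone.add[OF add] by (simp add: plus_fun_def distrib_right del: times_quat.sel)
qed

lemma quad_module_value_cone:
  assumes g: "\<And>i. i \<in> {1..m} \<Longrightarrow> g i \<in> rSym" and q: "q \<in> quad_module m g l h"
  shows "(\<lambda>a. qRe (heval a q)) \<in> value_cone m g l h"
proof -
  let ?t = "\<lambda>j x y. x * hpoly_of (h j) * hstar y + y * hstar (hpoly_of (h j)) * hstar x"
  obtain \<sigma> N \<tau> \<nu> where q: "q = \<sigma> 0 + (1 / 2) *\<^sub>R (\<Sum>i=1..m. \<sigma> i * hpoly_of (g i) + hpoly_of (g i) * \<sigma> i)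
        + (\<Sum>j=1..l. \<Sum>\<alpha><N j. ?t j (\<tau> j \<alpha>) (\<nu> j \<alpha>))" "\<forall>i\<le>m. \<sigma> i \<in> sos"
      "\<forall>j\<in>{1..l}. \<forall>\<alpha><(N j :: nat). \<tau> j \<alpha> \<in> left_polys \<and> \<nu> j \<alpha> \<in> left_polys"
    using q unfolding quad_module_def by blast
  have sq: "(\<lambda>a. qRe (heval a p)) \<in> value_cone m g l h" if p_sos: "p \<in> sos" for p
  proof -
    obtain n u where p: "p = (\<Sum>s<n::nat. hstar (u s) * u s)" "\<forall>s<n. u s \<in> left_polys"
      by (rule sosE[OF p_sos])
    have "qRe (heval a p) = (\<Sum>s<n. qnorm2 (heval a (u s)))" for a
      by (simp add: p(1) heval_sum qRe_sum heval_hstar qnorm2_conv del: times_quat.sel)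
    then show ?thesis using p(2) by (simp only:) (intro value_cone_sum value_cone.square, auto)
  qed
  have wt: "(\<lambda>a. qRe (heval a (p * hpoly_of (g i) + hpoly_of (g i) * p))) \<in> value_cone m g l h"
    if p_sos: "p \<in> sos" and i: "i \<in> {1..m}" for p i
  proof -
    obtain n u where p: "p = (\<Sum>s<n::nat. hstar (u s) * u s)" "\<forall>s<n. u s \<in> left_polys"
      by (rule sosE[OF p_sos])
    have pe: "heval a p = of_real (\<Sum>s<n. qnorm2 (heval a (u s)))" for a
      by (simp add: p(1) heval_sum heval_hstar qcnj_mult_self)
    have "qRe (heval a (p * hpoly_of (g i) + hpoly_of (g i) * p))
        = 2 * (\<Sum>s<n. qnorm2 (heval a (u s)) * qRe (reval a (g i)))" for a
    proof -
      define S where "S = (\<Sum>s<n. qnorm2 (heval a (u s)))"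
      have "heval a (p * hpoly_of (g i) + hpoly_of (g i) * p)
          = of_real S * reval a (g i) + reval a (g i) * of_real S"
        using pe[of a] by (simp add: S_def del: of_real_sum)
      then have "qRe (heval a (p * hpoly_of (g i) + hpoly_of (g i) * p)) = 2 * (S * qRe (reval a (g i)))"
        by simp
      then show ?thesis unfolding S_def sum_distrib_right .
    qed
    then show ?thesis using p(2) i
      by (simp del: heval_simps) (intro value_cone_real value_cone_sum value_cone.weight, auto)
  qed
  have id: "(\<lambda>a. qRe (heval a (?t j x y))) \<in> value_cone m g l h"
    if "x \<in> left_polys" "y \<in> left_polys" "j \<in> {1..l}" for x y j
  proof -
    have "qRe (heval a (?t j x y)) = 2 * qRe (heval a x * reval a (h j) * qcnj (heval a y))" for a
    proof -
      have "heval a (?t j x y) = heval a x * reval a (h j) * qcnj (heval a y)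
          + qcnj (heval a x * reval a (h j) * qcnj (heval a y))"
        by (simp add: heval_hstar reval_rstar mult.assoc)
      then show ?thesis by (simp only: plus_quat.sel qcnj.sel)
    qed
    then show ?thesis
      by (simp del: heval_simps hstar_simps times_quat.sel)
        (intro value_cone_real value_cone_ideal_left that, simp)
  qed
  have "(\<lambda>a. qRe (heval a q)) = (\<lambda>a. qRe (heval a (\<sigma> 0)))
      + (\<lambda>a. (1 / 2) * (\<Sum>i=1..m. qRe (heval a (\<sigma> i * hpoly_of (g i) + hpoly_of (g i) * \<sigma> i))))
      + (\<lambda>a. \<Sum>j=1..l. \<Sum>\<alpha><N j. qRe (heval a (?t j (\<tau> j \<alpha>) (\<nu> j \<alpha>))))"
    unfolding q(1) plus_fun_def heval_simps(1)[of _ "_ + _" "sum _ _"] heval_simps(1)[of _ _ "_ *\<^sub>R _"]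
      heval_scaleR heval_sum plus_quat.sel scaleR_quat.sel qRe_sum by (rule refl)
  also have "\<dots> \<in> value_cone m g l h"
  proof (intro value_cone.add value_cone_real value_cone_sum)
    show "(\<lambda>a. qRe (heval a (\<sigma> 0))) \<in> value_cone m g l h" using q(2) by (intro sq) auto
  qed (use q(2,3) in \<open>auto intro!: wt id simp del: heval_simps hstar_simps\<close>)
  finally show ?thesis .
qed

text \<open>The representative is found symmetric and middle-coefficient, because the difference
  between f and it must lie in that space too.\<close>

lemma value_cone_realize:
  assumes g: "\<And>i. i \<in> {1..m} \<Longrightarrow> g i \<in> rSym" and v: "v \<in> value_cone m g l h"
  shows "\<exists>q \<in> quad_module m g l h \<inter> hSym middle_polys. \<forall>a. heval a q = of_real (v a)"
  using v
proof induction
  case (square p)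
  show ?case
  proof (intro bexI[of _ "hstar p * p"] allI)
    show "heval a (hstar p * p) = of_real (qnorm2 (heval a p))" for a
      by (simp add: heval_hstar qcnj_mult_self)
    show "hstar p * p \<in> quad_module m g l h \<inter> hSym middle_polys"
      using square by (simp add: hSym_def quad_module_square hstar_left_mult_left)
  qed
next
  case (weight p i)
  let ?q = "(1 / 2) *\<^sub>R (hstar p * p * hpoly_of (g i) + hpoly_of (g i) * (hstar p * p))"
  have gi: "rstar (g i) = g i" using g[OF weight(2)] by (simp add: rSym_def)
  show ?case
  proof (intro bexI[of _ ?q] allI)
    show "heval a ?q = of_real (qnorm2 (heval a p) * qRe (reval a (g i)))" for a
    proof -
      have "reval a (g i) = of_real (qRe (reval a (g i)))" by (rule reval_real[OF g[OF weight(2)]])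
      then show ?thesis
        by (simp add: heval_scaleR heval_hstar qcnj_mult_self quat_eq_iff)
    qed
    have "hstar ?q = ?q" by (simp add: hstar_scaleR gi mult.assoc add.commute)
    moreover have "?q \<in> middle_polys"
      using weight(1)
      by (intro middle_polys_scaleR middle_polys_add middle_polys_hpoly_of hstar_left_mult_left)
    ultimately show "?q \<in> quad_module m g l h \<inter> hSym middle_polys"
      using quad_module_weight[OF weight] by (simp add: hSym_def)
  qed
next
  case (ideal j c x y)
  \<comment> \<open>The module adds the adjoint term, whose value is the conjugate; halving c
    therefore leaves exactly the real part.\<close>
  let ?p = "hconst ((1 / 2) *\<^sub>R c) * hpoly_of x" and ?r = "hconst 1 * hpoly_of (rstar y)"
  let ?q = "?p * hpoly_of (h j) * hstar ?r + ?r * hstar (hpoly_of (h j)) * hstar ?p"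
  show ?case
  proof (intro bexI[of _ ?q] allI)
    show "heval a ?q = of_real (qRe (c * reval a (x * h j * y)))" for a
    proof -
      have "heval a ?q = (1 / 2) *\<^sub>R (c * reval a (x * h j * y)) + qcnj ((1 / 2) *\<^sub>R (c * reval a (x * h j * y)))"
        by (simp add: reval_rstar mult.assoc)
      then show ?thesis unfolding quat_add_cnj scaleR_quat.sel by (simp del: times_quat.sel reval_mult)
    qed
    have A: "?p * hpoly_of (h j) * hstar ?r \<in> middle_polys"
    proof -
      have "?p * hpoly_of (h j) * hstar ?r = hconst ((1 / 2) *\<^sub>R c) * hpoly_of (x * h j * y)"
        by (simp add: hpoly_of_mult mult.assoc hconst_one_mult)
      then show ?thesis by (simp only: middle_polys_hpoly_of middle_polys_hconst)
    qed
    have "?r * hstar (hpoly_of (h j)) * hstar ?p = hstar (?p * hpoly_of (h j) * hstar ?r)"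
      by (simp add: mult.assoc)
    then have "?q \<in> middle_polys" using A hstar_middle_polys[OF A] middle_polys_add by metis
    moreover have "hstar ?q = ?q" by (simp add: mult.assoc add.commute)
    moreover have "?q \<in> quad_module m g l h"
      using ideal by (intro quad_module_ideal left_polys_hpoly_of)
    ultimately show "?q \<in> quad_module m g l h \<inter> hSym middle_polys" by (simp add: hSym_def)
  qed
next
  case (add v w)
  then obtain p q where p: "p \<in> quad_module m g l h \<inter> hSym middle_polys" "\<forall>a. heval a p = of_real (v a)"
    and q: "q \<in> quad_module m g l h \<inter> hSym middle_polys" "\<forall>a. heval a q = of_real (w a)" by blast
  then show ?case
    by (intro bexI[of _ "p + q"]) (auto simp: hSym_def plus_fun_def quad_module_add middle_polys_add)
qed


section \<open>Boundedness of polynomials from the Archimedean condition\<close>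

lemma normsq_bound_word:
  fixes g h :: "nat \<Rightarrow> 'n::finite rpoly"
  assumes g: "\<And>i. i \<in> {1..m} \<Longrightarrow> g i \<in> rSym"
    and arch: "archimedean (quad_module m g l h)"
  shows "\<exists>N\<ge>0. (\<lambda>a. N - qnorm2 (reval a x)) \<in> value_cone m g l h"
proof -
  let ?Q = "value_cone m g l h"
  obtain R where R: "R > 0" "of_real R - (\<Sum>i\<in>UNIV. hword (normsq i)) \<in> quad_module m g l h"
    using arch by (auto simp: archimedean_def)
  have ns: "heval a (hword (normsq i)) = of_real (qnorm2 (a $ i))" for a i
    by (simp add: heval_hword normsq_def qcnj_mult_self)
  have "qRe (heval a (of_real R - (\<Sum>i\<in>UNIV. hword (normsq i)))) = R - (\<Sum>i\<in>UNIV. qnorm2 (a $ i))"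
    for a :: "quat ^ 'n"
  proof -
    have "heval a (of_real R) = of_real R"
      by (simp add: of_real_def heval_scaleR)
    then show ?thesis by (simp add: heval_diff heval_sum ns qRe_sum)
  qed
  then have R': "(\<lambda>a. R - (\<Sum>i\<in>UNIV. qnorm2 (a $ i))) \<in> ?Q"
    using quad_module_value_cone[OF g R(2)] by simp
  have bound: "(\<lambda>a. R - qnorm2 (letter_eval a x)) \<in> ?Q" for x
  proof -
    have "qnorm2 (letter_eval a x) = qnorm2 (a $ lidx x)" for a
      by (cases x) (simp_all add: qnorm2_def)
    then have "(\<lambda>a. R - qnorm2 (letter_eval a x))
        = (\<lambda>a. R - (\<Sum>i\<in>UNIV. qnorm2 (a $ i))) + (\<lambda>a. \<Sum>i\<in>UNIV - {lidx x}. qnorm2 (a $ i))"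
      by (simp add: fun_eq_iff sum.remove[of UNIV "lidx x"])
    moreover have "(\<lambda>a. \<Sum>i\<in>UNIV - {lidx x}. qnorm2 (a $ i)) \<in> ?Q"
    proof (rule value_cone_sum)
      fix i
      have "(\<lambda>a. qnorm2 (heval a (hconst 1 * hword (wletter (LQ i))))) \<in> ?Q"
        by (intro value_cone.square left_polys_gen)
      then show "(\<lambda>a. qnorm2 (a $ i)) \<in> ?Q" by (simp add: heval_hword)
    qed
    ultimately show ?thesis using value_cone.add[OF R'] by simp
  qed
  have word: "\<exists>N\<ge>0. (\<lambda>a. N - qnorm2 (weval a w)) \<in> ?Q" for w
  proof (induction w rule: qword_induct)
    case empty
    have "(\<lambda>a. qnorm2 (heval a (hconst 0 * hword 0))) \<in> ?Q"
      by (intro value_cone.square left_polys_gen)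
    then show ?case by (intro exI[of _ 1]) (simp add: qnorm2_def)
  next
    case (letter x w)
    then obtain N where N: "N \<ge> 0" "(\<lambda>a. N - qnorm2 (weval a w)) \<in> ?Q" by blast
    \<comment> \<open>Bounds pass from w to x w because the norm is multiplicative and the cone is
      stable under squares.\<close>
    have "(\<lambda>a. qnorm2 (reval a (Poly_Mapping.single (wletter x) 1))) * (\<lambda>a. N - qnorm2 (weval a w))
        + (\<lambda>a. N * (R - qnorm2 (letter_eval a x))) \<in> ?Q"
      by (intro value_cone.add value_cone_mult square_cone.square N value_cone_real bound)
    also have "(\<lambda>a. qnorm2 (reval a (Poly_Mapping.single (wletter x) 1))) * (\<lambda>a. N - qnorm2 (weval a w))
        + (\<lambda>a. N * (R - qnorm2 (letter_eval a x))) = (\<lambda>a. N * R - qnorm2 (weval a (wletter x + w)))"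
      by (simp add: fun_eq_iff qnorm2_mult algebra_simps)
    finally show ?case using N(1) R(1) by (intro exI[of _ "N * R"]) simp
  qed
  show ?thesis
  proof (induction x rule: rpoly_induct)
    case (single w c)
    obtain N where N: "N \<ge> 0" "(\<lambda>a. N - qnorm2 (weval a w)) \<in> ?Q" using word by blast
    have "(\<lambda>a. c\<^sup>2 * (N - qnorm2 (weval a w))) \<in> ?Q" by (intro value_cone_real N) simp
    also have "(\<lambda>a. c\<^sup>2 * (N - qnorm2 (weval a w)))
        = (\<lambda>a. c\<^sup>2 * N - qnorm2 (reval a (Poly_Mapping.single w c)))"
      by (simp add: fun_eq_iff qnorm2_def power_mult_distrib algebra_simps)
    finally show ?case using N(1) by (intro exI[of _ "c\<^sup>2 * N"]) simp
  next
    case (add p q)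
    then obtain N M where N: "N \<ge> 0" "(\<lambda>a. N - qnorm2 (reval a p)) \<in> ?Q"
      and M: "M \<ge> 0" "(\<lambda>a. M - qnorm2 (reval a q)) \<in> ?Q" by blast
    \<comment> \<open>The square of p - q completes the parallelogram law, which bounds the norm of
      p + q.\<close>
    have "(\<lambda>a. qnorm2 (heval a (hconst 1 * hpoly_of (p - q)))) \<in> ?Q"
      by (intro value_cone.square left_polys_hpoly_of)
    then have "(\<lambda>a. 2 * (N - qnorm2 (reval a p))) + (\<lambda>a. 2 * (M - qnorm2 (reval a q)))
        + (\<lambda>a. qnorm2 (heval a (hconst 1 * hpoly_of (p - q)))) \<in> ?Q"
      by (intro value_cone.add value_cone_real N M) auto
    also have "(\<lambda>a. 2 * (N - qnorm2 (reval a p))) + (\<lambda>a. 2 * (M - qnorm2 (reval a q)))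
        + (\<lambda>a. qnorm2 (heval a (hconst 1 * hpoly_of (p - q))))
        = (\<lambda>a. 2 * N + 2 * M - qnorm2 (reval a (p + q)))"
      by (simp add: fun_eq_iff reval_diff) (simp add: qnorm2_def power2_eq_square algebra_simps)
    finally show ?case using N(1) M(1) by (intro exI[of _ "2 * N + 2 * M"]) simp
  qed
qed

lemma value_cone_archimedean:
  assumes g: "\<And>i. i \<in> {1..m} \<Longrightarrow> g i \<in> rSym"
    and arch: "archimedean (quad_module m g l h)" and v: "v \<in> coeff_space"
  shows "\<exists>N. of_real N - v \<in> value_cone m g l h"
  using v
proof induction
  case (gen c x)
  let ?Q = "value_cone m g l h"
  obtain N where N: "(\<lambda>a. N - qnorm2 (reval a x)) \<in> ?Q" using normsq_bound_word[OF g arch] by blast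
  \<comment> \<open>The square of x - \<open>qcnj c\<close> bounds 2 Re (c x) by the sum of the
    squared norms of c and x.\<close>
  let ?p = "hconst (- qcnj c) * hpoly_of 1 + hconst 1 * hpoly_of x"
  have "(\<lambda>a. qnorm2 (heval a ?p)) \<in> ?Q"
    by (intro value_cone.square left_polys_add left_polys_hpoly_of)
  then have "(\<lambda>a. (1 / 2) * ((\<lambda>a. N - qnorm2 (reval a x)) + (\<lambda>a. qnorm2 (heval a ?p))) a) \<in> ?Q"
    by (intro value_cone_real value_cone.add N) auto
  also have "(\<lambda>a. (1 / 2) * ((\<lambda>a. N - qnorm2 (reval a x)) + (\<lambda>a. qnorm2 (heval a ?p))) a)
      = of_real ((N + qnorm2 c) / 2) - (\<lambda>a. qRe (c * reval a x))"
    by (simp add: fun_eq_iff of_real_fun) (simp add: qnorm2_def power2_eq_square field_simps)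
  finally show ?case by blast
next
  case (add v w)
  then obtain N M where "of_real N - v \<in> value_cone m g l h" "of_real M - w \<in> value_cone m g l h" by blast
  then have "(of_real N - v) + (of_real M - w) \<in> value_cone m g l h" by (rule value_cone.add)
  also have "(of_real N - v) + (of_real M - w) = of_real (N + M) - (v + w)" by simp
  finally show ?case by blast
qed

interpretation function_cone: semiring_cone "coeff_space :: (quat ^ 'n::finite \<Rightarrow> real) set" square_cone
proof
  fix v w t s :: "quat ^ 'n \<Rightarrow> real" and r :: real
  show "v \<in> coeff_space \<Longrightarrow> w \<in> coeff_space \<Longrightarrow> v + w \<in> coeff_space" by (rule coeff_space.add)
  show "t \<in> square_cone \<Longrightarrow> v \<in> coeff_space \<Longrightarrow> t * v \<in> coeff_space"
    using square_cone_poly coeff_space_mult_real by metis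
  show "v \<in> coeff_space \<Longrightarrow> of_real r * v \<in> coeff_space"
    by (rule coeff_space_mult_real[where z = "r *\<^sub>R 1"]) (simp_all add: reval_scaleR of_real_fun of_real_def)
  show "s \<in> square_cone \<Longrightarrow> t \<in> square_cone \<Longrightarrow> s + t \<in> square_cone" by (rule square_cone.add)
  show "s \<in> square_cone \<Longrightarrow> t \<in> square_cone \<Longrightarrow> s * t \<in> square_cone" by (rule square_cone_mult)
  show "r \<ge> 0 \<Longrightarrow> of_real r \<in> (square_cone :: (quat ^ 'n \<Rightarrow> real) set)" by (rule square_cone_real)
  show "t \<in> square_cone \<Longrightarrow> (of_real r - t)\<^sup>2 \<in> square_cone"
  proof -
    assume "t \<in> square_cone"
    then obtain z where z: "\<And>a. reval a z = of_real (t a)" using square_cone_poly by blast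
    have "(of_real r - t)\<^sup>2 = (\<lambda>a. qnorm2 (reval a (r *\<^sub>R 1 - z)))"
      by (simp add: fun_eq_iff power2_eq_square of_real_fun reval_diff reval_scaleR z qnorm2_def)
    then show ?thesis by (simp only: square_cone.square)
  qed
qed

lemma value_cone_module:
  assumes g: "\<And>i. i \<in> {1..m} \<Longrightarrow> g i \<in> rSym"
    and arch: "archimedean (quad_module m g l h)"
  shows "value_cone m g l h \<in> function_cone.modules"
  unfolding function_cone.modules_def
proof (intro CollectI conjI ballI)
  show "square_cone \<subseteq> value_cone m g l h"
  proof
    fix t :: "quat ^ 'a \<Rightarrow> real" assume "t \<in> square_cone"
    then show "t \<in> value_cone m g l h"
    proof induction
      case (square x)
      have "(\<lambda>a. qnorm2 (heval a (hconst 1 * hpoly_of x))) \<in> value_cone m g l h"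
        by (intro value_cone.square left_polys_hpoly_of)
      then show ?case by simp
    qed (rule value_cone.add)
  qed
qed (use value_cone_subset[OF g] value_cone_archimedean[OF g arch] in \<open>auto intro: value_cone.add value_cone_mult\<close>)

section \<open>The Positivstellensatz\<close>

lemma coeff_space_sum_rep:
  assumes "v \<in> coeff_space"
  shows "\<exists>n c x. v = (\<lambda>a. \<Sum>k<n::nat. qRe (c k * reval a (x k)))"
  using assms
proof induction
  case (gen c x)
  show ?case by (intro exI[of _ 1] exI[of _ "\<lambda>_. c"] exI[of _ "\<lambda>_. x"]) simp
next
  case (add v w)
  then obtain n c x n' c' x' where v: "v = (\<lambda>a. \<Sum>k<n::nat. qRe (c k * reval a (x k)))"
    and w: "w = (\<lambda>a. \<Sum>k<n'::nat. qRe (c' k * reval a (x' k)))" by blast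
  let ?c = "\<lambda>k. if k < n then c k else c' (k - n)" and ?x = "\<lambda>k. if k < n then x k else x' (k - n)"
  have "(v + w) a = (\<Sum>k<n + n'. qRe (?c k * reval a (?x k)))" for a
    unfolding v w plus_fun_apply sum_concat[symmetric] by (intro sum.cong) auto
  then show ?case by (intro exI[of _ "n + n'"] exI[of _ ?c] exI[of _ ?x]) (rule ext)
qed

text \<open>Cyclicity of the real part moves the left word behind the right one, leaving a single
  constant in front.\<close>

lemma coeff_space_middle_polys: "p \<in> middle_polys \<Longrightarrow> (\<lambda>a. qRe (heval a p)) \<in> coeff_space"
proof (induction p rule: middle_polys_induct)
  case (gen u c v)
  have "(\<lambda>a. qRe (heval a (hword u * hconst c * hword v)))
      = (\<lambda>a. qRe (c * reval a (Poly_Mapping.single (v + u) 1)))"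
  proof
    fix a
    show "qRe (heval a (hword u * hconst c * hword v)) = qRe (c * reval a (Poly_Mapping.single (v + u) 1))"
      using qRe_cyc[of "weval a u" "c * weval a v"]
      by (simp add: heval_hword mult.assoc del: times_quat.sel)
  qed
  then show ?case by (simp only: coeff_space.gen)
next
  case (add p q)
  then show ?case using coeff_space.add[OF add] by (simp add: plus_fun_def)
qed

text \<open>The images of the letters \<open>LQ i\<close> are the coordinates of the point;
  compatibility with the involution then determines the images of the conjugate letters.\<close>

lemma homomorphism_is_evaluation:
  fixes \<psi> :: "'n::finite rpoly \<Rightarrow> quat"
  assumes add: "\<And>x y. \<psi> (x + y) = \<psi> x + \<psi> y" and scale: "\<And>r x. \<psi> (r *\<^sub>R x) = r *\<^sub>R \<psi> x"
    and mult: "\<And>x y. \<psi> (x * y) = \<psi> x * \<psi> y" and one: "\<psi> 1 = 1"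
    and star: "\<And>x. \<psi> (rstar x) = qcnj (\<psi> x)"
  shows "\<exists>a. \<forall>x. \<psi> x = reval a x"
proof -
  let ?w = "\<lambda>w. Poly_Mapping.single w (1 :: real) :: 'n rpoly"
  define a :: "quat ^ 'n" where "a = (\<chi> i. \<psi> (?w (wletter (LQ i))))"
  have letter: "\<psi> (?w (wletter x)) = letter_eval a x" for x
  proof (cases x)
    case (LQbar i)
    have "?w (wletter x) = rstar (?w (wletter (LQ i)))" by (simp add: LQbar)
    then have "\<psi> (?w (wletter x)) = qcnj (\<psi> (?w (wletter (LQ i))))" by (simp only: star)
    then show ?thesis by (simp add: LQbar a_def)
  qed (simp add: a_def)
  have word: "\<psi> (?w w) = weval a w" for w
  proof (induction w rule: qword_induct)
    case (letter x w)
    have "?w (wletter x + w) = ?w (wletter x) * ?w w" by (simp add: mult_single)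
    then show ?case using letter by (simp add: mult \<open>\<And>x. \<psi> (?w (wletter x)) = letter_eval a x\<close>)
  qed (simp add: one)
  have "\<psi> x = reval a x" for x
  proof (induction x rule: rpoly_induct)
    case (single w c)
    have "Poly_Mapping.single w c = c *\<^sub>R ?w w" by (simp add: scaleR_single)
    then show ?case by (simp only: scale word reval_scaleR reval_single scaleR_one)
  qed (simp add: add)
  then show ?thesis by blast
qed

theorem theorem4p11:
  fixes f :: "'n::finite hpoly"
    and g h :: "nat \<Rightarrow> 'n rpoly"
    and m l :: nat
  assumes "f \<in> hSym middle_polys"
    and "\<And>i. i \<in> {1..m} \<Longrightarrow> g i \<in> rSym"
    and "archimedean (quad_module m g l h)"
    and "\<And>a. a \<in> K_set m g l h \<Longrightarrow> qRe (heval a f) > 0"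
  shows "\<exists>q \<in> quad_module m g l h. \<exists>r \<in> vanishing_ideal \<inter> hSym middle_polys. f = q + r"
proof -
  let ?Q = "value_cone m g l h"
  define F where "F = (\<lambda>a. qRe (heval a f))"
  have f: "f \<in> middle_polys" "hstar f = f" using assms(1) by (auto simp: hSym_def)
  have F: "F \<in> coeff_space" unfolding F_def by (rule coeff_space_middle_polys[OF f(1)])
  have mod: "?Q \<in> function_cone.modules" by (rule value_cone_module[OF assms(2,3)])
  have QV: "?Q \<subseteq> coeff_space" by (rule value_cone_subset[OF assms(2)])
  have "F \<in> ?Q"
  proof (rule ccontr)
    assume "F \<notin> ?Q"
    then obtain \<phi> :: "(quat ^ 'n \<Rightarrow> real) \<Rightarrow> real" where
      add: "\<And>v w. v \<in> coeff_space \<Longrightarrow> w \<in> coeff_space \<Longrightarrow> \<phi> (v + w) = \<phi> v + \<phi> w"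
      and scale: "\<And>r v. v \<in> coeff_space \<Longrightarrow> \<phi> (of_real r * v) = r * \<phi> v"
      and mult: "\<And>t v. t \<in> square_cone \<Longrightarrow> v \<in> coeff_space \<Longrightarrow> \<phi> (t * v) = \<phi> t * \<phi> v"
      and pos: "\<And>v. v \<in> ?Q \<Longrightarrow> \<phi> v \<ge> 0" and one: "\<phi> 1 = 1" and fneg: "\<phi> F \<le> 0"
      using function_cone.separating_functional[OF mod F] by metis
    define \<beta> where "\<beta> c x = \<phi> (\<lambda>a. qRe (c * reval a x))" for c x
    have sum: "\<phi> (\<lambda>a. \<Sum>k\<in>A. v k a) = (\<Sum>k\<in>A. \<phi> (v k))"
      if "finite A" "\<And>k. k \<in> A \<Longrightarrow> v k \<in> coeff_space" for A :: "nat set" and v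
    proof -
      have z: "(\<lambda>a. 0) \<in> (coeff_space :: (quat ^ 'n \<Rightarrow> real) set)"
        using coeff_space.gen[of 0 0] by simp
      have "\<phi> (\<lambda>a. 0) = 0"
        using scale[OF z, of 0] by (simp add: times_fun_def)
      moreover have "(\<lambda>a. \<Sum>k\<in>A. v k a) \<in> coeff_space \<and> \<phi> (\<lambda>a. \<Sum>k\<in>A. v k a) = (\<Sum>k\<in>A. \<phi> (v k))"
        using that
      proof (induction A rule: finite_induct)
        case (insert k A)
        have e: "(\<lambda>a. \<Sum>k\<in>insert k A. v k a) = v k + (\<lambda>a. \<Sum>k\<in>A. v k a)"
          using insert.hyps by (simp add: fun_eq_iff)
        have IH: "(\<lambda>a. \<Sum>k\<in>A. v k a) \<in> coeff_space" "\<phi> (\<lambda>a. \<Sum>k\<in>A. v k a) = (\<Sum>k\<in>A. \<phi> (v k))"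
          using insert.IH insert.prems by auto
        have vk: "v k \<in> coeff_space" using insert.prems by simp
        show ?case unfolding e using insert.hyps
          by (simp only: add[OF vk IH(1)] IH(2) sum.insert coeff_space.add[OF vk IH(1)] simp_thms)
      qed (simp add: z calculation)
      ultimately show ?thesis by blast
    qed
    have sq: "\<phi> ((\<lambda>a. qnorm2 (reval a y)) * v) = \<beta> 1 (y * rstar y) * \<phi> v" if "v \<in> coeff_space" for y v
    proof -
      have "(\<lambda>a. qnorm2 (reval a y)) = (\<lambda>a. qRe (1 * reval a (y * rstar y)))"
        by (simp add: fun_eq_iff reval_rstar qcnj_mult_self del: times_quat.sel)
      then have "\<beta> 1 (y * rstar y) = \<phi> (\<lambda>a. qnorm2 (reval a y))" by (simp only: \<beta>_def)
      then show ?thesis by (simp only: mult[OF square_cone.square that])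
    qed
    interpret quat_state rstar \<beta>
    proof
      fix x y s :: "'n rpoly" and c c' :: quat and r :: real
      show "rstar (x + y) = rstar x + rstar y" "rstar (x * y) = rstar y * rstar x"
        "rstar (rstar x) = x" "rstar (r *\<^sub>R x) = r *\<^sub>R rstar x"
        by (simp_all add: rstar_scaleR)
      show "\<beta> (c + c') x = \<beta> c x + \<beta> c' x"
        using add[OF coeff_space.gen coeff_space.gen, of c x c' x]
        by (simp add: \<beta>_def plus_fun_def distrib_right del: times_quat.sel)
      show "\<beta> c (x + y) = \<beta> c x + \<beta> c y"
        using add[OF coeff_space.gen coeff_space.gen, of c x c y]
        by (simp add: \<beta>_def plus_fun_def distrib_left del: times_quat.sel)
      show "\<beta> (r *\<^sub>R c) x = r * \<beta> c x"
        using scale[OF coeff_space.gen, of r c x]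
        by (simp add: \<beta>_def times_fun_def of_real_fun del: times_quat.sel)
      show "\<beta> c (r *\<^sub>R x) = r * \<beta> c x"
        using scale[OF coeff_space.gen, of r c x]
        by (simp add: \<beta>_def times_fun_def of_real_fun reval_scaleR del: times_quat.sel)
      show "\<beta> c 1 = qRe c"
      proof -
        have "1 \<in> (coeff_space :: (quat ^ 'n \<Rightarrow> real) set)"
          using coeff_space.gen[of 1 1] by (simp add: one_fun_def)
        from scale[OF this, of "qRe c"] show ?thesis
          by (simp add: \<beta>_def one of_real_fun)
      qed
      show "\<beta> (qcnj c) (rstar x) = \<beta> c x"
      proof -
        have "qRe (qcnj c * reval a (rstar x)) = qRe (c * reval a x)" for a
          using qRe_cyc[of "reval a x" c] by (simp add: reval_rstar)
        then show ?thesis by (simp add: \<beta>_def)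
      qed
      show "\<beta> 1 (x * y) = \<beta> 1 (y * x)"
        using qRe_cyc by (simp add: \<beta>_def del: times_quat.sel)
      show "0 \<le> (\<Sum>k<n. \<Sum>j<n. \<beta> (qcnj (cs k) * cs j) (xs j * rstar (xs k)))"
        for n :: nat and cs :: "nat \<Rightarrow> quat" and xs :: "nat \<Rightarrow> 'n rpoly"
      proof -
        \<comment> \<open>Its squared norm expands, by cyclicity, into the double sum required for
          positivity.\<close>
        let ?p = "\<Sum>k<n. hconst (cs k) * hpoly_of (xs k)"
        have "?p \<in> left_polys"
        proof (induction n)
          case 0
          then show ?case using left_polys_hpoly_of[of 0 0] by (simp add: hconst_simps)
        qed (simp add: left_polys_add left_polys_hpoly_of)
        then have "0 \<le> \<phi> (\<lambda>a. qnorm2 (heval a ?p))" by (intro pos value_cone.square)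
        also have "(\<lambda>a. qnorm2 (heval a ?p))
            = (\<lambda>a. \<Sum>k<n. \<Sum>j<n. qRe (qcnj (cs k) * cs j * reval a (xs j * rstar (xs k))))"
        proof
          fix a
          have "qRe (qcnj (cs k * reval a (xs k)) * (cs j * reval a (xs j)))
              = qRe (qcnj (cs k) * cs j * reval a (xs j * rstar (xs k)))" for k j
            using qRe_cyc[of "qcnj (reval a (xs k))" "qcnj (cs k) * cs j * reval a (xs j)"]
            by (simp add: reval_rstar mult.assoc del: times_quat.sel)
          then show "qnorm2 (heval a ?p)
              = (\<Sum>k<n. \<Sum>j<n. qRe (qcnj (cs k) * cs j * reval a (xs j * rstar (xs k))))"
            unfolding qnorm2_conv heval_sum qcnj_sum sum_product qRe_sum heval_simps heval_hconst by simp
        qed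
        also have "\<phi> \<dots> = (\<Sum>k<n. \<phi> (\<lambda>a. \<Sum>j<n. qRe (qcnj (cs k) * cs j * reval a (xs j * rstar (xs k)))))"
        proof (rule sum)
          show "(\<lambda>a. \<Sum>j<n. qRe (qcnj (cs k) * cs j * reval a (xs j * rstar (xs k)))) \<in> coeff_space" for k
          proof (induction n)
            case 0
            then show ?case using coeff_space.gen[of 0 0] by simp
          next
            case (Suc n)
            from coeff_space.add[OF this coeff_space.gen[of "qcnj (cs k) * cs n" "xs n * rstar (xs k)"]]
            show ?case by (simp add: plus_fun_def del: times_quat.sel)
          qed
        qed simp
        also have "\<dots> = (\<Sum>k<n. \<Sum>j<n. \<beta> (qcnj (cs k) * cs j) (xs j * rstar (xs k)))"
          unfolding \<beta>_def by (intro sum.cong refl sum coeff_space.gen) simp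
        finally show ?thesis .
      qed
      show "\<beta> c (x * s) = \<beta> 1 s * \<beta> c x" if s: "rstar s = s"
      proof -
        have re: "reval a s = of_real (qRe (reval a s))" for a
          using s by (intro reval_real) (simp add: rSym_def)
        let ?v = "\<lambda>a. qRe (c * reval a x)" and ?S = "\<lambda>a. qRe (1 * reval a s)"
        \<comment> \<open>Multiplicativity is known for squares only. For real-valued s the squared
          norm of 1 + s is 1 + 2 s plus that of s, so comparing the two squares isolates
          multiplication by s.\<close>
        have polar: "\<phi> (?S * v) = \<phi> ?S * \<phi> v" if v: "v \<in> coeff_space" for v
        proof -
          have oneV: "1 \<in> (coeff_space :: (quat ^ 'n \<Rightarrow> real) set)"
            using coeff_space.gen[of 1 1] by (simp add: one_fun_def)
          have sqv: "(\<lambda>a. qnorm2 (reval a (1 + s))) * v \<in> coeff_space" if "v \<in> coeff_space" for v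
            using that function_cone.V_mult square_cone.square by blast
          have Sv: "?S * v \<in> coeff_space" if "v \<in> coeff_space" for v
            using that re by (intro coeff_space_mult_real[where z = s]) auto
          have exp: "(\<lambda>a. qnorm2 (reval a (1 + s))) * v
              = v + (of_real 2 * (?S * v) + (\<lambda>a. qnorm2 (reval a s)) * v)" for v
          proof
            fix a
            show "((\<lambda>a. qnorm2 (reval a (1 + s))) * v) a
              = (v + (of_real 2 * (?S * v) + (\<lambda>a. qnorm2 (reval a s)) * v)) a"
              using arg_cong[OF re[of a], of qI] arg_cong[OF re[of a], of qJ] arg_cong[OF re[of a], of qK]
              by (simp add: of_real_fun qnorm2_def power2_eq_square algebra_simps)
          qed
          have lin: "\<phi> ((\<lambda>a. qnorm2 (reval a (1 + s))) * v)
              = \<phi> v + (2 * \<phi> (?S * v) + \<beta> 1 (s * rstar s) * \<phi> v)" if v: "v \<in> coeff_space" for v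
          proof -
            have sv: "(\<lambda>a. qnorm2 (reval a s)) * v \<in> coeff_space"
              using v function_cone.V_mult square_cone.square by blast
            show ?thesis
              unfolding exp using v sv Sv[OF v]
              by (simp only: add scale sq function_cone.V_add function_cone.V_scale)
          qed
          have "\<phi> v + (2 * \<phi> (?S * v) + \<beta> 1 (s * rstar s) * \<phi> v)
              = (\<phi> 1 + (2 * \<phi> (?S * 1) + \<beta> 1 (s * rstar s) * \<phi> 1)) * \<phi> v"
            using lin[OF v] lin[OF oneV] sq[OF v, of "1 + s"] sq[OF oneV, of "1 + s"] one by simp
          then show ?thesis using one by (simp add: algebra_simps)
        qed
        have "(\<lambda>a. qRe (c * reval a (x * s))) = ?S * ?v"
        proof
          fix a
          have "c * reval a (x * s) = (c * reval a x) * of_real (qRe (reval a s))"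
            using re[of a] by (simp add: mult.assoc)
          then show "qRe (c * reval a (x * s)) = (?S * ?v) a"
            by (simp only: qRe_mult_of_real times_fun_def mult.commute mult_1_left)
        qed
        then show ?thesis using polar[OF coeff_space.gen, of c x] by (simp only: \<beta>_def)
      qed
    qed
    obtain n c x where rep: "F = (\<lambda>a. \<Sum>k<n::nat. qRe (c k * reval a (x k)))"
      using coeff_space_sum_rep[OF F] by blast
    obtain \<psi> where \<psi>: "\<psi> \<in> evaluations" "(\<Sum>k<n. qRe (c k * \<psi> (x k))) \<le> (\<Sum>k<n. \<beta> (c k) (x k))"
      using evaluation_below by blast
    obtain a where a: "\<And>y. \<psi> y = reval a y"
      using homomorphism_is_evaluation[of \<psi>] \<psi>(1) unfolding evaluations_def by blast
    have re: "qRe (reval a y) = \<beta> 1 y" for y using \<psi>(1) by (simp add: evaluations_def a)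
    have "a \<in> K_set m g l h"
      unfolding K_set_def
    proof (intro CollectI conjI ballI)
      fix i assume i: "i \<in> {1..m}"
      \<comment> \<open>The weight 1 places \<open>g i\<close> itself in the cone, so its state
        value, which is its value at a, is nonnegative.\<close>
      have "(\<lambda>a. qnorm2 (heval a (hconst 1 * hpoly_of 1)) * qRe (reval a (g i))) \<in> ?Q"
        by (intro value_cone.weight left_polys_hpoly_of i)
      then have "0 \<le> \<beta> 1 (g i)" using pos by (fastforce simp: \<beta>_def qnorm2_def)
      then show "0 \<le> qRe (reval a (g i))" by (simp add: re)
    next
      fix j assume j: "j \<in> {1..l}"
      \<comment> \<open>Taking c = 1 and c = - 1 forces the state value to be 0, and this value is
        the squared norm of h j at a.\<close>
      have "0 \<le> \<beta> c (1 * h j * rstar (h j))" for c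
        unfolding \<beta>_def by (intro pos value_cone.ideal j)
      from this[of 1] this[of "- 1"] have "\<beta> 1 (h j * rstar (h j)) = 0"
        using \<beta>_scale_left[of "- 1" 1] by simp
      then have "qnorm2 (reval a (h j)) = 0"
        using re[of "h j * rstar (h j)"] by (simp add: reval_rstar qcnj_mult_self del: times_quat.sel)
      then show "reval a (h j) = 0" by (simp add: qnorm2_eq_0_iff)
    qed
    then have "0 < F a" using assms(4) by (simp add: F_def)
    also have "F a \<le> (\<Sum>k<n. \<beta> (c k) (x k))" using \<psi>(2) by (simp add: rep a)
    also have "\<dots> = \<phi> F" unfolding rep \<beta>_def by (intro sum[symmetric] coeff_space.gen) simp
    finally show False using fneg by simp
  qed
  then have "\<exists>q\<in>quad_module m g l h \<inter> hSym middle_polys. \<forall>a. heval a q = of_real (F a)"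
    by (rule value_cone_realize[rotated]) (rule assms(2))
  then obtain q where q: "q \<in> quad_module m g l h" "q \<in> hSym middle_polys" "\<And>a. heval a q = of_real (F a)"
    by blast
  have "f - q \<in> vanishing_ideal"
    using q(3) heval_real[OF f(2)] by (simp add: vanishing_ideal_def heval_diff F_def)
  moreover have "f + (- 1) *\<^sub>R q \<in> middle_polys"
    using f(1) q(2) by (intro middle_polys_add middle_polys_scaleR) (auto simp: hSym_def)
  moreover have "hstar (f + (- 1) *\<^sub>R q) = f + (- 1) *\<^sub>R q"
    using hstar_simps(1)[of f "- q"] f(2) q(2) by (simp add: hSym_def hstar_minus del: hstar_simps)
  ultimately show ?thesis
    using q(1) by (intro bexI[of _ q] bexI[of _ "f - q"]) (auto simp: hSym_def)
qed

end
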